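(* Let $V(z;t)$, $t\in[0,t_0]$, be a one-parameter family of real analytic functions such that (a) there is a domain $\Omega\subset\mathbb C$ with $\mathbb R\subset\Omega$ such that $V(z;t)$ is analytic on $\Omega\times[0,t_0]$; (b) $\lim_{|x|\to\infty}\frac{\min\{V(x;t):0\le t\le t_0\}}{\log|x|}=\infty$; (c) $V(z;t)$ is one-cut regular for $0<t\le t_0$; (d) $V(z;0)$ is one-cut singular and $h(a)\ne0$, $h(b)\ne0$, where $[a,b]$ is the support of the equilibrium measure of $V(z;0)$. Then the end-points $a(t),b(t)$ of the support of the equilibrium measure of $V(z;t)$ are analytic on $[0,t_0]$.
   Context: Equilibrium measure of $V$: minimizer of $-\iint\log|x-y|d\nu d\nu+\int Vd\nu$ over Borel probability measures on $\mathbb R$. $V$ is one-cut if the support is a single interval $[a,b]$; then the density is $\frac1{2\pi}h(x)\sqrt{(b-x)(x-a)}$ with $h$ real analytic. One-cut regular: moreover $h>0$ on $[a,b]$ and $\int\log|x-y|d\nu_{eq}(y)-V(x)/2<l$ strictly for $x\notin[a,b]$, $l$ the constant value of the left side on $[a,b]$; one-cut singular: one-cut but not regular. Analytic on $[0,t_0]$ means extending to a real analytic function on an open interval containing $[0,t_0]$. *)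

theory Defs
  imports "HOL-Probability.Probability"
begin

definition real_analytic_at :: "(real \<Rightarrow> real) \<Rightarrow> real \<Rightarrow> bool" where
  "real_analytic_at f x \<longleftrightarrow>
     (\<exists>r>0. \<exists>c::nat \<Rightarrow> real. \<forall>y. \<bar>y - x\<bar> < r \<longrightarrow> (\<lambda>n. c n * (y - x) ^ n) sums f y)"

definition real_analytic_on :: "real set \<Rightarrow> (real \<Rightarrow> real) \<Rightarrow> bool" where
  "real_analytic_on S f \<longleftrightarrow> (\<forall>x\<in>S. real_analytic_at f x)"

definition analytic_on_closed_interval :: "(real \<Rightarrow> real) \<Rightarrow> real \<Rightarrow> real \<Rightarrow> bool" where
  "analytic_on_closed_interval f a b \<longleftrightarrow>
     (\<exists>c d g. c < a \<and> b < d \<and> real_analytic_on {c<..<d} g \<and> (\<forall>x\<in>{a..b}. g x = f x))"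

definition log_kernel :: "(real \<Rightarrow> real) \<Rightarrow> real \<Rightarrow> real \<Rightarrow> ereal" where
  "log_kernel V x y =
     (if x = y then \<infinity> else ereal (- ln \<bar>x - y\<bar> + V x / 2 + V y / 2))"

text \<open>The energy -\<integral>\<integral>log|x-y| d\<nu> d\<nu> + \<integral> V d\<nu>, written as the double integral of
  the symmetrised kernel (positive part minus negative part).\<close>
definition energy :: "(real \<Rightarrow> real) \<Rightarrow> real measure \<Rightarrow> ereal" where
  "energy V \<nu> =
     enn2ereal (\<integral>\<^sup>+ x. \<integral>\<^sup>+ y. e2ennreal (max 0 (log_kernel V x y)) \<partial>\<nu> \<partial>\<nu>)
   - enn2ereal (\<integral>\<^sup>+ x. \<integral>\<^sup>+ y. e2ennreal (max 0 (- log_kernel V x y)) \<partial>\<nu> \<partial>\<nu>)"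

definition borel_prob :: "real measure \<Rightarrow> bool" where
  "borel_prob \<mu> \<longleftrightarrow> sets \<mu> = sets borel \<and> prob_space \<mu>"

definition equilibrium_measure :: "(real \<Rightarrow> real) \<Rightarrow> real measure \<Rightarrow> bool" where
  "equilibrium_measure V \<nu> \<longleftrightarrow>
     borel_prob \<nu> \<and> (\<forall>\<mu>. borel_prob \<mu> \<longrightarrow> energy V \<nu> \<le> energy V \<mu>)"

definition msupp :: "real measure \<Rightarrow> real set" where
  "msupp \<nu> = {x. \<forall>e>0. emeasure \<nu> {x - e<..<x + e} > 0}"

definition eff_potential :: "(real \<Rightarrow> real) \<Rightarrow> real measure \<Rightarrow> real \<Rightarrow> real" where
  "eff_potential V \<nu> x = (\<integral> y. ln \<bar>x - y\<bar> \<partial>\<nu>) - V x / 2"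

definition one_cut_data ::
  "(real \<Rightarrow> real) \<Rightarrow> real \<Rightarrow> real \<Rightarrow> (real \<Rightarrow> real) \<Rightarrow> real measure \<Rightarrow> bool" where
  "one_cut_data V a b h \<nu> \<longleftrightarrow>
     equilibrium_measure V \<nu> \<and> a < b \<and> msupp \<nu> = {a..b} \<and>
     analytic_on_closed_interval h a b \<and>
     \<nu> = density lborel
           (\<lambda>x. ennreal (indicator {a..b} x * (1 / (2 * pi)) * h x * sqrt ((b - x) * (x - a))))"

definition one_cut :: "(real \<Rightarrow> real) \<Rightarrow> bool" where
  "one_cut V \<longleftrightarrow> (\<exists>a b h \<nu>. one_cut_data V a b h \<nu>)"

definition one_cut_regular :: "(real \<Rightarrow> real) \<Rightarrow> bool" where
  "one_cut_regular V \<longleftrightarrow>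
     (\<exists>a b h \<nu>. one_cut_data V a b h \<nu> \<and> (\<forall>x\<in>{a..b}. h x > 0) \<and>
        (\<forall>x\<in>{a..b}. eff_potential V \<nu> x = eff_potential V \<nu> a) \<and>
        (\<forall>x. x \<notin> {a..b} \<longrightarrow> eff_potential V \<nu> x < eff_potential V \<nu> a))"

definition one_cut_singular :: "(real \<Rightarrow> real) \<Rightarrow> bool" where
  "one_cut_singular V \<longleftrightarrow> one_cut V \<and> \<not> one_cut_regular V"

end

theory Submission
  imports Defs "HOL-Complex_Analysis.Complex_Analysis"
begin

text \<open>
  Parametrise intervals as \<open>[m - r, m + r]\<close> and let \<open>J\<^sub>t(m, r)\<close> be the mean of \<open>V(\<cdot>;t)\<close> against the arcsine law of
  the interval, minus \<open>2 ln r\<close> (the Mhaskar--Saff functional). The potential of the arcsine law is constant on its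
  interval and larger outside; integrating the Euler--Lagrange inequalities of the equilibrium measure against it shows that
  the support of the equilibrium measure is the unique minimiser of \<open>J\<^sub>t\<close>, the square-root behaviour of the density at
  the endpoints (\<open>h(a), h(b) \<noteq> 0\<close>) excluding larger intervals. Hence the endpoints solve \<open>\<nabla> J\<^sub>t = 0\<close>, and they depend
  continuously on \<open>t\<close> by compactness. The same square-root behaviour makes \<open>J\<^sub>t\<close> grow quadratically when an endpoint moves
  inwards, so the Hessian is invertible, and the implicit function theorem in the complexified variables
  gives analyticity.
\<close>

section \<open>The logarithmic potential of the arcsine law\<close>

text \<open>All parameters in [0, t_0] are treated alike, although the potential at 0 is singular.
  The local input is that the density stays above a multiple of the square root of the distance to
  each endpoint; positivity of \<open>h\<close> gives this for t > 0, and the condition on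
  \<open>h a\<close> and \<open>h b\<close> gives it at t = 0. Positivity of a quadratic form in two
  directions does not in general make it invertible. An integration by parts at the critical point
  makes the two diagonal entries of the Hessian equal; the two directions that move a single
  endpoint are then eigenvectors and decide the determinant. The conclusion speaks of every
  equilibrium measure, so the support must be shown not to depend on the choice. This rests on
  positive definiteness of the logarithmic energy, obtained from an explicit real integral formula.
  On the complex side, the working notion is continuity together with holomorphy in each variable.
  Cauchy's formula upgrades it to continuous partial derivatives, the inverse function theorem is
  applied over the reals, and complex homogeneity is recovered afterwards from the
  derivative.\<close>

lemma ln_abs_set_integrable:
  fixes R :: real
  shows "set_integrable lborel {-R..R} (\<lambda>u. ln \<bar>u\<bar>)"
proof -
  have pos: "set_integrable lborel {0..R} (\<lambda>u. ln u)" if "R \<ge> 1" for R :: real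
  proof -
    have 1: "set_integrable lborel {0..1} (\<lambda>u::real. - ln u)"
    proof -
      \<comment> \<open>The antiderivative \<open>u - u * ln u\<close> extends continuously to 0, so
        the fundamental theorem applies up to the singularity; the constant sign of
        \<open>ln\<close> on [0, 1] then upgrades integrability to absolute integrability.\<close>
      have "((\<lambda>u::real. - ln u) has_integral ((1 - 1 * ln 1) - (0 - 0 * ln 0))) {0..1}"
      proof (rule fundamental_theorem_of_calculus_interior)
        show "continuous_on {0..1} (\<lambda>u::real. u - u * ln u)"
        proof -
          have "continuous (at u within {0..1}) (\<lambda>u::real. u - u * ln u)" if "u \<in> {0..1}" for u
          proof (cases "u = 0")
            case True
            have "((\<lambda>u::real. u - u * ln u) \<longlongrightarrow> 0) (at_right 0)"
              by real_asymp
            then have "((\<lambda>u::real. u - u * ln u) \<longlongrightarrow> 0) (at 0 within {0..1})"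
              by (rule tendsto_mono[rotated]) (auto intro!: at_within_le_at simp: at_within_Icc_at_right)
            then show ?thesis using True by (simp add: continuous_within)
          next
            case False
            then show ?thesis using that by (auto intro!: continuous_intros)
          qed
          then show ?thesis by (simp add: continuous_on_eq_continuous_within)
        qed
        fix x :: real assume "x \<in> {0<..<1}"
        then show "((\<lambda>u. u - u * ln u) has_vector_derivative - ln x) (at x)"
          unfolding has_real_derivative_iff_has_vector_derivative[symmetric]
          by (auto intro!: derivative_eq_intros)
      qed auto
      then have "(\<lambda>u::real. - ln u) absolutely_integrable_on {0..1}"
      proof (intro nonnegative_absolutely_integrable_1)
        fix x :: real assume "x \<in> {0..1}"
        then show "0 \<le> - ln x" by (cases "x = 0") auto
      qed (auto simp: has_integral_integrable)
      then show ?thesis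
        by (subst set_integrable_def) (auto simp: set_integrable_def integrable_completion)
    qed
    have 2: "set_integrable lborel {1..R} (\<lambda>u::real. ln u)"
      by (rule borel_integrable_atLeastAtMost') (auto intro!: continuous_intros)
    have "set_integrable lborel ({0..1} \<union> {1..R}) (\<lambda>u::real. ln u)"
      using 1 2 by (intro set_integrable_Un) (auto simp: set_integrable_def)
    moreover have "{0..1} \<union> {1..R} = {0..R}" using that by auto
    ultimately show ?thesis by simp
  qed
  define R' where "R' = max R 1"
  have a: "set_integrable lborel {0..R'} (\<lambda>u. ln \<bar>u\<bar>)"
    using pos[of R'] by (rule set_integrable_cong[THEN iffD1, rotated -1]) (auto simp: R'_def)
  have b: "set_integrable lborel {-R'..0} (\<lambda>u. ln \<bar>u\<bar>)"
  proof -
    have "integrable lborel (\<lambda>u. indicator {0..R'} (0 + (-1) * u) *\<^sub>R ln \<bar>0 + (-1) * u\<bar>)"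
      by (rule lborel_integrable_real_affine) (use a in \<open>auto simp: set_integrable_def\<close>)
    then show ?thesis unfolding set_integrable_def
      by (rule Bochner_Integration.integrable_cong[THEN iffD1, rotated -1]) (auto split: split_indicator)
  qed
  have "set_integrable lborel ({-R'..0} \<union> {0..R'}) (\<lambda>u. ln \<bar>u\<bar>)"
    using a b by (intro set_integrable_Un) auto
  then show ?thesis
    by (rule set_integrable_subset) (auto simp: R'_def)
qed

section \<open>Averages over an angle uniform on [0, pi], whose cosine follows the arcsine
  law\<close>

definition angle :: "real measure" where
  "angle = uniform_measure lborel {0..pi}"

lemma sets_angle [simp, measurable_cong]: "sets angle = sets borel"
  by (simp add: angle_def)

lemma space_angle [simp]: "space angle = UNIV"
  by (simp add: angle_def)

lemma prob_space_angle: "prob_space angle"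
  unfolding angle_def by (rule prob_space_uniform_measure) auto

interpretation angle: prob_space angle by (rule prob_space_angle)

lemma angle_density: "angle = density lborel (\<lambda>x. ennreal (indicator {0..pi} x / pi))"
  unfolding angle_def uniform_measure_def
  by (rule density_cong) (auto split: split_indicator simp: ennreal_1[symmetric] divide_ennreal simp del: ennreal_1)

lemma AE_angle: "(AE x in angle. P x) \<longleftrightarrow> (AE x in lborel. x \<in> {0..pi} \<longrightarrow> P x)"
  unfolding angle_def by (subst AE_uniform_measure) auto

lemma integrable_angle:
  fixes f :: "real \<Rightarrow> real"
  assumes [measurable]: "f \<in> borel_measurable borel"
  shows "integrable angle f \<longleftrightarrow> set_integrable lborel {0..pi} f"
proof -
  have "integrable angle f \<longleftrightarrow> integrable lborel (\<lambda>x. (indicator {0..pi} x / pi) *\<^sub>R f x)"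
    unfolding angle_density by (rule integrable_density) (auto)
  also have "\<dots> \<longleftrightarrow> integrable lborel (\<lambda>x. (1/pi) * (indicator {0..pi} x *\<^sub>R f x))"
    by (simp add: field_simps)
  also have "\<dots> \<longleftrightarrow> set_integrable lborel {0..pi} f"
    unfolding set_integrable_def by (subst integrable_mult_left_iff) auto
  finally show ?thesis .
qed

lemma integral_angle:
  fixes f :: "real \<Rightarrow> real"
  assumes [measurable]: "f \<in> borel_measurable borel"
  shows "integral\<^sup>L angle f = (LINT x:{0..pi}|lborel. f x) / pi"
proof -
  have "integral\<^sup>L angle f = (\<integral>x. (indicator {0..pi} x / pi) *\<^sub>R f x \<partial>lborel)"
    unfolding angle_density by (rule integral_density) (auto)
  also have "\<dots> = (\<integral>x. (1/pi) *\<^sub>R (indicator {0..pi} x *\<^sub>R f x) \<partial>lborel)"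
    by (simp add: field_simps)
  finally show ?thesis
    unfolding set_lebesgue_integral_def by (simp add: field_simps)
qed

text \<open>Invariance of the arcsine law under the Chebyshev map
  \<open>x \<mapsto> 2 * x\<^sup>2 - 1\<close>. Substituting u = 2 \<phi> spreads the integral over
  [0, 2 pi], and u \<mapsto> 2 pi - u folds the second half back onto the first because the cosine
  is unchanged.\<close>

lemma integral_angle_double:
  fixes f :: "real \<Rightarrow> real"
  assumes [measurable]: "f \<in> borel_measurable borel"
    and int: "integrable angle (\<lambda>\<phi>. f (cos \<phi>))"
  shows "integrable angle (\<lambda>\<phi>. f (cos (2 * \<phi>)))"
    and "(\<integral>\<phi>. f (cos (2 * \<phi>)) \<partial>angle) = (\<integral>\<phi>. f (cos \<phi>) \<partial>angle)"
proof -
  define I where "I = (LINT x:{0..pi}|lborel. f (cos x))"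
  have a: "set_integrable lborel {0..pi} (\<lambda>\<phi>. f (cos \<phi>))"
    using int by (subst (asm) integrable_angle) auto
  have 1: "has_bochner_integral lborel (\<lambda>u. indicator {0..pi} u * f (cos u)) I"
    using a by (simp add: has_bochner_integral_iff I_def set_integrable_def set_lebesgue_integral_def)
  have "has_bochner_integral lborel (\<lambda>u. indicator {0..pi} (2*pi + (-1) * u) * f (cos (2*pi + (-1) * u))) (I /\<^sub>R \<bar>-1\<bar>)"
    using 1 by (subst lborel_has_bochner_integral_real_affine_iff[symmetric, of "-1::real"]) auto
  then have 2: "has_bochner_integral lborel (\<lambda>u. indicator {0..pi} (2*pi - u) * f (cos u)) I"
    by (simp add: cos_diff)
  have "has_bochner_integral lborel (\<lambda>u. indicator {0..pi} u * f (cos u) + indicator {0..pi} (2*pi - u) * f (cos u)) (I + I)"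
    by (intro has_bochner_integral_add 1 2)
  \<comment> \<open>The two indicators overlap only at u = pi, a null set.\<close>
  then have "has_bochner_integral lborel (\<lambda>u. indicator {0..2*pi} u * f (cos u)) (I + I)"
  proof (rule has_bochner_integralI_AE)
    show "AE x in lborel. indicator {0..pi} x * f (cos x) + indicator {0..pi} (2 * pi - x) * f (cos x) =
        indicator {0..2 * pi} x * f (cos x)"
      using AE_lborel_singleton[of pi] by eventually_elim (auto split: split_indicator)
  qed measurable
  then have "has_bochner_integral lborel (\<lambda>u. indicator {0..2*pi} (0 + 2 * u) * f (cos (0 + 2 * u))) ((I + I) /\<^sub>R \<bar>2\<bar>)"
    by (subst lborel_has_bochner_integral_real_affine_iff[symmetric, of "2::real"]) auto
  then have *: "has_bochner_integral lborel (\<lambda>u. indicator {0..pi} u * f (cos (2 * u))) I"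
    by (rule has_bochner_integral_cong[THEN iffD1, rotated -1]) (auto split: split_indicator)
  show "integrable angle (\<lambda>\<phi>. f (cos (2 * \<phi>)))"
    using * by (subst integrable_angle) (auto simp: set_integrable_def has_bochner_integral_iff)
  have "(\<integral>\<phi>. f (cos (2 * \<phi>)) \<partial>angle) = I / pi"
    using * by (subst integral_angle) (auto simp: set_lebesgue_integral_def has_bochner_integral_iff)
  moreover have "(\<integral>\<phi>. f (cos \<phi>) \<partial>angle) = I / pi"
    by (subst integral_angle) (auto simp: I_def)
  ultimately show "(\<integral>\<phi>. f (cos (2 * \<phi>)) \<partial>angle) = (\<integral>\<phi>. f (cos \<phi>) \<partial>angle)"
    by simp
qed

lemma integral_angle_reflect:
  fixes f :: "real \<Rightarrow> real"
  assumes [measurable]: "f \<in> borel_measurable borel"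
    and int: "integrable angle (\<lambda>\<phi>. f (cos \<phi>))"
  shows "integrable angle (\<lambda>\<phi>. f (- cos \<phi>))"
    and "(\<integral>\<phi>. f (- cos \<phi>) \<partial>angle) = (\<integral>\<phi>. f (cos \<phi>) \<partial>angle)"
proof -
  define I where "I = (LINT x:{0..pi}|lborel. f (cos x))"
  have a: "set_integrable lborel {0..pi} (\<lambda>\<phi>. f (cos \<phi>))"
    using int by (subst (asm) integrable_angle) auto
  have 1: "has_bochner_integral lborel (\<lambda>u. indicator {0..pi} u * f (cos u)) I"
    using a by (simp add: has_bochner_integral_iff I_def set_integrable_def set_lebesgue_integral_def)
  have "has_bochner_integral lborel (\<lambda>u. indicator {0..pi} (pi + (-1) * u) * f (cos (pi + (-1) * u))) (I /\<^sub>R \<bar>-1\<bar>)"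
    using 1 by (subst lborel_has_bochner_integral_real_affine_iff[symmetric, of "-1::real"]) auto
  then have *: "has_bochner_integral lborel (\<lambda>u. indicator {0..pi} u * f (- cos u)) I"
    by (rule has_bochner_integral_cong[THEN iffD1, rotated -1]) (auto split: split_indicator simp: cos_diff)
  show "integrable angle (\<lambda>\<phi>. f (- cos \<phi>))"
    using * by (subst integrable_angle) (auto simp: set_integrable_def has_bochner_integral_iff)
  have "(\<integral>\<phi>. f (- cos \<phi>) \<partial>angle) = I / pi"
    using * by (subst integral_angle) (auto simp: set_lebesgue_integral_def has_bochner_integral_iff)
  moreover have "(\<integral>\<phi>. f (cos \<phi>) \<partial>angle) = I / pi"
    by (subst integral_angle) (auto simp: I_def)
  ultimately show "(\<integral>\<phi>. f (- cos \<phi>) \<partial>angle) = (\<integral>\<phi>. f (cos \<phi>) \<partial>angle)"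
    by simp
qed

lemma sin_ge_chord:
  fixes x :: real
  assumes "0 \<le> x" "x \<le> pi / 2"
  shows "2 * x / pi \<le> sin x"
proof -
  have "concave_on {0..pi} sin"
    unfolding concave_on_def
    by (rule f''_ge0_imp_convex[where f' = "\<lambda>x. - cos x" and f'' = "\<lambda>x. sin x"])
       (auto intro!: derivative_eq_intros sin_ge_zero)
  then have "(1 - 2*x/pi) * sin 0 + (2*x/pi) * sin (pi/2) \<le> sin ((1 - 2*x/pi) *\<^sub>R 0 + (2*x/pi) *\<^sub>R (pi/2))"
    using assms by (intro concave_onD) (auto simp: field_simps)
  then show ?thesis by (simp add: field_simps)
qed

text \<open>Write the difference as \<open>2 * sin e * sin d\<close> with half difference d and half
  sum e; since d \<le> e \<le> pi - d, both sines are at least 2 d / pi. The bound has to be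
  quadratic, as the cosine is flat at 0 and pi; after taking logarithms the square costs only a
  factor 2.\<close>

lemma abs_cos_diff_ge:
  fixes s t :: real
  assumes "s \<in> {0..pi}" "t \<in> {0..pi}"
  shows "2 * (\<bar>s - t\<bar> / pi)\<^sup>2 \<le> \<bar>cos s - cos t\<bar>"
proof -
  have *: "2 * (\<bar>s - t\<bar> / pi)\<^sup>2 \<le> \<bar>cos s - cos t\<bar>" if "s \<in> {0..pi}" "t \<in> {0..pi}" "s \<le> t" for s t
  proof -
    define d where "d = (t - s) / 2"
    define e where "e = (s + t) / 2"
    have d: "0 \<le> d" "d \<le> pi/2" and e: "d \<le> e" "e \<le> pi - d"
      using that by (auto simp: d_def e_def field_simps)
    have sd: "2 * d / pi \<le> sin d" by (rule sin_ge_chord) (use d in auto)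
    have se: "sin d \<le> sin e"
    proof (cases "e \<le> pi/2")
      case True
      then show ?thesis using d e by (intro sin_monotone_2pi_le) auto
    next
      case False
      have "sin d \<le> sin (pi - e)"
        using False d e by (intro sin_monotone_2pi_le) auto
      then show ?thesis by simp
    qed
    have "cos s - cos t = 2 * sin e * sin d"
      unfolding d_def e_def by (simp add: cos_diff_cos)
    moreover have "(2*d/pi) * (2*d/pi) \<le> sin e * sin d"
      using sd se d sin_ge_zero[of d] by (intro mult_mono) auto
    moreover have "2 * (\<bar>s - t\<bar> / pi)\<^sup>2 = 2 * ((2*d/pi) * (2*d/pi))"
      using that by (simp add: d_def power2_eq_square abs_if field_simps)
    ultimately show ?thesis by linarith
  qed
  show ?thesis
    using *[of s t] *[of t s] assms by (cases "s \<le> t") (auto simp: abs_minus_commute)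
qed

lemma abs_ln_cos_diff_le:
  fixes s t :: real
  assumes "s \<in> {0..pi}" "t \<in> {0..pi}" "s \<noteq> t"
  shows "\<bar>ln \<bar>cos s - cos t\<bar>\<bar> \<le> 2 * ln pi + 2 * \<bar>ln \<bar>s - t\<bar>\<bar>"
proof -
  define d where "d = \<bar>s - t\<bar>"
  have d: "d > 0" using assms by (simp add: d_def)
  have 1: "2 * (d / pi)\<^sup>2 \<le> \<bar>cos s - cos t\<bar>"
    unfolding d_def by (rule abs_cos_diff_ge) (use assms in auto)
  have p: "0 < 2 * (d / pi)\<^sup>2" using d by auto
  have "ln (2 * (d / pi)\<^sup>2) \<le> ln \<bar>cos s - cos t\<bar>"
    using 1 p by (subst ln_le_cancel_iff) linarith+
  moreover have "ln (2 * (d / pi)\<^sup>2) = ln 2 + 2 * ln d - 2 * ln pi"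
    using d by (simp add: ln_mult ln_div ln_realpow)
  moreover have "\<bar>cos s - cos t\<bar> \<le> 2"
    using cos_ge_minus_one[of s] cos_le_one[of s] cos_ge_minus_one[of t] cos_le_one[of t] by linarith
  then have "ln \<bar>cos s - cos t\<bar> \<le> ln 2"
    using 1 p by (subst ln_le_cancel_iff) linarith+
  moreover have "ln 2 \<le> ln pi" using pi_gt3 by simp
  moreover have "0 \<le> ln (2::real)" by simp
  ultimately show ?thesis unfolding d_def[symmetric] by linarith
qed

text \<open>In the variable t = arccos x the integrand is dominated by a translate of one fixed
  integrable function of t - \<phi>. The bound is therefore uniform in x, and this uniformity is
  what the iteration in \<open>arcsine_potential_unit\<close> lives on.\<close>

lemma ln_cos_diff_bounded:
  "\<exists>B. \<forall>x. \<bar>x\<bar> \<le> 1 \<longrightarrow> integrable angle (\<lambda>\<phi>. ln \<bar>x - cos \<phi>\<bar>) \<and>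
    \<bar>\<integral>\<phi>. ln \<bar>x - cos \<phi>\<bar> \<partial>angle\<bar> \<le> B"
proof -
  define w where "w = (\<lambda>u::real. indicator {-pi..pi} u * (2 * ln pi + 2 * \<bar>ln \<bar>u\<bar>\<bar>))"
  have w0: "integrable lborel w"
  proof -
    have "set_integrable lborel {-pi..pi} (\<lambda>u. 2 * ln pi + 2 * \<bar>ln \<bar>u\<bar>\<bar>)"
      by (intro set_integral_add set_integrable_mult_right set_integrable_abs ln_abs_set_integrable)
         (auto simp: set_integrable_def)
    then show ?thesis by (simp add: set_integrable_def w_def)
  qed
  have *: "integrable angle (\<lambda>\<phi>. ln \<bar>x - cos \<phi>\<bar>)" "\<bar>\<integral>\<phi>. ln \<bar>x - cos \<phi>\<bar> \<partial>angle\<bar> \<le> integral\<^sup>L lborel w / pi"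
    if "\<bar>x\<bar> \<le> 1" for x
  proof -
    define t where "t = arccos x"
    have t: "t \<in> {0..pi}" "cos t = x"
      using that by (auto simp: t_def arccos_lbound arccos_ubound cos_arccos_abs)
    have wi: "integrable lborel (\<lambda>u. w (t + (-1) * u))" "integral\<^sup>L lborel (\<lambda>u. w (t + (-1) * u)) = integral\<^sup>L lborel w"
      using w0 lborel_integrable_real_affine[OF w0, of "-1" t] lborel_integral_real_affine[of "-1" w t] by auto
    have ae: "AE u in lborel. norm (indicator {0..pi} u *\<^sub>R ln \<bar>x - cos u\<bar>) \<le> w (t + (-1) * u)"
      using AE_lborel_singleton[of t]
    proof eventually_elim
      case (elim u)
      have "0 \<le> ln pi" using pi_gt3 by simp
      then show ?case using abs_ln_cos_diff_le[of t u] t elim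
        by (auto simp: w_def intro!: add_nonneg_nonneg split: split_indicator)
    qed
    have si: "set_integrable lborel {0..pi} (\<lambda>\<phi>. ln \<bar>x - cos \<phi>\<bar>)"
      unfolding set_integrable_def
      by (rule Bochner_Integration.integrable_bound[OF wi(1)]) (use ae in \<open>auto intro!: borel_measurable_indicator\<close>)
    then show "integrable angle (\<lambda>\<phi>. ln \<bar>x - cos \<phi>\<bar>)"
      by (subst integrable_angle) auto
    have "\<bar>LINT \<phi>:{0..pi}|lborel. ln \<bar>x - cos \<phi>\<bar>\<bar> \<le> integral\<^sup>L lborel w"
      unfolding set_lebesgue_integral_def wi(2)[symmetric]
      by (rule order_trans[OF integral_abs_bound])
        (use integral_mono_AE[OF integrable_norm[OF si[unfolded set_integrable_def]] wi(1) ae] in simp)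
    then show "\<bar>\<integral>\<phi>. ln \<bar>x - cos \<phi>\<bar> \<partial>angle\<bar> \<le> integral\<^sup>L lborel w / pi"
      by (subst integral_angle) (auto simp: divide_simps)
  qed
  show ?thesis using * by blast
qed

text \<open>Doubling the angle turns the potential \<open>Q\<close> of the arcsine law, normalised by \<open>ln 2\<close>, into
  \<open>Q (2 x\<^sup>2 - 1) = 2 Q x\<close>; a bounded solution of this equation vanishes.\<close>
lemma arcsine_potential_unit:
  assumes "\<bar>x\<bar> \<le> 1"
  shows "(\<integral>\<phi>. ln \<bar>x - cos \<phi>\<bar> \<partial>angle) = - ln 2"
proof -
  obtain B where int: "\<And>x. \<bar>x\<bar> \<le> 1 \<Longrightarrow> integrable angle (\<lambda>\<phi>. ln \<bar>x - cos \<phi>\<bar>)"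
    and B: "\<And>x. \<bar>x\<bar> \<le> 1 \<Longrightarrow> \<bar>\<integral>\<phi>. ln \<bar>x - cos \<phi>\<bar> \<partial>angle\<bar> \<le> B"
    using ln_cos_diff_bounded by blast
  define Q where "Q = (\<lambda>x. (\<integral>\<phi>. ln \<bar>x - cos \<phi>\<bar> \<partial>angle) + ln 2)"
  have T: "\<bar>2 * x\<^sup>2 - 1\<bar> \<le> 1" if "\<bar>x\<bar> \<le> 1" for x :: real
  proof -
    have "x\<^sup>2 \<le> 1" using that by (simp add: abs_square_le_1)
    moreover have "0 \<le> x\<^sup>2" by simp
    ultimately show ?thesis by (simp only: abs_le_iff) linarith
  qed
  have Q2: "Q (2 * x\<^sup>2 - 1) = 2 * Q x" if x: "\<bar>x\<bar> \<le> 1" for x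
  proof -
    note T = T[OF x]
    define y where "y = 2 * x\<^sup>2 - 1"
    have y: "\<bar>y\<bar> \<le> 1" using T by (simp add: y_def)
    have i1: "integrable angle (\<lambda>\<phi>. ln \<bar>x - cos \<phi>\<bar>)" using int[OF x] .
    have i2: "integrable angle (\<lambda>\<phi>. ln \<bar>x - (- cos \<phi>)\<bar>)"
      "(\<integral>\<phi>. ln \<bar>x - (- cos \<phi>)\<bar> \<partial>angle) = (\<integral>\<phi>. ln \<bar>x - cos \<phi>\<bar> \<partial>angle)"
      by (rule integral_angle_reflect; use i1 in auto)+
    have "(\<integral>\<phi>. ln \<bar>y - cos \<phi>\<bar> \<partial>angle) = (\<integral>\<phi>. ln \<bar>y - cos (2 * \<phi>)\<bar> \<partial>angle)"
      by (rule integral_angle_double(2)[symmetric]) (use int[OF y] in auto)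
    also have "\<dots> = (\<integral>\<phi>. ln 2 + ln \<bar>x - cos \<phi>\<bar> + ln \<bar>x - (- cos \<phi>)\<bar> \<partial>angle)"
    proof (rule integral_cong_AE)
      have "AE \<phi> in angle. cos \<phi> \<noteq> x \<and> cos \<phi> \<noteq> - x"
        unfolding AE_angle
        using AE_lborel_singleton[of "arccos x"] AE_lborel_singleton[of "arccos (-x)"]
        by eventually_elim (metis arccos_cos atLeastAtMost_iff)
      then show "AE \<phi> in angle. ln \<bar>y - cos (2 * \<phi>)\<bar> = ln 2 + ln \<bar>x - cos \<phi>\<bar> + ln \<bar>x - (- cos \<phi>)\<bar>"
      proof eventually_elim
        case (elim \<phi>)
        have "y - cos (2 * \<phi>) = 2 * (x - cos \<phi>) * (x + cos \<phi>)"
          unfolding y_def cos_double_cos by (simp add: algebra_simps power2_eq_square)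
        then have "\<bar>y - cos (2 * \<phi>)\<bar> = 2 * \<bar>x - cos \<phi>\<bar> * \<bar>x - (- cos \<phi>)\<bar>"
          by (simp only: abs_mult) simp
        moreover have "\<bar>x - cos \<phi>\<bar> > 0" "\<bar>x - (- cos \<phi>)\<bar> > 0" using elim by auto
        ultimately show ?case by (simp add: ln_mult)
      qed
    qed measurable
    also have "\<dots> = ln 2 + (\<integral>\<phi>. ln \<bar>x - cos \<phi>\<bar> \<partial>angle) + (\<integral>\<phi>. ln \<bar>x - (- cos \<phi>)\<bar> \<partial>angle)"
      using i1 i2(1) by (simp add: Bochner_Integration.integral_add angle.prob_space[simplified])
    finally show ?thesis unfolding Q_def i2(2) y_def[symmetric] by simp
  qed
  define it where "it = rec_nat x (\<lambda>_ z. 2 * z\<^sup>2 - 1)"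
  have it0: "it 0 = x" "\<And>n. it (Suc n) = 2 * (it n)\<^sup>2 - 1" by (simp_all add: it_def)
  have it: "\<bar>it n\<bar> \<le> 1 \<and> Q (it n) = 2 ^ n * Q x" for n
    by (induction n) (use assms T Q2 it0 in auto)
  have "\<bar>Q x\<bar> \<le> (B + ln 2) * (1/2) ^ n" for n
  proof -
    have "\<bar>Q (it n)\<bar> \<le> B + ln 2"
    proof -
      have "\<bar>\<integral>\<phi>. ln \<bar>it n - cos \<phi>\<bar> \<partial>angle\<bar> \<le> B" using B[of "it n"] it[of n] by auto
      moreover have "0 \<le> ln (2::real)" by simp
      ultimately show ?thesis unfolding Q_def by linarith
    qed
    then show ?thesis using it[of n] by (simp add: abs_mult field_simps)
  qed
  moreover have "(\<lambda>n. (B + ln 2) * (1/2) ^ n) \<longlonglongrightarrow> (B + ln 2) * 0"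
    by (intro tendsto_intros) auto
  ultimately have "\<bar>Q x\<bar> \<le> 0"
    by (intro LIMSEQ_le_const[of _ 0]) auto
  then show ?thesis by (simp add: Q_def)
qed

lemma ln_cos_diff_integrable:
  "integrable angle (\<lambda>\<phi>. ln \<bar>x - cos \<phi>\<bar>)"
proof (cases "\<bar>x\<bar> \<le> 1")
  case True
  then show ?thesis by (metis ln_cos_diff_bounded)
next
  case False
  have "x \<noteq> cos \<phi>" for \<phi> using False abs_cos_le_one[of \<phi>] by auto
  then have "set_integrable lborel {0..pi} (\<lambda>\<phi>. ln \<bar>x - cos \<phi>\<bar>)"
    by (intro borel_integrable_atLeastAtMost' continuous_intros) simp
  then show ?thesis by (subst integrable_angle) auto
qed

lemma one_minus_cos_le: "1 - cos x \<le> x\<^sup>2 / 2" for x :: real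
proof -
  have "\<bar>sin (x/2)\<bar> \<le> \<bar>x/2\<bar>" by (rule abs_sin_x_le_abs_x) 
  then have "(sin (x/2))\<^sup>2 \<le> (x/2)\<^sup>2" by (simp only: abs_le_square_iff)
  moreover have "cos x = 1 - 2 * (sin (x/2))\<^sup>2" using cos_double_sin[of "x/2"] by simp
  ultimately show ?thesis by (simp add: power_divide)
qed

text \<open>For angles up to sqrt (x - 1) one has 1 - cos \<phi> \<le> (x - 1) / 2, hence x - cos
  \<phi> \<ge> 3 (1 - cos \<phi>): moving the point from 1 to x gains ln 3 on that set of angles, of
  mass \<open>k / pi\<close>, and loses nothing elsewhere. The square root of x - 1 is the growth
  that later yields \<open>excess_quadratic\<close>.\<close>

lemma arcsine_potential_unit_ge:
  assumes "x \<ge> 1"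
  shows "(\<integral>\<phi>. ln \<bar>x - cos \<phi>\<bar> \<partial>angle) \<ge> - ln 2 + ln 3 / pi * min pi (sqrt (x - 1))"
proof -
  define k where "k = min pi (sqrt (x - 1))"
  have k: "0 \<le> k" "k \<le> pi" using assms by (auto simp: k_def)
  have "- ln 2 + ln 3 / pi * k = (\<integral>\<phi>. ln \<bar>1 - cos \<phi>\<bar> \<partial>angle) + (\<integral>\<phi>. indicator {0..k} \<phi> * ln 3 \<partial>angle)"
  proof -
    have "(\<integral>\<phi>. indicator {0..k} \<phi> * ln 3 \<partial>angle) = (\<integral>\<phi>. indicator {0..pi} \<phi> * (indicator {0..k} \<phi> * ln 3) \<partial>lborel) / pi"
      by (subst integral_angle) (simp_all only: set_lebesgue_integral_def real_scaleR_def, measurable)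
    also have "(\<lambda>\<phi>. indicator {0..pi} \<phi> * (indicator {0..k} \<phi> * ln 3)) = (\<lambda>\<phi>. indicator {0..k} \<phi> * ln (3::real))"
      using k by (auto split: split_indicator)
    also have "(\<integral>\<phi>. indicator {0..k} \<phi> * ln (3::real) \<partial>lborel) / pi = k * ln 3 / pi" using k by simp
    finally show ?thesis using arcsine_potential_unit[of 1] by (simp add: field_simps)
  qed
  also have "\<dots> = (\<integral>\<phi>. ln \<bar>1 - cos \<phi>\<bar> + indicator {0..k} \<phi> * ln 3 \<partial>angle)"
    by (rule Bochner_Integration.integral_add[symmetric])
       (use ln_cos_diff_integrable[of 1] in \<open>auto intro!: integrable_real_indicator simp: angle.emeasure_eq_measure\<close>)
  also have "\<dots> \<le> (\<integral>\<phi>. ln \<bar>x - cos \<phi>\<bar> \<partial>angle)"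
  proof (rule integral_mono_AE)
    show "AE \<phi> in angle. ln \<bar>1 - cos \<phi>\<bar> + indicator {0..k} \<phi> * ln 3 \<le> ln \<bar>x - cos \<phi>\<bar>"
      unfolding AE_angle using AE_lborel_singleton[of 0]
    proof eventually_elim
      case (elim \<phi>)
      show ?case
      proof
        assume \<phi>: "\<phi> \<in> {0..pi}"
        have "cos \<phi> \<noteq> 1"
        proof
          assume "cos \<phi> = 1"
          then have "arccos (cos \<phi>) = 0" by simp
          then show False using \<phi> elim by (simp add: arccos_cos)
        qed
        then have c: "1 - cos \<phi> > 0" using cos_le_one[of \<phi>] by linarith
        show "ln \<bar>1 - cos \<phi>\<bar> + indicator {0..k} \<phi> * ln 3 \<le> ln \<bar>x - cos \<phi>\<bar>"
        proof (cases "\<phi> \<in> {0..k}")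
          case True
          have "\<phi>\<^sup>2 \<le> (sqrt (x - 1))\<^sup>2" using True by (intro power_mono) (auto simp: k_def)
          then have "1 - cos \<phi> \<le> (x - 1) / 2" using one_minus_cos_le[of \<phi>] assms by simp
          then have "3 * (1 - cos \<phi>) \<le> x - cos \<phi>" by (simp add: field_simps)
          then have "ln (3 * (1 - cos \<phi>)) \<le> ln (x - cos \<phi>)"
            by (rule ln_mono) (use c in simp)
          moreover have "ln (3 * (1 - cos \<phi>)) = ln (1 - cos \<phi>) + ln 3"
            using c by (subst ln_mult) simp_all
          moreover have "\<bar>1 - cos \<phi>\<bar> = 1 - cos \<phi>" "\<bar>x - cos \<phi>\<bar> = x - cos \<phi>" using c assms by simp_all
          ultimately show ?thesis using True by (simp only: indicator_simps mult_1)
        next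
          case False
          then show ?thesis using c assms by simp
        qed
      qed
    qed
  qed (use ln_cos_diff_integrable[of 1] in \<open>auto intro!: Bochner_Integration.integrable_add integrable_real_indicator simp: ln_cos_diff_integrable angle.emeasure_eq_measure\<close>)
  finally show ?thesis by (simp add: k_def)
qed

lemma arcsine_potential_integrable:
  assumes "r > 0"
  shows "integrable angle (\<lambda>\<phi>. ln \<bar>m + r * cos \<phi> - y\<bar>)"
    and "(\<integral>\<phi>. ln \<bar>m + r * cos \<phi> - y\<bar> \<partial>angle) = ln r + (\<integral>\<phi>. ln \<bar>(y - m) / r - cos \<phi>\<bar> \<partial>angle)"
proof -
  define x where "x = (y - m) / r"
  have e: "\<bar>m + r * cos \<phi> - y\<bar> = r * \<bar>x - cos \<phi>\<bar>" for \<phi>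
  proof -
    have "m + r * cos \<phi> - y = - (r * (x - cos \<phi>))" using assms by (simp add: x_def field_simps)
    then show ?thesis using assms by (simp add: abs_mult)
  qed
  have ae: "AE \<phi> in angle. ln \<bar>m + r * cos \<phi> - y\<bar> = ln r + ln \<bar>x - cos \<phi>\<bar>"
  proof -
    have "AE \<phi> in angle. cos \<phi> \<noteq> x"
      unfolding AE_angle using AE_lborel_singleton[of "arccos x"]
      by eventually_elim (auto simp: arccos_cos)
    then show ?thesis
      by eventually_elim (use e assms in \<open>auto simp: ln_mult\<close>)
  qed
  have i: "integrable angle (\<lambda>\<phi>. ln r + ln \<bar>x - cos \<phi>\<bar>)"
    by (auto simp: ln_cos_diff_integrable)
  show "integrable angle (\<lambda>\<phi>. ln \<bar>m + r * cos \<phi> - y\<bar>)"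
    using i ae by (subst integrable_cong_AE[OF _ _ ae]) auto
  have "(\<integral>\<phi>. ln \<bar>m + r * cos \<phi> - y\<bar> \<partial>angle) = (\<integral>\<phi>. ln r + ln \<bar>x - cos \<phi>\<bar> \<partial>angle)"
    using ae by (intro integral_cong_AE) auto
  then show "(\<integral>\<phi>. ln \<bar>m + r * cos \<phi> - y\<bar> \<partial>angle) = ln r + (\<integral>\<phi>. ln \<bar>(y - m) / r - cos \<phi>\<bar> \<partial>angle)"
    by (simp add: ln_cos_diff_integrable angle.prob_space[simplified] x_def)
qed

lemma arcsine_potential_inside:
  assumes "r > 0" "\<bar>y - m\<bar> \<le> r"
  shows "(\<integral>\<phi>. ln \<bar>m + r * cos \<phi> - y\<bar> \<partial>angle) = ln (r / 2)"
  using assms by (simp add: arcsine_potential_integrable(2) arcsine_potential_unit ln_div)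

lemma arcsine_potential_outside:
  assumes "r > 0" "\<bar>y - m\<bar> \<ge> r"
  shows "(\<integral>\<phi>. ln \<bar>m + r * cos \<phi> - y\<bar> \<partial>angle) \<ge> ln (r / 2) + ln 3 / pi * min pi (sqrt (\<bar>y - m\<bar> / r - 1))"
proof -
  define x where "x = \<bar>y - m\<bar> / r"
  have x: "x \<ge> 1" using assms by (simp add: x_def)
  have "(\<integral>\<phi>. ln \<bar>(y - m) / r - cos \<phi>\<bar> \<partial>angle) = (\<integral>\<phi>. ln \<bar>x - cos \<phi>\<bar> \<partial>angle)"
  proof (cases "y \<ge> m")
    case True
    then show ?thesis by (simp add: x_def)
  next
    case False
    have "(\<integral>\<phi>. ln \<bar>x - cos \<phi>\<bar> \<partial>angle) = (\<integral>\<phi>. ln \<bar>x - (- cos \<phi>)\<bar> \<partial>angle)"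
      by (rule integral_angle_reflect(2)[symmetric]) (auto simp: ln_cos_diff_integrable)
    also have "(\<lambda>\<phi>. ln \<bar>x - (- cos \<phi>)\<bar>) = (\<lambda>\<phi>. ln \<bar>(y - m) / r - cos \<phi>\<bar>)"
    proof
      fix \<phi>
      have "x - (- cos \<phi>) = - ((y - m) / r - cos \<phi>)" using False by (simp add: x_def diff_divide_distrib)
      then show "ln \<bar>x - (- cos \<phi>)\<bar> = ln \<bar>(y - m) / r - cos \<phi>\<bar>" by (simp only: abs_minus_cancel)
    qed
    finally show ?thesis by simp
  qed
  then show ?thesis
    using arcsine_potential_unit_ge[OF x] assms
    by (simp add: arcsine_potential_integrable(2) ln_div x_def)
qed

section \<open>Uniqueness of the equilibrium support\<close>

text \<open>The tents \<open>max 0 (1 - \<bar>x - y\<bar> / s)\<close> are convolution squares of windows of length \<open>s\<close>, and integrating them against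
  \<open>ds / s\<close> over \<open>(0, R]\<close> gives \<open>- ln \<bar>x - y\<bar>\<close> up to a constant and a defect vanishing as \<open>R \<rightarrow> \<infinity>\<close>. This exhibits the
  logarithmic energy as a positive definite form on signed measures of total mass zero.\<close>
definition tent_weight :: "real \<Rightarrow> real \<times> real \<Rightarrow> ennreal" where
  "tent_weight R p = (if 0 < fst p \<and> fst p \<le> R then ennreal (1 / (fst p)\<^sup>2) else 0)"

text \<open>The first component of a pair is the length s, the second the left end u. Windows
  containing both x and y have left ends in an interval of length s - \<bar>x - y\<bar>; of the two
  factors 1 / s in \<open>tent_weight\<close>, one normalises this to the tent and the other belongs
  to ds / s.\<close>

definition window :: "real \<times> real \<Rightarrow> real \<Rightarrow> ennreal" where
  "window p x = (if snd p \<le> x \<and> x \<le> snd p + fst p then 1 else 0)"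

definition tent_kernel :: "real \<Rightarrow> real \<Rightarrow> real \<Rightarrow> ennreal" where
  "tent_kernel R x y = (\<integral>\<^sup>+p. tent_weight R p * (window p x * window p y) \<partial>(lborel \<Otimes>\<^sub>M lborel))"

lemma tent_weight_measurable [measurable]: "tent_weight R \<in> borel_measurable (borel \<Otimes>\<^sub>M borel)"
  unfolding tent_weight_def by measurable

lemma window_measurable [measurable]:
  "(\<lambda>(p, x). window p x) \<in> borel_measurable ((borel \<Otimes>\<^sub>M borel) \<Otimes>\<^sub>M borel)"
  unfolding window_def by measurable

text \<open>Integrating over the position first leaves one integral over the scale. Where s <
  \<bar>x - y\<bar> the coercion \<open>ennreal\<close> sends the negative quotient to 0, which is
  the truncation of the tent.\<close>

lemma tent_kernel_radial:
  "tent_kernel R x y = (\<integral>\<^sup>+s. (if 0 < s \<and> s \<le> R then ennreal ((s - \<bar>x - y\<bar>) / s\<^sup>2) else 0) \<partial>lborel)"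
proof -
  have "tent_kernel R x y = (\<integral>\<^sup>+s. \<integral>\<^sup>+u. tent_weight R (s, u) * (window (s, u) x * window (s, u) y) \<partial>lborel \<partial>lborel)"
    unfolding tent_kernel_def
    by (rule lborel.nn_integral_fst[symmetric]) measurable
  also have "\<dots> = (\<integral>\<^sup>+s. (if 0 < s \<and> s \<le> R then ennreal ((s - \<bar>x - y\<bar>) / s\<^sup>2) else 0) \<partial>lborel)"
  proof (rule nn_integral_cong)
    fix s :: real
    have "(\<integral>\<^sup>+u. window (s, u) x * window (s, u) y \<partial>lborel) = (\<integral>\<^sup>+u. indicator {max x y - s..min x y} u \<partial>lborel)"
      by (rule nn_integral_cong) (auto simp: window_def split: split_indicator)
    also have "\<dots> = ennreal (s - \<bar>x - y\<bar>)"
      by (auto simp: abs_if ennreal_neg min_def max_def emeasure_lborel_Icc_eq)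
    finally have *: "(\<integral>\<^sup>+u. window (s, u) x * window (s, u) y \<partial>lborel) = ennreal (s - \<bar>x - y\<bar>)" .
    have "(\<integral>\<^sup>+u. tent_weight R (s, u) * (window (s, u) x * window (s, u) y) \<partial>lborel) =
       (if 0 < s \<and> s \<le> R then ennreal (1 / s\<^sup>2) else 0) * ennreal (s - \<bar>x - y\<bar>)"
      unfolding tent_weight_def fst_conv by (subst nn_integral_cmult) (measurable, simp add: *)
    also have "\<dots> = (if 0 < s \<and> s \<le> R then ennreal ((s - \<bar>x - y\<bar>) / s\<^sup>2) else 0)"
      by (auto simp: ennreal_mult'[symmetric])
    finally show "(\<integral>\<^sup>+u. tent_weight R (s, u) * (window (s, u) x * window (s, u) y) \<partial>lborel) =
       (if 0 < s \<and> s \<le> R then ennreal ((s - \<bar>x - y\<bar>) / s\<^sup>2) else 0)" .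
  qed
  finally show ?thesis .
qed

text \<open>For d \<le> R the integral of (s - d) / s^2 over [d, R] is ln R + d / R - ln d - 1,
  which leaves d / R besides the logarithms and the constant. For d > R the truncated integral is 0,
  and the second branch is the value that keeps \<open>tent_integral\<close> in the same
  form.\<close>

definition tent_defect :: "real \<Rightarrow> real \<Rightarrow> real" where
  "tent_defect R d = (if d \<le> R then d / R else ln (d / R) + 1)"

lemma tent_integral:
  fixes d R :: real
  assumes "0 < d" "1 \<le> R"
  shows "(\<integral>\<^sup>+s. (if 0 < s \<and> s \<le> R then ennreal ((s - d) / s\<^sup>2) else 0) \<partial>lborel) =
    ennreal (tent_defect R d + ln R - ln d - 1)"
proof (cases "d \<le> R")
  case False
  have "(\<lambda>s. if 0 < s \<and> s \<le> R then ennreal ((s - d) / s\<^sup>2) else 0) = (\<lambda>s. 0)"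
    using False by (auto simp: fun_eq_iff ennreal_eq_0_iff divide_le_0_iff)
  then show ?thesis using False assms by (simp add: tent_defect_def ln_div)
next
  case True
  have "(\<integral>\<^sup>+s. (if 0 < s \<and> s \<le> R then ennreal ((s - d) / s\<^sup>2) else 0) \<partial>lborel) =
     (\<integral>\<^sup>+s. ennreal ((s - d) / s\<^sup>2) * indicator {d..R} s \<partial>lborel)"
    using assms by (intro nn_integral_cong) (auto split: split_indicator simp: ennreal_eq_0_iff divide_le_0_iff)
  also have "\<dots> = ennreal ((ln R + d / R) - (ln d + d / d))"
  proof (rule nn_integral_FTC_Icc[where F = "\<lambda>s. ln s + d / s"])
    fix x assume "x \<in> {d..R}"
    then show "((\<lambda>s. ln s + d / s) has_real_derivative (x - d) / x\<^sup>2) (at x)" using assms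
      by (auto intro!: derivative_eq_intros simp: field_simps power2_eq_square)
  qed (use True assms in auto)
  finally show ?thesis using True assms by (simp add: tent_defect_def field_simps)
qed

lemma tent_kernel_off_diagonal:
  assumes "x \<noteq> y" "1 \<le> R"
  shows "tent_kernel R x y = ennreal (tent_defect R \<bar>x - y\<bar> + ln R - ln \<bar>x - y\<bar> - 1)"
  unfolding tent_kernel_radial by (rule tent_integral) (use assms in auto)

lemma tent_kernel_diagonal:
  assumes "1 \<le> R"
  shows "tent_kernel R x x = \<infinity>"
proof -
  have "of_nat n \<le> tent_kernel R x x" for n
  proof -
    define d where "d = R * exp (- real (n + 1))"
    have d: "0 < d" "d \<le> R" using assms by (auto simp: d_def)
    have "real n \<le> tent_defect R d + ln R - ln d - 1"
      using assms d by (simp add: tent_defect_def d_def ln_mult)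
    then have "of_nat n \<le> ennreal (tent_defect R d + ln R - ln d - 1)"
      by (simp add: ennreal_leI flip: ennreal_of_nat_eq_real_of_nat)
    also have "\<dots> = (\<integral>\<^sup>+s. (if 0 < s \<and> s \<le> R then ennreal ((s - d) / s\<^sup>2) else 0) \<partial>lborel)"
      by (rule tent_integral[symmetric]) (use d assms in auto)
    also have "\<dots> \<le> tent_kernel R x x"
      unfolding tent_kernel_radial using d
      by (intro nn_integral_mono) (auto intro!: ennreal_leI divide_right_mono)
    finally show ?thesis .
  qed
  then show ?thesis
    by (metis ennreal_SUP_of_nat_eq_top infinity_ennreal_def SUP_le_iff top.extremum_uniqueI)
qed

text \<open>The upper bound does not depend on R and is only logarithmic in d, so
  \<open>1 + kernel\<close> can serve as majorant when R tends to infinity.\<close>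

lemma tent_defect_bounds:
  assumes "0 \<le> d" "1 \<le> R"
  shows "0 \<le> tent_defect R d" "tent_defect R d \<le> 1 + ln (1 + d)"
proof -
  show "0 \<le> tent_defect R d" using assms by (auto simp: tent_defect_def)
  show "tent_defect R d \<le> 1 + ln (1 + d)"
  proof (cases "d \<le> R")
    case True
    then have "d / R \<le> 1" using assms by simp
    moreover have "0 \<le> ln (1 + d)" using assms by simp
    ultimately show ?thesis using True by (simp add: tent_defect_def)
  next
    case False
    have "d / R \<le> d" using assms mult_left_mono[of 1 R d] by (simp add: field_simps)
    then have "ln (d / R) \<le> ln (1 + d)" using False assms by (intro ln_mono) auto
    then show ?thesis using False by (simp add: tent_defect_def)
  qed
qed

text \<open>By Tonelli the form becomes a weighted inner product of the window masses of the two
  measures. Polarising it gives a weighted integral of squared differences, which is the positivity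
  used in \<open>equilibrium_msupp_unique\<close>.\<close>

lemma tent_form:
  assumes "borel_prob \<sigma>" "borel_prob \<tau>"
  shows "(\<integral>\<^sup>+x. \<integral>\<^sup>+y. tent_kernel R x y \<partial>\<tau> \<partial>\<sigma>) =
    (\<integral>\<^sup>+p. tent_weight R p * ((\<integral>\<^sup>+x. window p x \<partial>\<sigma>) * (\<integral>\<^sup>+y. window p y \<partial>\<tau>)) \<partial>(lborel \<Otimes>\<^sub>M lborel))"
proof -
  interpret s: prob_space \<sigma> using assms(1) by (simp add: borel_prob_def)
  interpret t: prob_space \<tau> using assms(2) by (simp add: borel_prob_def)
  have [measurable_cong]: "sets \<sigma> = sets borel" "sets \<tau> = sets borel"
    using assms by (auto simp: borel_prob_def)
  interpret st: pair_sigma_finite \<sigma> "lborel \<Otimes>\<^sub>M lborel :: (real \<times> real) measure" ..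
  interpret tt: pair_sigma_finite \<tau> "lborel \<Otimes>\<^sub>M lborel :: (real \<times> real) measure" ..
  have "(\<integral>\<^sup>+x. \<integral>\<^sup>+y. tent_kernel R x y \<partial>\<tau> \<partial>\<sigma>) =
    (\<integral>\<^sup>+x. \<integral>\<^sup>+p. \<integral>\<^sup>+y. tent_weight R p * (window p x * window p y) \<partial>\<tau> \<partial>(lborel \<Otimes>\<^sub>M lborel) \<partial>\<sigma>)"
    unfolding tent_kernel_def by (intro nn_integral_cong tt.Fubini'[symmetric]) measurable
  also have "\<dots> = (\<integral>\<^sup>+p. \<integral>\<^sup>+x. \<integral>\<^sup>+y. tent_weight R p * (window p x * window p y) \<partial>\<tau> \<partial>\<sigma> \<partial>(lborel \<Otimes>\<^sub>M lborel))"
    by (rule st.Fubini'[symmetric]) measurable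
  also have "\<dots> = (\<integral>\<^sup>+p. tent_weight R p * ((\<integral>\<^sup>+x. window p x \<partial>\<sigma>) * (\<integral>\<^sup>+y. window p y \<partial>\<tau>)) \<partial>(lborel \<Otimes>\<^sub>M lborel))"
  proof (rule nn_integral_cong)
    fix p :: "real \<times> real"
    have [measurable]: "window p \<in> borel_measurable borel" unfolding window_def by measurable
    show "(\<integral>\<^sup>+x. \<integral>\<^sup>+y. tent_weight R p * (window p x * window p y) \<partial>\<tau> \<partial>\<sigma>) =
      tent_weight R p * ((\<integral>\<^sup>+x. window p x \<partial>\<sigma>) * (\<integral>\<^sup>+y. window p y \<partial>\<tau>))"
      by (simp add: nn_integral_cmult nn_integral_multc mult_ac)
  qed
  finally show ?thesis .
qed

section \<open>The energy form of a confining potential\<close>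

locale confining_potential =
  fixes V :: "real \<Rightarrow> real" and C :: real
  assumes V_cont: "continuous_on UNIV V"
    and V_growth: "\<And>x. 4 * ln (1 + \<bar>x\<bar>) - C \<le> V x"
    and C_nonneg: "0 \<le> C"
begin

lemma V_measurable [measurable]: "V \<in> borel_measurable borel"
  using V_cont by (rule borel_measurable_continuous_onI)

text \<open>The shift by \<open>C\<close> makes the symmetrised kernel nonnegative, so that double
  integrals can be taken in the extended nonnegative reals.\<close>

definition kernel :: "real \<Rightarrow> real \<Rightarrow> ennreal" where
  "kernel x y = (if x = y then \<infinity> else ennreal (- ln \<bar>x - y\<bar> + V x / 2 + V y / 2 + C))"

lemma kernel_measurable [measurable]: "(\<lambda>(x, y). kernel x y) \<in> borel_measurable (borel \<Otimes>\<^sub>M borel)"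
  unfolding kernel_def by measurable

lemma kernel_commute: "kernel x y = kernel y x"
  by (simp add: kernel_def abs_minus_commute algebra_simps)

text \<open>This is what the 4 in \<open>V_growth\<close> is for. The halves of V at x and y supply
  2 ln (1 + \<bar>x\<bar>) + 2 ln (1 + \<bar>y\<bar>); one copy pays for ln \<bar>x - y\<bar>, the
  other is left over and dominates \<open>tent_defect\<close>.\<close>

lemma kernel_ge:
  assumes "x \<noteq> y"
  shows "ln (1 + \<bar>x\<bar>) + ln (1 + \<bar>y\<bar>) \<le> - ln \<bar>x - y\<bar> + V x / 2 + V y / 2 + C"
proof -
  have "\<bar>x - y\<bar> \<le> (1 + \<bar>x\<bar>) * (1 + \<bar>y\<bar>)"
  proof -
    have "0 \<le> \<bar>x\<bar> * \<bar>y\<bar>" by simp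
    moreover have "(1 + \<bar>x\<bar>) * (1 + \<bar>y\<bar>) = 1 + \<bar>x\<bar> + \<bar>y\<bar> + \<bar>x\<bar> * \<bar>y\<bar>" by (simp add: distrib_left distrib_right)
    ultimately show ?thesis using abs_triangle_ineq4[of x y] by linarith
  qed
  then have "ln \<bar>x - y\<bar> \<le> ln ((1 + \<bar>x\<bar>) * (1 + \<bar>y\<bar>))" using assms by (intro ln_mono) auto
  also have "\<dots> = ln (1 + \<bar>x\<bar>) + ln (1 + \<bar>y\<bar>)" by (subst ln_mult) auto
  finally show ?thesis using V_growth[of x] V_growth[of y] by argo
qed

definition form :: "real measure \<Rightarrow> real measure \<Rightarrow> ennreal" where
  "form \<sigma> \<tau> = (\<integral>\<^sup>+x. \<integral>\<^sup>+y. kernel x y \<partial>\<tau> \<partial>\<sigma>)"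

text \<open>The negative part of the symmetrised kernel is at most \<open>C\<close>, so its integral
  is finite and the difference defining \<open>energy\<close> never reads \<infinity> - \<infinity>.
  Adding \<open>C\<close> to the positive part turns that difference into one nonnegative
  integral.\<close>

lemma energy_eq:
  assumes "borel_prob \<mu>"
  shows "energy V \<mu> = enn2ereal (form \<mu> \<mu>) - ereal C"
proof -
  interpret s: prob_space \<mu> using assms(1) by (simp add: borel_prob_def)
  have [measurable_cong]: "sets \<mu> = sets borel"
    using assms by (auto simp: borel_prob_def)
  have meas[measurable]: "(\<lambda>(x, y). log_kernel V x y) \<in> borel_measurable (borel \<Otimes>\<^sub>M borel)"
    unfolding log_kernel_def by measurable
  define P where "P = (\<integral>\<^sup>+ x. \<integral>\<^sup>+ y. e2ennreal (max 0 (log_kernel V x y)) \<partial>\<mu> \<partial>\<mu>)"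
  define N where "N = (\<integral>\<^sup>+ x. \<integral>\<^sup>+ y. e2ennreal (max 0 (- log_kernel V x y)) \<partial>\<mu> \<partial>\<mu>)"
  have pw: "e2ennreal (max 0 (log_kernel V x y)) + ennreal C = kernel x y + e2ennreal (max 0 (- log_kernel V x y))"
    "e2ennreal (max 0 (- log_kernel V x y)) \<le> ennreal C" for x y
  proof -
    define k where "k = - ln \<bar>x - y\<bar> + V x / 2 + V y / 2"
    have *: "e2ennreal (max 0 (ereal r)) = ennreal (max 0 r)" for r
      by (metis ennreal.abs_eq eq_onp_same_args max.cobounded1 max_def ereal_max_0 e2ennreal_ereal zero_ereal_def)
    have "e2ennreal (max 0 (log_kernel V x y)) + ennreal C = kernel x y + e2ennreal (max 0 (- log_kernel V x y)) \<and>
       e2ennreal (max 0 (- log_kernel V x y)) \<le> ennreal C"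
    proof (cases "x = y")
      case True
      then show ?thesis by (simp add: kernel_def log_kernel_def)
    next
      case False
      have k: "- C \<le> k" using kernel_ge[OF False] unfolding k_def
        by (smt (verit) ln_ge_zero abs_ge_zero)
      have "e2ennreal (max 0 (log_kernel V x y)) = ennreal (max 0 k)"
        "e2ennreal (max 0 (- log_kernel V x y)) = ennreal (max 0 (- k))" "kernel x y = ennreal (k + C)"
        using False *[of k] *[of "-k"] unfolding log_kernel_def kernel_def k_def[symmetric] by auto
      then show ?thesis using k C_nonneg
        by (auto simp: ennreal_plus[symmetric] max_def simp del: ennreal_plus intro!: ennreal_leI)
    qed
    then show "e2ennreal (max 0 (log_kernel V x y)) + ennreal C = kernel x y + e2ennreal (max 0 (- log_kernel V x y))"
      "e2ennreal (max 0 (- log_kernel V x y)) \<le> ennreal C" by auto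
  qed
  have "P + ennreal C = (\<integral>\<^sup>+ x. \<integral>\<^sup>+ y. e2ennreal (max 0 (log_kernel V x y)) + ennreal C \<partial>\<mu> \<partial>\<mu>)"
    unfolding P_def by (simp add: nn_integral_add s.emeasure_space_1)
  also have "\<dots> = form \<mu> \<mu> + N"
    unfolding pw(1) form_def N_def by (simp add: nn_integral_add)
  finally have eq: "P + ennreal C = form \<mu> \<mu> + N" .
  have "N \<le> (\<integral>\<^sup>+ x. \<integral>\<^sup>+ y. ennreal C \<partial>\<mu> \<partial>\<mu>)"
    unfolding N_def by (intro nn_integral_mono pw(2))
  then have N: "N \<le> ennreal C" by (simp add: s.emeasure_space_1)
  then obtain n where n: "N = ennreal n" "0 \<le> n" 
    by (cases N) (auto simp: top_unique)
  have "enn2ereal P - enn2ereal N = enn2ereal (form \<mu> \<mu>) - ereal C"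
  proof (cases P)
    case (real p)
    then have "form \<mu> \<mu> \<noteq> \<top>" using eq C_nonneg by (auto simp flip: ennreal_plus)
    then obtain f where f: "form \<mu> \<mu> = ennreal f" "0 \<le> f" by (cases "form \<mu> \<mu>") auto
    have "p + C = f + n" using eq real f n C_nonneg by (simp flip: ennreal_plus)
    then show ?thesis using f n real by (simp add: enn2ereal_ennreal)
  next
    case top
    then have "form \<mu> \<mu> = \<top>" using eq n by (cases "form \<mu> \<mu>") (auto simp flip: ennreal_plus)
    then show ?thesis using top n by (simp add: enn2ereal_ennreal)
  qed
  then show ?thesis unfolding energy_def P_def N_def .
qed

lemma form_minimal:
  assumes "equilibrium_measure V \<nu>" "borel_prob \<mu>"
  shows "form \<nu> \<nu> \<le> form \<mu> \<mu>"
proof -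
  have "energy V \<nu> \<le> energy V \<mu>" "borel_prob \<nu>" using assms by (auto simp: equilibrium_measure_def)
  then have "enn2ereal (form \<nu> \<nu>) - ereal C \<le> enn2ereal (form \<mu> \<mu>) - ereal C"
    using assms by (simp add: energy_eq)
  then have "enn2ereal (form \<nu> \<nu>) \<le> enn2ereal (form \<mu> \<mu>)"
    by (cases "enn2ereal (form \<nu> \<nu>)"; cases "enn2ereal (form \<mu> \<mu>)") auto
  then show ?thesis by (simp add: less_eq_ennreal.rep_eq)
qed

lemma form_commute:
  assumes "borel_prob \<sigma>" "borel_prob \<tau>"
  shows "form \<sigma> \<tau> = form \<tau> \<sigma>"
proof -
  interpret s: prob_space \<sigma> using assms(1) by (simp add: borel_prob_def)
  interpret t: prob_space \<tau> using assms(2) by (simp add: borel_prob_def)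
  have [measurable_cong]: "sets \<sigma> = sets borel" "sets \<tau> = sets borel"
    using assms by (auto simp: borel_prob_def)
  interpret p: pair_sigma_finite \<sigma> \<tau> ..
  show ?thesis unfolding form_def
    by (subst p.Fubini'[symmetric]) (measurable, simp add: kernel_commute)
qed

end

section \<open>Convex combinations of measures\<close>

lemma ennreal_combination:
  assumes "0 \<le> p" "0 \<le> q" "0 \<le> r" "0 \<le> x" "0 \<le> y" "0 \<le> z"
  shows "ennreal (p * x + q * y + r * z) = ennreal p * ennreal x + ennreal q * ennreal y + ennreal r * ennreal z"
  using assms by (simp add: ennreal_plus ennreal_mult'')

text \<open>The convex combination p \<sigma> + (1 - p) \<tau>, realised by first drawing a
  Bernoulli variable, so that its total mass and its integrals follow from the rules for
  \<open>bind\<close>.\<close>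

definition mixture :: "real \<Rightarrow> real measure \<Rightarrow> real measure \<Rightarrow> real measure" where
  "mixture p \<sigma> \<tau> = measure_pmf (bernoulli_pmf p) \<bind> (\<lambda>b. if b then \<sigma> else \<tau>)"

lemma
  assumes "borel_prob \<sigma>" "borel_prob \<tau>"
  shows borel_prob_mixture: "borel_prob (mixture p \<sigma> \<tau>)"
    and nn_integral_mixture: "f \<in> borel_measurable borel \<Longrightarrow> 0 \<le> p \<Longrightarrow> p \<le> 1 \<Longrightarrow>
      (\<integral>\<^sup>+x. f x \<partial>mixture p \<sigma> \<tau>) = ennreal p * (\<integral>\<^sup>+x. f x \<partial>\<sigma>) + ennreal (1 - p) * (\<integral>\<^sup>+x. f x \<partial>\<tau>)"
proof -
  interpret s: prob_space \<sigma> using assms(1) by (simp add: borel_prob_def)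
  interpret t: prob_space \<tau> using assms(2) by (simp add: borel_prob_def)
  have s[measurable_cong]: "sets \<sigma> = sets borel" "sets \<tau> = sets borel"
    using assms by (auto simp: borel_prob_def)
  have sp: "subprob_space \<sigma>" "subprob_space \<tau>"
    by (rule s.subprob_space_axioms, rule t.subprob_space_axioms)
  have m: "(\<lambda>b. if b then \<sigma> else \<tau>) \<in> measurable (measure_pmf (bernoulli_pmf p)) (subprob_algebra borel)"
    using s sp by (simp add: space_subprob_algebra)
  show "borel_prob (mixture p \<sigma> \<tau>)"
    unfolding borel_prob_def mixture_def
  proof
    show "sets (measure_pmf (bernoulli_pmf p) \<bind> (\<lambda>b. if b then \<sigma> else \<tau>)) = sets borel"
      by (rule sets_bind) (use s in auto)
    show "prob_space (measure_pmf (bernoulli_pmf p) \<bind> (\<lambda>b. if b then \<sigma> else \<tau>))"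
      by (rule measure_pmf.prob_space_bind[OF _ m]) (simp add: s.prob_space_axioms t.prob_space_axioms)
  qed
  assume [measurable]: "f \<in> borel_measurable borel" and p: "0 \<le> p" "p \<le> 1"
  have "(\<integral>\<^sup>+x. f x \<partial>mixture p \<sigma> \<tau>) = (\<integral>\<^sup>+b. (\<integral>\<^sup>+x. f x \<partial>(if b then \<sigma> else \<tau>)) \<partial>measure_pmf (bernoulli_pmf p))"
    unfolding mixture_def by (rule nn_integral_bind[OF _ m]) fact
  also have "\<dots> = ennreal p * (\<integral>\<^sup>+x. f x \<partial>\<sigma>) + ennreal (1 - p) * (\<integral>\<^sup>+x. f x \<partial>\<tau>)"
    using p by (subst nn_integral_bernoulli_pmf) (simp_all add: mult.commute)
  finally show "(\<integral>\<^sup>+x. f x \<partial>mixture p \<sigma> \<tau>) = ennreal p * (\<integral>\<^sup>+x. f x \<partial>\<sigma>) + ennreal (1 - p) * (\<integral>\<^sup>+x. f x \<partial>\<tau>)" .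
qed

context confining_potential
begin

lemma form_mixture:
  assumes \<sigma>: "borel_prob \<sigma>" and \<tau>: "borel_prob \<tau>" and p: "0 \<le> p" "p \<le> 1"
  shows "form (mixture p \<sigma> \<tau>) (mixture p \<sigma> \<tau>) = ennreal (p\<^sup>2) * form \<sigma> \<sigma> +
     ennreal (2 * p * (1 - p)) * form \<sigma> \<tau> + ennreal ((1 - p)\<^sup>2) * form \<tau> \<tau>"
proof -
  interpret s: prob_space \<sigma> using assms(1) by (simp add: borel_prob_def)
  interpret t: prob_space \<tau> using assms(2) by (simp add: borel_prob_def)
  have [measurable_cong]: "sets \<sigma> = sets borel" "sets \<tau> = sets borel"
    using assms by (auto simp: borel_prob_def)
  have [measurable]: "(\<lambda>y. kernel x y) \<in> borel_measurable borel" for x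
    unfolding kernel_def by measurable
  define F where "F \<rho> x = (\<integral>\<^sup>+y. kernel x y \<partial>\<rho>)" for \<rho> x
  have [measurable]: "F \<sigma> \<in> borel_measurable borel" "F \<tau> \<in> borel_measurable borel"
    unfolding F_def by measurable
  have f: "form \<mu> \<rho> = (\<integral>\<^sup>+x. F \<rho> x \<partial>\<mu>)" for \<mu> \<rho>
    by (simp add: form_def F_def)
  have "F (mixture p \<sigma> \<tau>) = (\<lambda>x. ennreal p * F \<sigma> x + ennreal (1 - p) * F \<tau> x)"
    unfolding F_def using p \<sigma> \<tau> by (simp add: nn_integral_mixture)
  then have "form (mixture p \<sigma> \<tau>) (mixture p \<sigma> \<tau>) =
    ennreal p * (ennreal p * form \<sigma> \<sigma> + ennreal (1 - p) * form \<sigma> \<tau>) +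
    ennreal (1 - p) * (ennreal p * form \<tau> \<sigma> + ennreal (1 - p) * form \<tau> \<tau>)"
    using p \<sigma> \<tau> by (simp add: f nn_integral_mixture nn_integral_add nn_integral_cmult)
  also have "form \<tau> \<sigma> = form \<sigma> \<tau>" by (rule form_commute[OF \<tau> \<sigma>])
  also have "ennreal p * (ennreal p * form \<sigma> \<sigma> + ennreal (1 - p) * form \<sigma> \<tau>) +
      ennreal (1 - p) * (ennreal p * form \<sigma> \<tau> + ennreal (1 - p) * form \<tau> \<tau>) =
    (ennreal p * ennreal p) * form \<sigma> \<sigma> + (ennreal p * ennreal (1 - p) + ennreal p * ennreal (1 - p)) * form \<sigma> \<tau> +
    (ennreal (1 - p) * ennreal (1 - p)) * form \<tau> \<tau>"
    by (simp add: distrib_left distrib_right mult_ac add_ac)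
  also have "ennreal p * ennreal p = ennreal (p * p)"
    using p by (simp add: ennreal_mult'')
  also have "ennreal (1 - p) * ennreal (1 - p) = ennreal ((1 - p) * (1 - p))"
    using p by (simp add: ennreal_mult'')
  also have "ennreal p * ennreal (1 - p) + ennreal p * ennreal (1 - p) = ennreal (2 * p * (1 - p))"
  proof -
    have "ennreal (p * (1 - p)) + ennreal (p * (1 - p)) = ennreal (p * (1 - p) + p * (1 - p))"
      using p by (subst ennreal_plus) auto
    then show ?thesis using p by (simp add: ennreal_mult'' mult.assoc)
  qed
  finally show ?thesis by (simp add: power2_eq_square)
qed

text \<open>Two copies carry the potential, the shift \<open>C\<close> of \<open>kernel\<close> and
  the 1 that offsets the -1 in \<open>tent_integral\<close>. The value is nonnegative by
  \<open>V_growth\<close>, so \<open>ennreal\<close> truncates nothing.\<close>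

definition tent_shift :: "real \<Rightarrow> ennreal" where
  "tent_shift x = ennreal (V x / 2 + C / 2 + 1 / 2)"

text \<open>Up to one-variable terms and a constant, the logarithmic kernel is the tent kernel minus
  its defect. Each term stands on the side where it is added, so the identity makes sense in
  \<open>ennreal\<close>; on the diagonal both sides are infinite.\<close>

lemma tent_kernel_eq:
  assumes R: "1 \<le> R"
  shows "tent_kernel R x y + (tent_shift x + tent_shift y) =
    kernel x y + (ennreal (ln R) + ennreal (tent_defect R \<bar>x - y\<bar>))"
proof (cases "x = y")
  case True
  then show ?thesis using R by (simp add: tent_kernel_diagonal kernel_def)
next
  case False
  define d where "d = \<bar>x - y\<bar>"
  have d: "0 < d" using False by (simp add: d_def)
  have t: "0 \<le> tent_defect R d + ln R - ln d - 1"
  proof (cases "d \<le> R")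
    case True
    have "ln (d / R) \<le> d / R - 1" using d R by (intro ln_le_minus_one) auto
    then show ?thesis using True d R by (simp add: tent_defect_def ln_div)
  qed (use d R in \<open>auto simp: tent_defect_def ln_div\<close>)
  have w: "0 \<le> V z / 2 + C / 2 + 1 / 2" for z
    using V_growth[of z] ln_ge_zero[of "1 + \<bar>z\<bar>"] by argo
  have k: "0 \<le> - ln d + V x / 2 + V y / 2 + C"
    using kernel_ge[OF False] ln_ge_zero[of "1 + \<bar>x\<bar>"] ln_ge_zero[of "1 + \<bar>y\<bar>"] unfolding d_def by argo
  have D: "0 \<le> tent_defect R d" using tent_defect_bounds(1)[of d R] d R by simp
  have "tent_kernel R x y + (tent_shift x + tent_shift y) =
    ennreal ((tent_defect R d + ln R - ln d - 1) + ((V x / 2 + C / 2 + 1 / 2) + (V y / 2 + C / 2 + 1 / 2)))"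
    using t w[of x] w[of y] tent_kernel_off_diagonal[OF False R]
    by (simp add: d_def tent_shift_def ennreal_plus[symmetric] add_nonneg_nonneg del: ennreal_plus)
  also have "\<dots> = ennreal ((- ln d + V x / 2 + V y / 2 + C) + (ln R + tent_defect R d))"
    by (rule arg_cong[where f = ennreal]) (simp add: field_simps)
  also have "\<dots> = kernel x y + (ennreal (ln R) + ennreal (tent_defect R d))"
    using k D R False ln_ge_zero[OF R] by (simp add: d_def kernel_def ennreal_plus[symmetric] add_nonneg_nonneg del: ennreal_plus)
  finally show ?thesis unfolding d_def .
qed

definition defect_form :: "real \<Rightarrow> real measure \<Rightarrow> real measure \<Rightarrow> ennreal" where
  "defect_form R \<sigma> \<tau> = (\<integral>\<^sup>+x. \<integral>\<^sup>+y. ennreal (tent_defect R \<bar>x - y\<bar>) \<partial>\<tau> \<partial>\<sigma>)"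

lemma tent_kernel_measurable [measurable]:
  "(\<lambda>(x, y). tent_kernel R x y) \<in> borel_measurable (borel \<Otimes>\<^sub>M borel)"
  unfolding tent_kernel_def by measurable

lemma form_tent:
  assumes R: "1 \<le> R" and \<sigma>: "borel_prob \<sigma>" and \<tau>: "borel_prob \<tau>"
  shows "(\<integral>\<^sup>+x. \<integral>\<^sup>+y. tent_kernel R x y \<partial>\<tau> \<partial>\<sigma>) + ((\<integral>\<^sup>+x. tent_shift x \<partial>\<sigma>) + (\<integral>\<^sup>+x. tent_shift x \<partial>\<tau>)) =
    form \<sigma> \<tau> + (ennreal (ln R) + defect_form R \<sigma> \<tau>)"
proof -
  interpret s: prob_space \<sigma> using \<sigma> by (simp add: borel_prob_def)
  interpret t: prob_space \<tau> using \<tau> by (simp add: borel_prob_def)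
  have [measurable_cong]: "sets \<sigma> = sets borel" "sets \<tau> = sets borel"
    using assms by (auto simp: borel_prob_def)
  have [measurable]: "(\<lambda>y. kernel x y) \<in> borel_measurable borel" for x
    unfolding kernel_def by measurable
  have [measurable]: "tent_shift \<in> borel_measurable borel" unfolding tent_shift_def by measurable
  have [measurable]: "tent_defect R \<in> borel_measurable borel" unfolding tent_defect_def by measurable
  have [measurable]: "tent_kernel R x \<in> borel_measurable borel" for x
    using tent_kernel_measurable[of R] by (rule measurable_Pair_compose_split[where f = "tent_kernel R"]) auto
  have "(\<integral>\<^sup>+x. \<integral>\<^sup>+y. tent_kernel R x y + (tent_shift x + tent_shift y) \<partial>\<tau> \<partial>\<sigma>) =
    (\<integral>\<^sup>+x. \<integral>\<^sup>+y. kernel x y + (ennreal (ln R) + ennreal (tent_defect R \<bar>x - y\<bar>)) \<partial>\<tau> \<partial>\<sigma>)"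
    by (simp only: tent_kernel_eq[OF R])
  then show ?thesis unfolding form_def defect_form_def
    by (simp add: nn_integral_add s.emeasure_space_1 t.emeasure_space_1)
qed

text \<open>At a fixed distance d the defect is eventually d / R, and \<open>1 + kernel\<close> is a
  majorant by \<open>tent_defect_bounds\<close> and \<open>kernel_ge\<close>. Finite energy is
  exactly its integrability.\<close>

lemma defect_form_tendsto_0:
  assumes \<mu>: "borel_prob \<mu>" and fin: "form \<mu> \<mu> \<noteq> \<top>"
  shows "(\<lambda>n. defect_form (real (Suc n)) \<mu> \<mu>) \<longlonglongrightarrow> 0"
proof -
  interpret s: prob_space \<mu> using \<mu> by (simp add: borel_prob_def)
  have [measurable_cong]: "sets \<mu> = sets borel"
    using assms by (auto simp: borel_prob_def)
  interpret pair_sigma_finite \<mu> \<mu> ..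
  have [measurable]: "tent_defect R \<in> borel_measurable borel" for R unfolding tent_defect_def by measurable
  have [measurable]: "(\<lambda>p. kernel (fst p) (snd p)) \<in> borel_measurable (\<mu> \<Otimes>\<^sub>M \<mu>)"
    unfolding kernel_def by measurable
  have D: "defect_form R \<mu> \<mu> = (\<integral>\<^sup>+p. ennreal (tent_defect R \<bar>fst p - snd p\<bar>) \<partial>(\<mu> \<Otimes>\<^sub>M \<mu>))" for R
    unfolding defect_form_def by (subst s.nn_integral_fst[symmetric]) auto
  have "(\<lambda>n. \<integral>\<^sup>+p. ennreal (tent_defect (real (Suc n)) \<bar>fst p - snd p\<bar>) \<partial>(\<mu> \<Otimes>\<^sub>M \<mu>)) \<longlonglongrightarrow> (\<integral>\<^sup>+p. 0 \<partial>(\<mu> \<Otimes>\<^sub>M \<mu>))"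
  proof (rule nn_integral_dominated_convergence[where w = "\<lambda>p. 1 + kernel (fst p) (snd p)"])
    have "(\<integral>\<^sup>+p. 1 + kernel (fst p) (snd p) \<partial>(\<mu> \<Otimes>\<^sub>M \<mu>)) = (\<integral>\<^sup>+p. 1 \<partial>(\<mu> \<Otimes>\<^sub>M \<mu>)) + (\<integral>\<^sup>+p. kernel (fst p) (snd p) \<partial>(\<mu> \<Otimes>\<^sub>M \<mu>))"
      by (rule nn_integral_add) simp_all
    also have "(\<integral>\<^sup>+p. kernel (fst p) (snd p) \<partial>(\<mu> \<Otimes>\<^sub>M \<mu>)) = form \<mu> \<mu>"
      unfolding form_def by (subst s.nn_integral_fst[symmetric]) simp_all
    also have "(\<integral>\<^sup>+p. 1 \<partial>(\<mu> \<Otimes>\<^sub>M \<mu>)) = 1"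
      by (subst s.nn_integral_fst[symmetric]) (auto simp: s.emeasure_space_1)
    finally show "(\<integral>\<^sup>+p. 1 + kernel (fst p) (snd p) \<partial>(\<mu> \<Otimes>\<^sub>M \<mu>)) < \<infinity>"
      using fin by (simp add: less_top)
    fix n
    show "AE p in \<mu> \<Otimes>\<^sub>M \<mu>. ennreal (tent_defect (real (Suc n)) \<bar>fst p - snd p\<bar>) \<le> 1 + kernel (fst p) (snd p)"
    proof (rule AE_I2)
      fix p :: "real \<times> real"
      obtain x y where p: "p = (x, y)" by (cases p)
      show "ennreal (tent_defect (real (Suc n)) \<bar>fst p - snd p\<bar>) \<le> 1 + kernel (fst p) (snd p)"
      proof (cases "x = y")
        case True then show ?thesis by (simp add: p kernel_def)
      next
        case False
        have "tent_defect (real (Suc n)) \<bar>x - y\<bar> \<le> 1 + ln (1 + \<bar>x - y\<bar>)"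
          by (rule tent_defect_bounds) auto
        also have "ln (1 + \<bar>x - y\<bar>) \<le> ln ((1 + \<bar>x\<bar>) * (1 + \<bar>y\<bar>))"
        proof (rule ln_mono)
          have "0 \<le> \<bar>x\<bar> * \<bar>y\<bar>" by simp
          moreover have "(1 + \<bar>x\<bar>) * (1 + \<bar>y\<bar>) = 1 + \<bar>x\<bar> + \<bar>y\<bar> + \<bar>x\<bar> * \<bar>y\<bar>" by (simp add: distrib_left distrib_right)
          ultimately show "1 + \<bar>x - y\<bar> \<le> (1 + \<bar>x\<bar>) * (1 + \<bar>y\<bar>)"
            using abs_triangle_ineq4[of x y] by linarith
        qed auto
        also have "ln ((1 + \<bar>x\<bar>) * (1 + \<bar>y\<bar>)) = ln (1 + \<bar>x\<bar>) + ln (1 + \<bar>y\<bar>)" by (subst ln_mult) auto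
        also have "\<dots> \<le> - ln \<bar>x - y\<bar> + V x / 2 + V y / 2 + C" by (rule kernel_ge[OF False])
        finally have "ennreal (tent_defect (real (Suc n)) \<bar>x - y\<bar>) \<le> ennreal (1 + (- ln \<bar>x - y\<bar> + V x / 2 + V y / 2 + C))"
          by (intro ennreal_leI) simp
        also have "\<dots> = 1 + kernel x y"
        proof -
          have "0 \<le> - ln \<bar>x - y\<bar> + V x / 2 + V y / 2 + C"
            using kernel_ge[OF False] ln_ge_zero[of "1 + \<bar>x\<bar>"] ln_ge_zero[of "1 + \<bar>y\<bar>"] by linarith
          then show ?thesis using False by (subst ennreal_plus) (auto simp: kernel_def)
        qed
        finally show ?thesis by (simp add: p)
      qed
    qed
  next
    show "AE p in \<mu> \<Otimes>\<^sub>M \<mu>. (\<lambda>n. ennreal (tent_defect (real (Suc n)) \<bar>fst p - snd p\<bar>)) \<longlonglongrightarrow> 0"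
    proof (rule AE_I2)
      fix p :: "real \<times> real"
      define d where "d = \<bar>fst p - snd p\<bar>"
      have "eventually (\<lambda>n. real (Suc n) \<ge> d) sequentially"
        by real_asymp
      then have ev: "eventually (\<lambda>n. tent_defect (real (Suc n)) d = d / real (Suc n)) sequentially"
        by eventually_elim (simp add: tent_defect_def)
      have "(\<lambda>n. d / real (Suc n)) \<longlonglongrightarrow> 0" by real_asymp
      then have "(\<lambda>n. tent_defect (real (Suc n)) d) \<longlonglongrightarrow> 0"
        using ev by (subst tendsto_cong)
      then have "(\<lambda>n. ennreal (tent_defect (real (Suc n)) d)) \<longlonglongrightarrow> ennreal 0"
        by (rule tendsto_ennrealI)
      then show "(\<lambda>n. ennreal (tent_defect (real (Suc n)) \<bar>fst p - snd p\<bar>)) \<longlonglongrightarrow> 0"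
        by (simp add: d_def)
    qed
  qed (simp_all add: kernel_def)
  then show ?thesis by (simp add: D)
qed

end

lemma AE_lborel_ex_in_interval:
  fixes a b :: real
  assumes "AE x in lborel. P x" "a < b"
  obtains x where "a < x" "x < b" "P x"
proof -
  obtain N where N: "N \<in> null_sets lborel" "{x. \<not> P x} \<subseteq> N" 
    using assms(1) by (auto simp: eventually_ae_filter)
  have "\<not> {a<..<b} \<subseteq> N"
  proof
    assume "{a<..<b} \<subseteq> N"
    then have "{a<..<b} \<in> null_sets lborel" using null_sets_subset[OF N(1)] by auto
    then show False using assms(2) by (simp add: null_sets_def)
  qed
  then obtain x where "x \<in> {a<..<b}" "x \<notin> N" by blast
  then show ?thesis using N(2) that[of x] by auto
qed

lemma msupp_subset_of_windows:
  assumes \<mu>: "borel_prob \<mu>" and \<nu>: "borel_prob \<nu>"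
    and ae: "AE s in lborel. AE u in lborel. 0 < s \<longrightarrow> emeasure \<mu> {u..u + s} = emeasure \<nu> {u..u + s}"
  shows "msupp \<mu> \<subseteq> msupp \<nu>"
proof
  have [simp]: "sets \<mu> = sets borel" "sets \<nu> = sets borel" using \<mu> \<nu> by (auto simp: borel_prob_def)
  fix x assume x: "x \<in> msupp \<mu>"
  show "x \<in> msupp \<nu>" unfolding msupp_def
  proof safe
    fix e :: real assume e: "0 < e"
    \<comment> \<open>With u between x - 5/8 e and x - 3/8 e, these lengths make the window
      [u, u + s] contain (x - e/4, x + e/4) and stay inside (x - e, x + e). Both ranges have
      positive length, so equality for almost every window suffices.\<close>
    obtain s where s: "e < s" "s < 5/4 * e" and "AE u in lborel. 0 < s \<longrightarrow> emeasure \<mu> {u..u + s} = emeasure \<nu> {u..u + s}"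
      using AE_lborel_ex_in_interval[OF ae, of e "5/4 * e"] e by auto
    then have "AE u in lborel. emeasure \<mu> {u..u + s} = emeasure \<nu> {u..u + s}" using e by auto
    then obtain u where u: "x - 5/8 * e < u" "u < x - 3/8 * e" "emeasure \<mu> {u..u + s} = emeasure \<nu> {u..u + s}"
      using AE_lborel_ex_in_interval[of _ "x - 5/8*e" "x - 3/8*e"] e by auto
    have "0 < emeasure \<mu> {x - e/4<..<x + e/4}" using x e by (auto simp: msupp_def)
    also have "\<dots> \<le> emeasure \<mu> {u..u + s}" using s u e by (intro emeasure_mono) auto
    also have "\<dots> = emeasure \<nu> {u..u + s}" by fact
    also have "\<dots> \<le> emeasure \<nu> {x - e<..<x + e}" using s u e by (intro emeasure_mono) auto
    finally show "0 < emeasure \<nu> {x - e<..<x + e}" .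
  qed
qed

context confining_potential
begin

text \<open>The midpoint of two minimisers cannot have smaller energy, so the cross form is at least
  the common minimum. With the tent identity this bounds the weighted integral of the squared
  differences of window masses by the two tent defects, which vanish in the limit. Almost all
  windows then have equal mass, and that determines the support.\<close>

lemma equilibrium_msupp_unique:
  assumes eq: "equilibrium_measure V \<mu>" "equilibrium_measure V \<nu>" and fin: "form \<nu> \<nu> \<noteq> \<top>"
  shows "msupp \<mu> = msupp \<nu>"
proof -
  have \<mu>: "borel_prob \<mu>" and \<nu>: "borel_prob \<nu>" using eq by (auto simp: equilibrium_measure_def)
  interpret m: prob_space \<mu> using \<mu> by (simp add: borel_prob_def)
  interpret n: prob_space \<nu> using \<nu> by (simp add: borel_prob_def)
  have sets[measurable_cong]: "sets \<mu> = sets borel" "sets \<nu> = sets borel"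
    using \<mu> \<nu> by (auto simp: borel_prob_def)
  have same: "form \<mu> \<mu> = form \<nu> \<nu>"
    using form_minimal[OF eq(1) \<nu>] form_minimal[OF eq(2) \<mu>] by simp
  obtain e where e: "form \<nu> \<nu> = ennreal e" "0 \<le> e" using fin by (cases "form \<nu> \<nu>") auto
  have cross: "form \<nu> \<nu> \<le> form \<mu> \<nu>"
  proof (cases "form \<mu> \<nu>")
    case (real c)
    have "form \<nu> \<nu> \<le> form (mixture (1/2) \<mu> \<nu>) (mixture (1/2) \<mu> \<nu>)"
      by (rule form_minimal[OF eq(2) borel_prob_mixture[OF \<mu> \<nu>]])
    also have "\<dots> = ennreal ((1/2)\<^sup>2 * e + 2 * (1/2) * (1 - 1/2) * c + (1 - 1/2)\<^sup>2 * e)"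
      using form_mixture[OF \<mu> \<nu>, of "1/2"] e real same by (subst ennreal_combination) auto
    finally have "e \<le> (1/2)\<^sup>2 * e + 2 * (1/2) * (1 - 1/2) * c + (1 - 1/2)\<^sup>2 * e"
      unfolding e(1) using e real by (subst (asm) ennreal_le_iff) auto
    then have "e \<le> c" by (simp add: power2_eq_square)
    then show ?thesis using e real by (simp add: ennreal_leI)
  qed simp
  define a where "a p = (\<integral>\<^sup>+x. window p x \<partial>\<mu>)" for p
  define b where "b p = (\<integral>\<^sup>+x. window p x \<partial>\<nu>)" for p
  have a_eq: "a p = emeasure \<mu> {snd p..snd p + fst p}" and b_eq: "b p = emeasure \<nu> {snd p..snd p + fst p}" for p
  proof -
    have w: "window p x = indicator {snd p..snd p + fst p} x" for x
      by (auto simp: window_def)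
    show "a p = emeasure \<mu> {snd p..snd p + fst p}" "b p = emeasure \<nu> {snd p..snd p + fst p}"
      unfolding a_def b_def w by (auto simp: sets)
  qed
  have [measurable]: "a \<in> borel_measurable (borel \<Otimes>\<^sub>M borel)" "b \<in> borel_measurable (borel \<Otimes>\<^sub>M borel)"
    unfolding a_def b_def by measurable
  define g where "g p = ennreal ((enn2real (a p) - enn2real (b p))\<^sup>2)" for p
  have [measurable]: "g \<in> borel_measurable (borel \<Otimes>\<^sub>M borel)"
    unfolding g_def by measurable
  have sq: "a p * a p + b p * b p = a p * b p + b p * a p + g p" for p
  proof -
    obtain x y where x: "a p = ennreal x" "0 \<le> x" and y: "b p = ennreal y" "0 \<le> y"
      using m.emeasure_finite n.emeasure_finite unfolding a_eq b_eq by (metis ennreal_cases top_neq_ennreal infinity_ennreal_def)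
    have "ennreal (x * x + y * y) = ennreal ((x * y + y * x) + (x - y)\<^sup>2)"
      by (rule arg_cong[where f = ennreal]) (simp add: power2_eq_square algebra_simps)
    then have "ennreal (x * x) + ennreal (y * y) = ennreal (x * y) + ennreal (y * x) + ennreal ((x - y)\<^sup>2)"
      using x y by (simp only: ennreal_plus mult_nonneg_nonneg add_nonneg_nonneg zero_le_power2)
    then show ?thesis unfolding g_def x(1) y(1) using x(2) y(2)
      by (simp only: ennreal_mult enn2real_ennreal)
  qed
  define Q where "Q R = (\<integral>\<^sup>+p. tent_weight R p * g p \<partial>(lborel \<Otimes>\<^sub>M lborel))" for R
  define TT where "TT R \<sigma> \<tau> = (\<integral>\<^sup>+x. \<integral>\<^sup>+y. tent_kernel R x y \<partial>\<tau> \<partial>\<sigma>)" for R \<sigma> \<tau>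
  have TT: "TT R \<mu> \<mu> + TT R \<nu> \<nu> = TT R \<mu> \<nu> + TT R \<nu> \<mu> + Q R" for R
    unfolding TT_def Q_def tent_form[OF \<mu> \<mu>] tent_form[OF \<mu> \<nu>] tent_form[OF \<nu> \<mu>] tent_form[OF \<nu> \<nu>]
      a_def[symmetric] b_def[symmetric]
    by (subst nn_integral_add[symmetric], simp, simp)+ (simp add: sq flip: distrib_left)
  have Q_le: "Q R \<le> defect_form R \<mu> \<mu> + defect_form R \<nu> \<nu>" if R: "1 \<le> R" for R
  proof -
    define W where "W \<sigma> = (\<integral>\<^sup>+x. tent_shift x \<partial>\<sigma>)" for \<sigma>
    note f = form_tent[OF R, folded TT_def W_def]
    \<comment> \<open>In the extended reals only a finite summand can be cancelled, so
      \<open>2 * e + 2 * ln R\<close> is carried through the whole chain and removed at its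
      end.\<close>
    have "ennreal (2 * e + 2 * ln R) + Q R = (ennreal e + ennreal (ln R)) + (ennreal e + ennreal (ln R)) + Q R"
      using e R ln_ge_zero[OF R] by (simp add: ennreal_plus[symmetric] del: ennreal_plus)
    also have "\<dots> \<le> (form \<mu> \<nu> + (ennreal (ln R) + defect_form R \<mu> \<nu>)) + (form \<nu> \<mu> + (ennreal (ln R) + defect_form R \<nu> \<mu>)) + Q R"
      using cross form_commute[OF \<mu> \<nu>] unfolding e(1)
      by (intro add_mono) (simp_all add: add_increasing2)
    also have "\<dots> = (TT R \<mu> \<nu> + TT R \<nu> \<mu> + Q R) + (W \<mu> + W \<nu> + (W \<nu> + W \<mu>))"
      unfolding f[OF \<mu> \<nu>, symmetric] f[OF \<nu> \<mu>, symmetric] by (simp add: ac_simps)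
    also have "\<dots> = (TT R \<mu> \<mu> + (W \<mu> + W \<mu>)) + (TT R \<nu> \<nu> + (W \<nu> + W \<nu>))"
      unfolding TT[symmetric] by (simp add: ac_simps)
    also have "\<dots> = (ennreal e + (ennreal (ln R) + defect_form R \<mu> \<mu>)) + (ennreal e + (ennreal (ln R) + defect_form R \<nu> \<nu>))"
      unfolding f[OF \<mu> \<mu>] f[OF \<nu> \<nu>] same e(1) ..
    also have "\<dots> = (ennreal e + ennreal e + (ennreal (ln R) + ennreal (ln R))) + (defect_form R \<mu> \<mu> + defect_form R \<nu> \<nu>)"
      by (simp add: ac_simps)
    also have "ennreal e + ennreal e + (ennreal (ln R) + ennreal (ln R)) = ennreal (2 * e + 2 * ln R)"
      using e R ln_ge_zero[OF R] by (simp add: ennreal_plus[symmetric] del: ennreal_plus)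
    finally show ?thesis by (simp add: ennreal_add_left_cancel_le)
  qed
  \<comment> \<open>\<open>Q\<close> increases with R while the bounds tend to 0, so it vanishes at
    every R and not only in the limit.\<close>
  have Q0: "Q R = 0" for R
  proof -
    have "(\<lambda>n. defect_form (real (Suc n)) \<mu> \<mu> + defect_form (real (Suc n)) \<nu> \<nu>) \<longlonglongrightarrow> 0 + 0"
      using fin same by (intro tendsto_add defect_form_tendsto_0 \<mu> \<nu>) auto
    moreover have "eventually (\<lambda>n. Q R \<le> defect_form (real (Suc n)) \<mu> \<mu> + defect_form (real (Suc n)) \<nu> \<nu>) sequentially"
    proof -
      have "eventually (\<lambda>n. R \<le> real (Suc n)) sequentially" by real_asymp
      then show ?thesis
      proof eventually_elim
        case (elim n)
        have "Q R \<le> Q (real (Suc n))" unfolding Q_def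
          by (intro nn_integral_mono mult_right_mono) (use elim in \<open>auto simp: tent_weight_def\<close>)
        also have "\<dots> \<le> defect_form (real (Suc n)) \<mu> \<mu> + defect_form (real (Suc n)) \<nu> \<nu>"
          by (rule Q_le) simp
        finally show ?case .
      qed
    qed
    ultimately have "Q R \<le> 0" by (intro tendsto_lowerbound[of _ "0::ennreal" sequentially]) auto
    then show ?thesis by simp
  qed
  have "AE p in lborel \<Otimes>\<^sub>M lborel. \<forall>n. tent_weight (real n) p * g p = 0"
    unfolding AE_all_countable
  proof
    fix n
    show "AE p in lborel \<Otimes>\<^sub>M lborel. tent_weight (real n) p * g p = 0"
      using Q0[of "real n"] unfolding Q_def by (subst (asm) nn_integral_0_iff_AE) auto
  qed
  then have "AE p in lborel \<Otimes>\<^sub>M lborel. 0 < fst p \<longrightarrow> a p = b p"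
  proof eventually_elim
    case (elim p)
    show ?case
    proof
      assume s: "0 < fst p"
      obtain n where "fst p \<le> real n" using real_arch_simple by blast
      then have "tent_weight (real n) p \<noteq> 0" using s by (simp add: tent_weight_def)
      then have "g p = 0" using elim by (metis mult_eq_0_iff)
      then have "enn2real (a p) = enn2real (b p)" by (simp add: g_def)
      then show "a p = b p" unfolding a_eq b_eq
        by (metis m.emeasure_eq_measure n.emeasure_eq_measure measure_def)
    qed
  qed
  from lborel_pair.AE_pair[OF this] have ae: "AE s in lborel. AE u in lborel. 0 < s \<longrightarrow> emeasure \<mu> {u..u + s} = emeasure \<nu> {u..u + s}"
    by (simp add: a_eq b_eq)
  show ?thesis
    by (intro equalityI msupp_subset_of_windows \<mu> \<nu>) (use ae in auto)
qed

end

section \<open>Euler--Lagrange conditions\<close>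

text \<open>The substitution w = x - y moves x from the factor that is merely locally integrable
  into the continuous one, where dominated convergence applies.\<close>

lemma convolution_continuous:
  fixes \<phi> \<rho> :: "real \<Rightarrow> real"
  assumes [measurable]: "\<phi> \<in> borel_measurable borel"
    and \<phi>: "\<And>R. set_integrable lborel {-R..R} \<phi>"
    and \<rho>: "continuous_on UNIV \<rho>" "\<And>y. y \<notin> {a..b} \<Longrightarrow> \<rho> y = 0"
  shows "integrable lborel (\<lambda>y. \<phi> (x - y) * \<rho> y)"
    and "continuous_on UNIV (\<lambda>x. \<integral>y. \<phi> (x - y) * \<rho> y \<partial>lborel)"
proof -
  have [measurable]: "\<rho> \<in> borel_measurable borel" using \<rho>(1) by (rule borel_measurable_continuous_onI)
  obtain M where M: "\<And>y. \<bar>\<rho> y\<bar> \<le> M"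
  proof -
    have "bounded (\<rho> ` {a..b})"
      using \<rho>(1) by (intro compact_imp_bounded compact_continuous_image) (auto intro: continuous_on_subset)
    then obtain M where "0 < M" "\<And>y. y \<in> {a..b} \<Longrightarrow> \<bar>\<rho> y\<bar> \<le> M"
      by (auto simp: bounded_pos)
    then have "\<bar>\<rho> y\<bar> \<le> M" for y using \<rho>(2)[of y] by (cases "y \<in> {a..b}") auto
    then show ?thesis by (rule that)
  qed
  \<comment> \<open>For \<bar>x\<bar> \<le> r every w with x - w in [a, b] lies in this interval, so
    \<open>B r\<close> dominates the integrand for all such x at once.\<close>
  define B where "B r w = M * \<bar>indicator {-(r + \<bar>a\<bar> + \<bar>b\<bar>)..r + \<bar>a\<bar> + \<bar>b\<bar>} w * \<phi> w\<bar>" for r w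
  have Bi: "integrable lborel (B r)" for r
    unfolding B_def using \<phi>[of "r + \<bar>a\<bar> + \<bar>b\<bar>"] by (auto simp: set_integrable_def)
  have Bb: "\<bar>\<phi> w * \<rho> (x - w)\<bar> \<le> B r w" if "\<bar>x\<bar> \<le> r" for x w r
  proof (cases "x - w \<in> {a..b}")
    case True
    then have "w \<in> {-(r + \<bar>a\<bar> + \<bar>b\<bar>)..r + \<bar>a\<bar> + \<bar>b\<bar>}" using that by auto
    moreover have "\<bar>\<phi> w\<bar> * \<bar>\<rho> (x - w)\<bar> \<le> \<bar>\<phi> w\<bar> * M" by (intro mult_left_mono M) auto
    ultimately show ?thesis by (simp add: B_def abs_mult mult.commute)
  next
    case False
    have "0 \<le> M" using M[of 0] by linarith
    then show ?thesis using \<rho>(2)[OF False] by (simp add: B_def)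
  qed
  have i: "integrable lborel (\<lambda>w. \<phi> w * \<rho> (x - w))" for x
    by (rule Bochner_Integration.integrable_bound[OF Bi[of "\<bar>x\<bar>"]]) (use Bb[of x "\<bar>x\<bar>"] in \<open>auto intro!: AE_I2 order_trans[OF _ abs_ge_self]\<close>)
  from lborel_integrable_real_affine[OF i[of x], of "-1" x]
  show "integrable lborel (\<lambda>y. \<phi> (x - y) * \<rho> y)" by simp
  have eq: "(\<integral>y. \<phi> (x - y) * \<rho> y \<partial>lborel) = (\<integral>w. \<phi> w * \<rho> (x - w) \<partial>lborel)" for x
    using lborel_integral_real_affine[of "-1" "\<lambda>w. \<phi> w * \<rho> (x - w)" x] by simp
  have "isCont (\<lambda>x. \<integral>w. \<phi> w * \<rho> (x - w) \<partial>lborel) x0" for x0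
    unfolding isCont_def
  proof (rule tendsto_at_iff_sequentially[THEN iffD2], intro allI impI)
    fix X assume X: "\<forall>i. X i \<in> UNIV - {x0}" "X \<longlonglongrightarrow> x0"
    obtain r where r: "\<And>n. \<bar>X n\<bar> \<le> r"
      using convergent_imp_Bseq[OF convergentI[OF X(2)]] by (auto simp: Bseq_def)
    show "((\<lambda>x. \<integral>w. \<phi> w * \<rho> (x - w) \<partial>lborel) \<circ> X) \<longlonglongrightarrow> (\<integral>w. \<phi> w * \<rho> (x0 - w) \<partial>lborel)"
      unfolding comp_def
    proof (rule integral_dominated_convergence[where w = "B r"])
      show "AE w in lborel. (\<lambda>n. \<phi> w * \<rho> (X n - w)) \<longlonglongrightarrow> \<phi> w * \<rho> (x0 - w)"
        using \<rho>(1) X(2) by (intro AE_I2 tendsto_mult tendsto_const isCont_tendsto_compose[where g = \<rho>] tendsto_diff)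
          (auto simp: continuous_on_eq_continuous_at)
      show "AE w in lborel. norm (\<phi> w * \<rho> (X n - w)) \<le> B r w" for n
        using Bb[OF r] by auto
    qed (use Bi in auto)
  qed
  then show "continuous_on UNIV (\<lambda>x. \<integral>y. \<phi> (x - y) * \<rho> y \<partial>lborel)"
    unfolding eq by (simp add: continuous_on_eq_continuous_at)
qed

section \<open>Probability measures with a continuous density of bounded support\<close>

locale continuous_density =
  fixes \<rho> :: "real \<Rightarrow> real" and a b :: real
  assumes \<rho>_cont: "continuous_on UNIV \<rho>"
    and \<rho>_nonneg: "\<And>y. 0 \<le> \<rho> y"
    and \<rho>_zero: "\<And>y. y \<notin> {a..b} \<Longrightarrow> \<rho> y = 0"
    and \<rho>_prob: "(\<integral>\<^sup>+y. ennreal (\<rho> y) \<partial>lborel) = 1"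
begin

definition law :: "real measure" where
  "law = density lborel (\<lambda>y. ennreal (\<rho> y))"

definition log_pot :: "real \<Rightarrow> real" where
  "log_pot x = (\<integral>y. ln \<bar>x - y\<bar> \<partial>law)"

lemma \<rho>_measurable [measurable]: "\<rho> \<in> borel_measurable borel"
  using \<rho>_cont by (rule borel_measurable_continuous_onI)

lemma sets_law [simp, measurable_cong]: "sets law = sets borel"
  by (simp add: law_def)

lemma space_law [simp]: "space law = UNIV"
  by (simp add: law_def)

lemma borel_prob_law: "borel_prob law"
  unfolding borel_prob_def
proof
  show "prob_space law"
    by (rule prob_spaceI) (simp add: law_def emeasure_density \<rho>_prob)
qed simp

sublocale law: prob_space law
  using borel_prob_law by (simp add: borel_prob_def)

lemma AE_law: "(AE y in law. P y) \<longleftrightarrow> (AE y in lborel. 0 < \<rho> y \<longrightarrow> P y)"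
  unfolding law_def by (subst AE_density) auto

lemma AE_law_neq: "AE y in law. x \<noteq> y"
  unfolding AE_law using AE_lborel_singleton[of x] by eventually_elim auto

lemma integrable_law:
  fixes f :: "real \<Rightarrow> real"
  assumes [measurable]: "f \<in> borel_measurable borel"
  shows "integrable law f \<longleftrightarrow> integrable lborel (\<lambda>y. f y * \<rho> y)"
  unfolding law_def by (subst integrable_density) (auto simp: \<rho>_nonneg mult.commute)

lemma integral_law:
  fixes f :: "real \<Rightarrow> real"
  assumes [measurable]: "f \<in> borel_measurable borel"
  shows "integral\<^sup>L law f = (\<integral>y. f y * \<rho> y \<partial>lborel)"
  unfolding law_def by (subst integral_density) (auto simp: \<rho>_nonneg mult.commute)

lemma integrable_law_continuous:
  fixes f :: "real \<Rightarrow> real"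
  assumes "continuous_on UNIV f"
  shows "integrable law f"
proof -
  have [measurable]: "f \<in> borel_measurable borel" using assms by (rule borel_measurable_continuous_onI)
  have "set_integrable lborel {a..b} (\<lambda>y. f y * \<rho> y)"
    using assms \<rho>_cont
    by (intro borel_integrable_atLeastAtMost' continuous_intros) (auto intro: continuous_on_subset)
  then have "integrable lborel (\<lambda>y. f y * \<rho> y)"
    unfolding set_integrable_def
    by (rule Bochner_Integration.integrable_cong[THEN iffD1, rotated -1]) (auto simp: \<rho>_zero split: split_indicator)
  then show ?thesis by (subst integrable_law) auto
qed

lemma continuous_abs_ln: "continuous_on UNIV (\<lambda>x. \<integral>y. \<bar>ln \<bar>x - y\<bar>\<bar> \<partial>law)"
  and integrable_law_ln: "integrable law (\<lambda>y. ln \<bar>x - y\<bar>)"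
  and continuous_log_pot: "continuous_on UNIV log_pot"
proof -
  have 1: "set_integrable lborel {-R..R} (\<lambda>u. ln \<bar>u\<bar>)" for R :: real
    by (rule ln_abs_set_integrable)
  have 2: "set_integrable lborel {-R..R} (\<lambda>u. \<bar>ln \<bar>u\<bar>\<bar>)" for R :: real
    using 1 by (rule set_integrable_abs)
  show "continuous_on UNIV (\<lambda>x. \<integral>y. \<bar>ln \<bar>x - y\<bar>\<bar> \<partial>law)"
    using convolution_continuous(2)[OF _ 2 \<rho>_cont \<rho>_zero] by (subst integral_law) auto
  show "integrable law (\<lambda>y. ln \<bar>x - y\<bar>)"
    using convolution_continuous(1)[OF _ 1 \<rho>_cont \<rho>_zero] by (subst integrable_law) auto
  show "continuous_on UNIV log_pot"
    unfolding log_pot_def using convolution_continuous(2)[OF _ 1 \<rho>_cont \<rho>_zero] by (subst integral_law) auto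
qed

end

text \<open>A point mass has infinite energy; these normalised tents are the trial measures that
  localise near x0 with finite energy.\<close>

lemma bump_density:
  fixes x0 e :: real
  assumes "0 < e"
  obtains \<tau> where "continuous_density \<tau> (x0 - e) (x0 + e)"
proof -
  define g where "g y = max 0 (e - \<bar>y - x0\<bar>)" for y :: real
  have gc: "continuous_on UNIV g" unfolding g_def by (intro continuous_intros)
  then have [measurable]: "g \<in> borel_measurable borel" by (rule borel_measurable_continuous_onI)
  define I where "I = (\<integral>\<^sup>+y. ennreal (g y) \<partial>lborel)"
  have "I \<le> (\<integral>\<^sup>+y. ennreal e * indicator {x0 - e..x0 + e} y \<partial>lborel)"
    unfolding I_def by (intro nn_integral_mono) (use assms in \<open>auto simp: g_def ennreal_eq_0_iff split: split_indicator intro!: ennreal_leI\<close>)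
  also have "\<dots> = ennreal e * ennreal (2 * e)" using assms by (simp add: nn_integral_cmult_indicator)
  also have "\<dots> < \<top>" by (simp add: ennreal_mult_less_top)
  finally have I1: "I < \<top>" .
  have "ennreal (e/2) * ennreal e = (\<integral>\<^sup>+y. ennreal (e/2) * indicator {x0 - e/2..x0 + e/2} y \<partial>lborel)"
    using assms by (simp add: nn_integral_cmult_indicator)
  also have "\<dots> \<le> I"
    unfolding I_def by (intro nn_integral_mono) (use assms in \<open>auto simp: g_def abs_if split: split_indicator intro!: ennreal_leI max.coboundedI2\<close>)
  finally have "ennreal (e/2) * ennreal e \<le> I" .
  moreover have "0 < ennreal (e/2) * ennreal e" using assms by (simp add: ennreal_zero_less_mult_iff)
  ultimately have I0: "0 < I" by simp
  obtain i where i: "I = ennreal i" "0 < i" using I0 I1 by (cases I) auto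
  have "continuous_density (\<lambda>y. g y / i) (x0 - e) (x0 + e)"
  proof
    show "continuous_on UNIV (\<lambda>y. g y / i)" using gc i by (intro continuous_intros) auto
    show "0 \<le> g y / i" for y using i by (simp add: g_def)
    show "g y / i = 0" if "y \<notin> {x0 - e..x0 + e}" for y using that by (auto simp: g_def)
    have "(\<integral>\<^sup>+y. ennreal (g y / i) \<partial>lborel) = (\<integral>\<^sup>+y. ennreal (1 / i) * ennreal (g y) \<partial>lborel)"
      using i by (intro nn_integral_cong) (simp add: ennreal_mult'[symmetric])
    also have "\<dots> = ennreal (1 / i) * ennreal i"
      by (simp add: nn_integral_cmult I_def[symmetric] i)
    also have "\<dots> = 1" using i by (simp add: ennreal_mult'[symmetric])
    finally show "(\<integral>\<^sup>+y. ennreal (g y / i) \<partial>lborel) = 1" .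
  qed
  then show ?thesis by (rule that)
qed

context confining_potential
begin

text \<open>The first variation at a minimiser: the mixture with small weight p on \<sigma> is
  compared with \<nu>, and after division by p only the terms linear in p survive as p tends to 0.
  Finite energy of \<sigma> makes the quadratic term harmless.\<close>

lemma form_minimal_cross:
  assumes eq: "equilibrium_measure V \<nu>" and \<sigma>: "borel_prob \<sigma>"
    and fin: "form \<nu> \<nu> \<noteq> \<top>" "form \<sigma> \<sigma> \<noteq> \<top>"
  shows "form \<nu> \<nu> \<le> form \<sigma> \<nu>"
proof (cases "form \<sigma> \<nu>")
  case (real B)
  have \<nu>: "borel_prob \<nu>" using eq by (simp add: equilibrium_measure_def)
  obtain m where m: "form \<nu> \<nu> = ennreal m" "0 \<le> m" using fin by (cases "form \<nu> \<nu>") auto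
  obtain A where A: "form \<sigma> \<sigma> = ennreal A" "0 \<le> A" using fin by (cases "form \<sigma> \<sigma>") auto
  have *: "2 * m \<le> p * A + 2 * (1 - p) * B + p * m" if p: "0 < p" "p < 1" for p
  proof -
    have "form \<nu> \<nu> \<le> form (mixture p \<sigma> \<nu>) (mixture p \<sigma> \<nu>)"
      by (rule form_minimal[OF eq borel_prob_mixture[OF \<sigma> \<nu>]])
    also have "\<dots> = ennreal (p\<^sup>2 * A + (2 * p * (1 - p)) * B + (1 - p)\<^sup>2 * m)"
      using form_mixture[OF \<sigma> \<nu>, of p] A m real p by (subst ennreal_combination) auto
    finally have "m \<le> p\<^sup>2 * A + (2 * p * (1 - p)) * B + (1 - p)\<^sup>2 * m"
      unfolding m(1) using p A m real by (subst (asm) ennreal_le_iff) auto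
    then have "p * (2 * m) \<le> p * (p * A + 2 * (1 - p) * B + p * m)"
      by (simp add: power2_eq_square algebra_simps)
    then show ?thesis using p by simp
  qed
  have "((\<lambda>p. p * A + 2 * (1 - p) * B + p * m) \<longlongrightarrow> 0 * A + 2 * (1 - 0) * B + 0 * m) (at_right 0)"
    by (intro tendsto_intros)
  moreover have "eventually (\<lambda>p. 2 * m \<le> p * A + 2 * (1 - p) * B + p * m) (at_right (0::real))"
    using eventually_at_right_real[of 0 "1::real", OF zero_less_one] by (rule eventually_mono) (use * in auto)
  ultimately have "2 * m \<le> 0 * A + 2 * (1 - 0) * B + 0 * m"
    by (intro tendsto_lowerbound) auto
  then show ?thesis using m real by (simp add: ennreal_leI)
qed simp

end

locale potential_and_density = confining_potential V C + continuous_density \<rho> a b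
  for V C \<rho> a b
begin

definition mean_V :: real where
  "mean_V = (\<integral>y. V y / 2 \<partial>law)"

lemma integrable_V: "integrable law (\<lambda>y. V y / 2)"
  using V_cont by (intro integrable_law_continuous continuous_intros) auto

lemma kernel_law:
  shows "0 \<le> V x / 2 - log_pot x + (mean_V + C)"
    and "(\<integral>\<^sup>+y. kernel x y \<partial>law) = ennreal (V x / 2 - log_pot x + (mean_V + C))"
proof -
  define k where "k y = - ln \<bar>x - y\<bar> + V x / 2 + V y / 2 + C" for y
  have ki: "integrable law k" unfolding k_def
    using integrable_law_ln[of x] integrable_V by auto
  have kI: "integral\<^sup>L law k = V x / 2 - log_pot x + (mean_V + C)"
    unfolding k_def using integrable_law_ln[of x] integrable_V
    by (simp add: log_pot_def mean_V_def law.prob_space[simplified])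
  have k0: "AE y in law. 0 \<le> k y"
    using AE_law_neq[of x]
  proof eventually_elim
    case (elim y)
    show ?case using kernel_ge[OF elim] ln_ge_zero[of "1 + \<bar>x\<bar>"] ln_ge_zero[of "1 + \<bar>y\<bar>"]
      unfolding k_def by linarith
  qed
  show "0 \<le> V x / 2 - log_pot x + (mean_V + C)"
    unfolding kI[symmetric] by (rule integral_nonneg_AE[OF k0])
  have "(\<integral>\<^sup>+y. kernel x y \<partial>law) = (\<integral>\<^sup>+y. ennreal (k y) \<partial>law)"
    using AE_law_neq[of x] by (intro nn_integral_cong_AE, eventually_elim) (auto simp: kernel_def k_def)
  also have "\<dots> = ennreal (integral\<^sup>L law k)"
    by (rule nn_integral_eq_integral[OF ki k0])
  finally show "(\<integral>\<^sup>+y. kernel x y \<partial>law) = ennreal (V x / 2 - log_pot x + (mean_V + C))"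
    unfolding kI .
qed

lemma field_continuous: "continuous_on UNIV (\<lambda>x. V x / 2 - log_pot x + (mean_V + C))"
  using V_cont continuous_log_pot by (intro continuous_intros) auto

lemma form_law: "form \<sigma> law = (\<integral>\<^sup>+x. ennreal (V x / 2 - log_pot x + (mean_V + C)) \<partial>\<sigma>)"
  unfolding form_def kernel_law(2) ..

lemma form_law_law: "form law law = ennreal (\<integral>x. V x / 2 - log_pot x + (mean_V + C) \<partial>law)"
  unfolding form_law
  by (rule nn_integral_eq_integral[OF integrable_law_continuous[OF field_continuous]]) (simp add: kernel_law(1))

text \<open>A value of \<open>S\<close> below its mean m would persist near that point, and a bump
  placed there would violate \<open>form_minimal_cross\<close>. So \<open>S\<close> is at least m
  everywhere with mean m, hence equal to m almost everywhere, and by continuity at every point of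
  the support.\<close>

lemma Euler_Lagrange:
  assumes eq: "equilibrium_measure V law"
  obtains l where "\<And>x. log_pot x \<le> V x / 2 + l" "\<And>x. x \<in> msupp law \<Longrightarrow> log_pot x = V x / 2 + l"
proof -
  define S where "S x = V x / 2 - log_pot x + (mean_V + C)" for x
  have Sc: "continuous_on UNIV S" unfolding S_def by (rule field_continuous)
  define m where "m = integral\<^sup>L law S"
  have m0: "0 \<le> m" unfolding m_def S_def by (intro Bochner_Integration.integral_nonneg) (simp add: kernel_law(1))
  have m: "form law law = ennreal m" unfolding form_law_law S_def m_def ..
  have ge: "m \<le> S x" for x
  proof (rule ccontr)
    assume "\<not> m \<le> S x"
    define \<eta> where "\<eta> = (m - S x) / 2"
    have \<eta>: "0 < \<eta>" using \<open>\<not> m \<le> S x\<close> by (simp add: \<eta>_def)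
    have "isCont S x" using Sc by (simp add: continuous_on_eq_continuous_at)
    then obtain e where e: "0 < e" "\<And>y. \<bar>y - x\<bar> < e \<Longrightarrow> \<bar>S y - S x\<bar> < \<eta>"
      using \<eta> unfolding continuous_at_eps_delta by (auto simp: dist_real_def)
    have Sy: "S y \<le> m - \<eta>" if "\<bar>y - x\<bar> < e" for y
      using e(2)[OF that] by (auto simp: \<eta>_def abs_if field_simps split: if_splits)
    obtain \<tau> where \<tau>: "continuous_density \<tau> (x - e/2) (x + e/2)" using bump_density[of "e/2" x] e by auto
    interpret T: potential_and_density V C \<tau> "x - e/2" "x + e/2"
      using \<tau> confining_potential_axioms by (simp add: potential_and_density_def)
    have "form law law \<le> form T.law law"
      by (rule form_minimal_cross[OF eq T.borel_prob_law]) (simp_all add: m T.form_law_law)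
    also have "\<dots> \<le> (\<integral>\<^sup>+x. ennreal (m - \<eta>) \<partial>T.law)"
      unfolding form_law S_def[symmetric]
    proof (intro nn_integral_mono_AE)
      have "AE y in T.law. y \<in> {x - e/2..x + e/2}"
        unfolding T.AE_law using T.\<rho>_zero by (intro AE_I2) force
      then show "AE y in T.law. ennreal (S y) \<le> ennreal (m - \<eta>)"
        by eventually_elim (use e in \<open>auto intro!: ennreal_leI Sy\<close>)
    qed
    also have "\<dots> = ennreal (m - \<eta>)" using T.law.emeasure_space_1 by simp
    finally have "ennreal m \<le> ennreal (m - \<eta>)" unfolding m .
    moreover have "0 \<le> m - \<eta>" using kernel_law(1)[of x] Sy[of x] e unfolding S_def by auto
    ultimately show False using \<eta> by simp
  qed
  have "(\<integral>x. S x - m \<partial>law) = 0"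
    using integrable_law_continuous[OF Sc] by (simp add: m_def law.prob_space[simplified])
  then have ae: "AE x in law. S x = m"
    using integrable_law_continuous[OF Sc] ge
    by (subst (asm) integral_nonneg_eq_0_iff_AE) auto
  have eqS: "S x = m" if "x \<in> msupp law" for x
  proof (rule ccontr)
    assume "S x \<noteq> m"
    then have "m < S x" using ge[of x] by simp
    moreover have "isCont S x" using Sc by (simp add: continuous_on_eq_continuous_at)
    ultimately obtain e where e: "0 < e" "\<And>y. \<bar>y - x\<bar> < e \<Longrightarrow> \<bar>S y - S x\<bar> < S x - m"
      unfolding continuous_at_eps_delta dist_real_def by (metis diff_gt_0_iff_gt)
    have "AE y in law. y \<notin> {x - e<..<x + e}"
      using ae
    proof eventually_elim
      case (elim y)
      show ?case
      proof
        assume "y \<in> {x - e<..<x + e}"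
        then have "\<bar>y - x\<bar> < e" by auto
        from e(2)[OF this] show False using elim by linarith
      qed
    qed
    then have "emeasure law {x - e<..<x + e} = 0"
      by (subst (asm) AE_iff_measurable[of "{x - e<..<x + e}"]) auto
    then show False using that e by (auto simp: msupp_def)
  qed
  show ?thesis
  proof (rule that[of "mean_V + C - m"])
    fix x
    show "log_pot x \<le> V x / 2 + (mean_V + C - m)" using ge[of x] by (simp add: S_def)
    show "x \<in> msupp law \<Longrightarrow> log_pot x = V x / 2 + (mean_V + C - m)" using eqS[of x] by (simp add: S_def)
  qed
qed

end

section \<open>Minimality of the support among intervals\<close>

lemma integrable_angle_continuous:
  fixes f :: "real \<Rightarrow> real"
  assumes "continuous_on UNIV f"
  shows "integrable angle f"
proof -
  have "f \<in> borel_measurable borel" using assms by (rule borel_measurable_continuous_onI)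
  moreover have "set_integrable lborel {0..pi} f"
    using assms by (intro borel_integrable_atLeastAtMost') (auto intro: continuous_on_subset)
  ultimately show ?thesis by (simp add: integrable_angle)
qed

lemma integral_angle_eq_0_D:
  fixes f :: "real \<Rightarrow> real"
  assumes f: "continuous_on UNIV f" and nonneg: "\<And>x. 0 \<le> f x"
    and zero: "integral\<^sup>L angle f = 0" and x: "x \<in> {0..pi}"
  shows "f x = 0"
proof (rule ccontr)
  assume "f x \<noteq> 0"
  then have "0 < f x" using nonneg[of x] by simp
  moreover have "isCont f x" using f by (simp add: continuous_on_eq_continuous_at)
  ultimately obtain e where e: "0 < e" "\<And>y. \<bar>y - x\<bar> < e \<Longrightarrow> \<bar>f y - f x\<bar> < f x"
    unfolding continuous_at_eps_delta dist_real_def by metis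
  have "AE y in angle. f y = 0"
    using zero integrable_angle_continuous[OF f] nonneg by (subst (asm) integral_nonneg_eq_0_iff_AE) auto
  then have ae: "AE y in lborel. y \<in> {0..pi} \<longrightarrow> f y = 0" by (simp add: AE_angle)
  have "max 0 (x - e) < min pi (x + e)" using x e pi_gt_zero by auto
  then obtain y where "max 0 (x - e) < y" "y < min pi (x + e)" "y \<in> {0..pi} \<longrightarrow> f y = 0"
    using AE_lborel_ex_in_interval[OF ae] by blast
  then have "f y = 0" "\<bar>y - x\<bar> < e" by auto
  then show False using e(2)[of y] by auto
qed

text \<open>The interval with midpoint \<open>m\<close> and radius \<open>r\<close> has capacity \<open>r / 2\<close>, and \<open>green m r\<close> is its Green function.\<close>
definition interval_energy :: "(real \<Rightarrow> real) \<Rightarrow> real \<Rightarrow> real \<Rightarrow> real" where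
  "interval_energy V m r = (\<integral>\<phi>. V (m + r * cos \<phi>) \<partial>angle) - 2 * ln r"

definition green :: "real \<Rightarrow> real \<Rightarrow> real \<Rightarrow> real" where
  "green m r y = (\<integral>\<phi>. ln \<bar>m + r * cos \<phi> - y\<bar> \<partial>angle) - ln (r / 2)"

lemma green_inside: "0 < r \<Longrightarrow> \<bar>y - m\<bar> \<le> r \<Longrightarrow> green m r y = 0"
  by (simp add: green_def arcsine_potential_inside)

lemma green_outside: "0 < r \<Longrightarrow> r \<le> \<bar>y - m\<bar> \<Longrightarrow> ln 3 / pi * min pi (sqrt (\<bar>y - m\<bar> / r - 1)) \<le> green m r y"
  using arcsine_potential_outside[of r y m] by (simp add: green_def)

lemma green_nonneg:
  assumes "0 < r" shows "0 \<le> green m r y"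
proof (cases "\<bar>y - m\<bar> \<le> r")
  case False
  then have "0 \<le> ln 3 / pi * min pi (sqrt (\<bar>y - m\<bar> / r - 1))" using assms by (intro mult_nonneg_nonneg) auto
  also have "\<dots> \<le> green m r y" using False assms by (intro green_outside) auto
  finally show ?thesis .
qed (simp add: green_inside assms)

lemma green_pos:
  assumes "0 < r" "r < \<bar>y - m\<bar>" shows "0 < green m r y"
proof -
  have "1 < \<bar>y - m\<bar> / r" using assms by simp
  then have "0 < ln 3 / pi * min pi (sqrt (\<bar>y - m\<bar> / r - 1))" by (intro mult_pos_pos) auto
  also have "\<dots> \<le> green m r y" using assms by (intro green_outside) auto
  finally show ?thesis .
qed

section \<open>Equilibrium laws with square-root edges\<close>

definition soft_edge :: "(real \<Rightarrow> real) \<Rightarrow> real \<Rightarrow> real \<Rightarrow> bool" where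
  "soft_edge \<rho> c \<sigma> \<longleftrightarrow> (\<exists>\<kappa>>0. \<exists>\<delta>>0. \<forall>s\<in>{0..\<delta>}. \<kappa> * sqrt s \<le> \<rho> (c - \<sigma> * s))"

text \<open>In \<open>edges\<close> the sign is the outward direction at the endpoint, so c -
  \<sigma> s runs into the interval. \<open>V_second_difference\<close> is the quantitative
  smoothness of V that is played off against the square-root edges.\<close>

locale soft_edge_equilibrium = potential_and_density V C \<rho> a b for V C \<rho> a b +
  fixes l :: real
  assumes ab: "a < b"
    and msupp_law: "msupp law = {a..b}"
    and EL_le: "\<And>x. log_pot x \<le> V x / 2 + l"
    and EL_eq: "\<And>x. x \<in> {a..b} \<Longrightarrow> log_pot x = V x / 2 + l"
    and edges: "soft_edge \<rho> b 1" "soft_edge \<rho> a (-1)"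
    and V_second_difference: "\<And>c \<sigma>. \<exists>K \<delta>. 0 < \<delta> \<and> (\<forall>h. 0 < h \<and> h < \<delta> \<longrightarrow>
       \<bar>V (c + 2 * (\<sigma> * h)) - 2 * V (c + \<sigma> * h) + V c\<bar> \<le> K * h\<^sup>2)"
begin

definition slack :: "real \<Rightarrow> real" where
  "slack x = V x / 2 + l - log_pot x"

lemma slack_nonneg: "0 \<le> slack x"
  using EL_le[of x] by (simp add: slack_def)

lemma slack_zero: "x \<in> {a..b} \<Longrightarrow> slack x = 0"
  using EL_eq[of x] by (simp add: slack_def)

lemma slack_continuous: "continuous_on UNIV slack"
  unfolding slack_def using V_cont continuous_log_pot by (intro continuous_intros) auto

lemma AE_law_support: "AE y in law. y \<in> {a..b}"
  unfolding AE_law using \<rho>_zero by (intro AE_I2) force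

text \<open>By \<open>continuous_abs_ln\<close> the inner absolute integral is a continuous function
  of the angle. Joint integrability is what permits exchanging the two potentials in
  \<open>green_integral\<close>.\<close>

lemma ln_pair_integrable: "integrable (angle \<Otimes>\<^sub>M law) (\<lambda>(\<phi>, y). ln \<bar>m + r * cos \<phi> - y\<bar>)"
proof -
  interpret pair_sigma_finite angle law ..
  show ?thesis
  proof (rule Fubini_integrable)
    have "continuous_on UNIV (\<lambda>\<phi>. \<integral>y. \<bar>ln \<bar>(m + r * cos \<phi>) - y\<bar>\<bar> \<partial>law)"
      by (rule continuous_on_compose2[OF continuous_abs_ln]) (auto intro!: continuous_intros)
    then show "integrable angle (\<lambda>\<phi>. \<integral>y. norm (case (\<phi>, y) of (\<phi>, y) \<Rightarrow> ln \<bar>m + r * cos \<phi> - y\<bar>) \<partial>law)"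
      by (intro integrable_angle_continuous) simp
  qed (auto simp: integrable_law_ln)
qed

lemma green_integrable: "integrable law (green m r)"
  and green_integral: "(\<integral>y. green m r y \<partial>law) = (\<integral>\<phi>. log_pot (m + r * cos \<phi>) \<partial>angle) - ln (r / 2)"
proof -
  interpret pair_sigma_finite angle law ..
  have "integrable law (\<lambda>y. \<integral>\<phi>. ln \<bar>m + r * cos \<phi> - y\<bar> \<partial>angle)"
    using integrable_snd[OF ln_pair_integrable] by simp
  then show "integrable law (green m r)"
    unfolding green_def by auto
  have "(\<integral>y. \<integral>\<phi>. ln \<bar>m + r * cos \<phi> - y\<bar> \<partial>angle \<partial>law) = (\<integral>\<phi>. log_pot (m + r * cos \<phi>) \<partial>angle)"
    unfolding log_pot_def by (rule Fubini_integral[OF ln_pair_integrable])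
  then show "(\<integral>y. green m r y \<partial>law) = (\<integral>\<phi>. log_pot (m + r * cos \<phi>) \<partial>angle) - ln (r / 2)"
    unfolding green_def using \<open>integrable law (\<lambda>y. \<integral>\<phi>. ln \<bar>m + r * cos \<phi> - y\<bar> \<partial>angle)\<close>
    by (simp add: law.prob_space[simplified])
qed

lemma continuous_comp_circle:
  assumes "continuous_on UNIV f" shows "continuous_on UNIV (\<lambda>\<phi>. f (m + r * cos \<phi> :: real) :: real)"
  by (rule continuous_on_compose2[OF assms]) (auto intro!: continuous_intros)

definition excess :: "real \<Rightarrow> real \<Rightarrow> real" where
  "excess m r = interval_energy V m r / 2 + l + ln 2"

text \<open>Fubini exchanges the arcsine potential averaged over the equilibrium law with
  \<open>log_pot\<close> averaged over the arcsine law. This splits the functional into two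
  nonnegative terms: \<open>slack\<close> can be positive only where the trial interval leaves
  [a, b], \<open>green\<close> only where the support leaves the trial interval. The constants in
  \<open>excess\<close> make its minimum 0.\<close>

lemma excess_eq:
  assumes "0 < r"
  shows "excess m r = (\<integral>\<phi>. slack (m + r * cos \<phi>) \<partial>angle) + (\<integral>y. green m r y \<partial>law)"
proof -
  have "(\<integral>\<phi>. slack (m + r * cos \<phi>) \<partial>angle) =
      (\<integral>\<phi>. V (m + r * cos \<phi>) / 2 \<partial>angle) + l - (\<integral>\<phi>. log_pot (m + r * cos \<phi>) \<partial>angle)"
    unfolding slack_def
    using integrable_angle_continuous[OF continuous_comp_circle[OF V_cont, of m r]]
      integrable_angle_continuous[OF continuous_comp_circle[OF continuous_log_pot, of m r]]
    by (simp add: angle.prob_space[simplified])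
  then show ?thesis
    using assms by (simp add: excess_def interval_energy_def green_integral ln_div)
qed

lemma slack_integral_nonneg: "0 \<le> (\<integral>\<phi>. slack (m + r * cos \<phi>) \<partial>angle)"
  by (intro Bochner_Integration.integral_nonneg) (simp add: slack_nonneg)

lemma green_integral_nonneg: "0 < r \<Longrightarrow> 0 \<le> (\<integral>y. green m r y \<partial>law)"
  by (intro Bochner_Integration.integral_nonneg) (simp add: green_nonneg)

lemma excess_nonneg: "0 < r \<Longrightarrow> 0 \<le> excess m r"
  by (simp add: excess_eq slack_integral_nonneg green_integral_nonneg)

lemma excess_zero: "excess ((a + b) / 2) ((b - a) / 2) = 0"
proof -
  define m r where "m = (a + b) / 2" and "r = (b - a) / 2"
  have r: "0 < r" using ab by (simp add: r_def)
  have "slack (m + r * cos \<phi>) = 0" for \<phi>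
  proof (rule slack_zero)
    have "\<bar>r * cos \<phi>\<bar> \<le> r" using r abs_cos_le_one[of \<phi>] by (simp add: abs_mult mult_left_le)
    then show "m + r * cos \<phi> \<in> {a..b}" by (auto simp: m_def r_def abs_le_iff field_simps)
  qed
  moreover have "(\<integral>y. green m r y \<partial>law) = 0"
  proof (rule integral_eq_zero_AE)
    show "AE y in law. green m r y = 0"
      using AE_law_support by eventually_elim (use r in \<open>auto intro!: green_inside simp: m_def r_def abs_if field_simps\<close>)
  qed
  ultimately have "excess m r = 0" using excess_eq[OF r, of m] by simp
  then show ?thesis by (simp add: m_def r_def)
qed

lemma integral_window_ge:
  assumes "I = {c..d}" "c \<le> d" "\<And>y. y \<in> I \<Longrightarrow> k \<le> \<rho> y"
  shows "k * (d - c) \<le> measure law I"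
proof -
  have "ennreal (k * (d - c)) = (\<integral>\<^sup>+y. ennreal k * indicator I y \<partial>lborel)"
    using assms(1,2) by (simp add: nn_integral_cmult_indicator ennreal_mult'')
  also have "\<dots> \<le> (\<integral>\<^sup>+y. ennreal (\<rho> y) * indicator I y \<partial>lborel)"
    using assms(3) by (intro nn_integral_mono) (auto split: split_indicator intro!: ennreal_leI)
  also have "\<dots> = emeasure law I"
    unfolding law_def using assms(1) by (subst emeasure_density) auto
  also have "\<dots> = ennreal (measure law I)" by (rule law.emeasure_eq_measure)
  finally show ?thesis by (simp add: ennreal_le_iff)
qed

text \<open>Just outside a soft edge the logarithmic potential has second differences of order \<open>h\<^bsup>3/2\<^esup>\<close>,
  while those of \<open>V\<close> are of order \<open>h\<^sup>2\<close>: the two cannot agree up to a constant.\<close>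
lemma slack_not_zero_beyond_edge:
  assumes \<sigma>: "(\<sigma> = 1 \<and> c = b) \<or> (\<sigma> = -1 \<and> c = a)" and h0: "0 < h0"
    and zero: "\<And>h. 0 \<le> h \<Longrightarrow> h < h0 \<Longrightarrow> slack (c + \<sigma> * h) = 0"
  shows False
proof -
  obtain \<kappa> \<delta> where \<kappa>: "0 < \<kappa>" "0 < \<delta>" "\<And>s. 0 \<le> s \<Longrightarrow> s \<le> \<delta> \<Longrightarrow> \<kappa> * sqrt s \<le> \<rho> (c - \<sigma> * s)"
    using \<sigma> edges unfolding soft_edge_def by fastforce
  obtain K \<delta>' where K: "0 < \<delta>'" "\<And>h. 0 < h \<Longrightarrow> h < \<delta>' \<Longrightarrow>
       \<bar>V (c + 2 * (\<sigma> * h)) - 2 * V (c + \<sigma> * h) + V c\<bar> \<le> K * h\<^sup>2"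
    using V_second_difference[of c \<sigma>] by blast
  have s2: "\<sigma> * \<sigma> = 1" using \<sigma> by auto
  have *: "\<kappa> / 9 * sqrt h \<le> K / 2 * h" if h: "0 < h" "2 * h < h0" "h < \<delta>'" "2 * h \<le> \<delta>" for h
  proof -
    define G where "G y = ln \<bar>(c + 2 * (\<sigma> * h)) - y\<bar> - 2 * ln \<bar>(c + \<sigma> * h) - y\<bar> + ln \<bar>c - y\<bar>" for y
    \<comment> \<open>The window between \<open>lo\<close> and \<open>hi\<close> consists of the
      points at distance h to 2 h inside the edge. There the second difference \<open>G\<close> of
      the logarithm is at most -1/9, and the law has mass at least of order h^(3/2).\<close>
    define lo where "lo = min (c - \<sigma> * h) (c - \<sigma> * (2 * h))"
    define hi where "hi = max (c - \<sigma> * h) (c - \<sigma> * (2 * h))"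
    have hl: "hi - lo = h" "lo \<le> hi" using \<sigma> h by (auto simp: hi_def lo_def)
    define I where "I = {lo..hi}"
    have "integral\<^sup>L law G = log_pot (c + 2 * (\<sigma> * h)) - 2 * log_pot (c + \<sigma> * h) + log_pot c"
      unfolding G_def log_pot_def using integrable_law_ln by simp
    also have "\<dots> = (V (c + 2 * (\<sigma> * h)) - 2 * V (c + \<sigma> * h) + V c) / 2"
      using zero[of "2 * h"] zero[of h] zero[of 0] h by (simp add: slack_def field_simps)
    finally have "- (K * h\<^sup>2) / 2 \<le> integral\<^sup>L law G"
      using K(2)[of h] h by (simp add: abs_le_iff)
    also have "\<dots> \<le> (\<integral>y. - (1 / 9) * indicator I y \<partial>law)"
    proof (rule integral_mono_AE)
      show "integrable law G" unfolding G_def using integrable_law_ln by simp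
      show "AE y in law. G y \<le> - (1 / 9) * indicator I y"
        using AE_law_support AE_law_neq[of c]
      proof eventually_elim
        case (elim y)
        define s where "s = \<sigma> * (c - y)"
        have s: "0 < s" "y = c - \<sigma> * s" using elim \<sigma> by (auto simp: s_def)
        have e: "\<bar>(c + \<sigma> * t) - y\<bar> = s + t" if "0 \<le> t" for t using s \<sigma> that by auto
        have "G y = ln (s + 2 * h) - 2 * ln (s + h) + ln s"
          using e[of "2 * h"] e[of h] e[of 0] h unfolding G_def by (simp add: mult.left_commute)
        also have "\<dots> = ln ((s + 2 * h) * s / (s + h)\<^sup>2)"
          using s h by (simp add: ln_mult ln_div ln_realpow)
        \<comment> \<open>The three logarithms combine into ln (1 - u^2) with u = h / (s + h). Hence
          \<open>G\<close> is negative wherever the law lives, and on the window u is at least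
          1/3.\<close>
        also have id: "(s + 2 * h) * s / (s + h)\<^sup>2 = 1 - (h / (s + h))\<^sup>2"
        proof -
          have "(s + 2 * h) * s = (s + h)\<^sup>2 - h\<^sup>2" by (simp add: power2_eq_square algebra_simps)
          then show ?thesis using s h by (simp add: diff_divide_distrib power_divide)
        qed
        also have "ln (1 - (h / (s + h))\<^sup>2) \<le> - (h / (s + h))\<^sup>2"
        proof -
          have "0 < (s + 2 * h) * s / (s + h)\<^sup>2" using s h by auto
          also note id
          finally show ?thesis using ln_le_minus_one[of "1 - (h / (s + h))\<^sup>2"] by simp
        qed
        finally have G: "G y \<le> - (h / (s + h))\<^sup>2" .
        show ?case
        proof (cases "y \<in> I")
          case True
          then have "s \<le> 2 * h" using \<sigma> h by (auto simp: I_def lo_def hi_def s_def min_def max_def split: if_splits)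
          then have "1 / 3 \<le> h / (s + h)" using s h by (simp add: field_simps)
          then have "(1 / 3)\<^sup>2 \<le> (h / (s + h))\<^sup>2" by (intro power_mono) auto
          then show ?thesis using G True by (simp add: power2_eq_square)
        next
          case False
          then show ?thesis using G by (simp add: order_trans[OF G])
        qed
      qed
    qed (auto simp: I_def intro!: integrable_real_indicator simp: law.emeasure_eq_measure)
    also have "\<dots> = - (1 / 9) * measure law I"
      by (simp add: I_def)
    finally have 1: "measure law I / 9 \<le> K * h\<^sup>2 / 2" by simp
    have "\<kappa> * sqrt h * (hi - lo) \<le> measure law I"
    proof (rule integral_window_ge[OF I_def hl(2)])
      fix y assume "y \<in> I"
      define s where "s = \<sigma> * (c - y)"
      have s: "h \<le> s" "s \<le> 2 * h" "y = c - \<sigma> * s" using \<sigma> \<open>y \<in> I\<close> h by (auto simp: s_def I_def lo_def hi_def)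
      have "\<kappa> * sqrt h \<le> \<kappa> * sqrt s" using s \<kappa> by simp
      also have "\<dots> \<le> \<rho> y" unfolding s(3) using s h by (intro \<kappa>(3)) auto
      finally show "\<kappa> * sqrt h \<le> \<rho> y" .
    qed
    then have "h * (\<kappa> / 9 * sqrt h) \<le> h * (K / 2 * h)" using 1 hl by (simp add: power2_eq_square algebra_simps)
    then show ?thesis using h by simp
  qed
  define u where "u = min (min (h0 / 3) (\<delta>' / 2)) (\<delta> / 2)"
  have u: "0 < u" "2 * u < h0" "u < \<delta>'" "2 * u \<le> \<delta>" using h0 K \<kappa> by (auto simp: u_def min_def)
  \<comment> \<open>Dividing by sqrt h leaves a positive constant on the left and a right-hand side
    tending to 0.\<close>
  have "((\<lambda>h. K / 2 * sqrt h) \<longlongrightarrow> K / 2 * sqrt 0) (at_right 0)"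
    by (intro tendsto_intros)
  moreover have "eventually (\<lambda>h. \<kappa> / 9 \<le> K / 2 * sqrt h) (at_right 0)"
    using eventually_at_right_real[OF u(1)]
  proof eventually_elim
    case (elim h)
    then have "sqrt h * (\<kappa> / 9) \<le> sqrt h * (K / 2 * sqrt h)" using *[of h] u by (simp add: algebra_simps)
    then show ?case using elim by simp
  qed
  ultimately have "\<kappa> / 9 \<le> K / 2 * sqrt 0" by (intro tendsto_lowerbound) auto
  then show False using \<kappa> by simp
qed

text \<open>Both nonnegative terms of \<open>excess_eq\<close> vanish. For the Green part this puts
  the support inside the trial interval; for the slack part it extends the Euler--Lagrange equality
  over that whole interval, which \<open>slack_not_zero_beyond_edge\<close> forbids beyond either
  edge.\<close>

lemma excess_zero_unique:
  assumes r: "0 < r" and zero: "excess m r = 0"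
  shows "m - r = a" "m + r = b"
proof -
  have zs: "(\<integral>\<phi>. slack (m + r * cos \<phi>) \<partial>angle) = 0" and zg: "(\<integral>y. green m r y \<partial>law) = 0"
    using zero slack_integral_nonneg[of m r] green_integral_nonneg[OF r, of m] unfolding excess_eq[OF r] by linarith+
  have "AE y in law. green m r y = 0"
    using zg green_integrable green_nonneg[OF r] by (subst (asm) integral_nonneg_eq_0_iff_AE) auto
  then have ae: "AE y in law. \<bar>y - m\<bar> \<le> r"
    by eventually_elim (metis green_pos[OF r] less_irrefl not_le)
  have sub: "\<bar>x - m\<bar> \<le> r" if "x \<in> {a..b}" for x
  proof (rule ccontr)
    assume n: "\<not> \<bar>x - m\<bar> \<le> r"
    define e where "e = \<bar>x - m\<bar> - r"
    have e: "0 < e" using n by (simp add: e_def)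
    have "AE y in law. y \<notin> {x - e<..<x + e}"
      using ae by eventually_elim (auto simp: e_def abs_if split: if_splits)
    then have "emeasure law {x - e<..<x + e} = 0"
      by (subst (asm) AE_iff_measurable[of "{x - e<..<x + e}"]) auto
    moreover have "x \<in> msupp law" using that msupp_law by simp
    ultimately show False using e unfolding msupp_def by force
  qed
  have ma: "m - r \<le> a" and mb: "b \<le> m + r" using sub[of a] sub[of b] ab by auto
  have sl: "slack x = 0" if "\<bar>x - m\<bar> \<le> r" for x
  proof -
    define t where "t = (x - m) / r"
    have t: "\<bar>t\<bar> \<le> 1" "m + r * t = x" using that r by (auto simp: t_def)
    have "slack (m + r * cos (arccos t)) = 0"
      by (rule integral_angle_eq_0_D[OF continuous_comp_circle[OF slack_continuous] _ zs])
        (use t in \<open>auto simp: slack_nonneg arccos_lbound arccos_ubound abs_le_iff\<close>)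
    then show ?thesis using t by (simp add: cos_arccos_abs)
  qed
  show "m + r = b"
  proof (rule ccontr)
    assume "m + r \<noteq> b"
    then show False
      by (intro slack_not_zero_beyond_edge[of 1 b "m + r - b"]) (use ma mb ab in \<open>auto intro!: sl simp: abs_if\<close>)
  qed
  show "m - r = a"
  proof (rule ccontr)
    assume "m - r \<noteq> a"
    then show False
      by (intro slack_not_zero_beyond_edge[of "-1" a "a - (m - r)"]) (use ma mb ab in \<open>auto intro!: sl simp: abs_if\<close>)
  qed
qed

text \<open>Changing midpoint and radius by \<epsilon> moves only the endpoint c, inwards by 2
  \<epsilon>. At distance \<epsilon>/2 to \<epsilon> from c the law has mass at least of order
  \<epsilon>^(3/2), and the Green function of the shrunken interval is at least of order sqrt
  \<epsilon> there; the product is quadratic.\<close>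

lemma excess_quadratic:
  assumes \<sigma>: "(\<sigma> = 1 \<and> c = b) \<or> (\<sigma> = -1 \<and> c = a)"
  shows "\<exists>k>0. \<exists>\<epsilon>0>0. \<forall>\<epsilon>. 0 < \<epsilon> \<and> \<epsilon> < \<epsilon>0 \<longrightarrow>
    k * \<epsilon>\<^sup>2 \<le> excess ((a + b) / 2 - \<sigma> * \<epsilon>) ((b - a) / 2 - \<epsilon>)"
proof -
  define m0 r0 where "m0 = (a + b) / 2" and "r0 = (b - a) / 2"
  have r0: "0 < r0" using ab by (simp add: r0_def)
  have c: "c = m0 + \<sigma> * r0" using \<sigma> by (auto simp: m0_def r0_def field_simps)
  obtain \<kappa> \<delta> where \<kappa>: "0 < \<kappa>" "0 < \<delta>" "\<And>s. 0 \<le> s \<Longrightarrow> s \<le> \<delta> \<Longrightarrow> \<kappa> * sqrt s \<le> \<rho> (c - \<sigma> * s)"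
    using \<sigma> edges unfolding soft_edge_def by fastforce
  \<comment> \<open>The Green bound \<open>ln 3 / pi * sqrt (\<epsilon> / r0)\<close> times the mass
    bound \<open>\<kappa> * sqrt (\<epsilon> / 2) * (\<epsilon> / 2)\<close>, with
    \<open>\<epsilon>\<^sup>2\<close> taken out.\<close>
  define k where "k = ln 3 / pi * \<kappa> / (2 * sqrt (2 * r0))"
  have k: "0 < k" using \<kappa> r0 by (simp add: k_def)
  define \<epsilon>0 where "\<epsilon>0 = min r0 \<delta>"
  have "k * \<epsilon>\<^sup>2 \<le> excess (m0 - \<sigma> * \<epsilon>) (r0 - \<epsilon>)" if \<epsilon>: "0 < \<epsilon>" "\<epsilon> < \<epsilon>0" for \<epsilon>
  proof -
    define m r where "m = m0 - \<sigma> * \<epsilon>" and "r = r0 - \<epsilon>"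
    have r: "0 < r" "r \<le> r0" using \<epsilon> by (auto simp: r_def \<epsilon>0_def)
    define lo where "lo = min (c - \<sigma> * \<epsilon>) (c - \<sigma> * (\<epsilon> / 2))"
    define hi where "hi = max (c - \<sigma> * \<epsilon>) (c - \<sigma> * (\<epsilon> / 2))"
    define I where "I = {lo..hi}"
    have hl: "hi - lo = \<epsilon> / 2" "lo \<le> hi" using \<sigma> \<epsilon> by (auto simp: hi_def lo_def)
    have I: "\<exists>s. y = c - \<sigma> * s \<and> \<epsilon> / 2 \<le> s \<and> s \<le> \<epsilon>" if "y \<in> I" for y
      using that \<sigma> \<epsilon> by (intro exI[of _ "\<sigma> * (c - y)"]) (auto simp: I_def lo_def hi_def)
    have p: "pi \<ge> sqrt (\<epsilon> / r0)"
    proof -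
      have "\<epsilon> / r0 \<le> 1" using \<epsilon> r0 by (simp add: \<epsilon>0_def)
      then have "sqrt (\<epsilon> / r0) \<le> 1" by simp
      then show ?thesis using pi_gt3 by linarith
    qed
    have g: "ln 3 / pi * sqrt (\<epsilon> / r0) \<le> green m r y" if yI: "y \<in> I" for y
    proof -
      obtain s where s: "y = c - \<sigma> * s" "\<epsilon> / 2 \<le> s" "s \<le> \<epsilon>" using I[OF yI] by blast
      have d: "\<bar>y - m\<bar> = r + (2 * \<epsilon> - s)"
        unfolding s(1) m_def r_def c using \<sigma> s \<epsilon> r by (auto simp: \<epsilon>0_def)
      have "\<epsilon> / r0 \<le> (2 * \<epsilon> - s) / r" using r s \<epsilon> by (intro frac_le) auto
      also have "\<dots> = \<bar>y - m\<bar> / r - 1" unfolding d using r by (simp add: field_simps)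
      finally have "sqrt (\<epsilon> / r0) \<le> min pi (sqrt (\<bar>y - m\<bar> / r - 1))" using p by simp
      then have "ln 3 / pi * sqrt (\<epsilon> / r0) \<le> ln 3 / pi * min pi (sqrt (\<bar>y - m\<bar> / r - 1))"
        by (intro mult_left_mono) auto
      also have "\<dots> \<le> green m r y" using r s \<epsilon> d by (intro green_outside) auto
      finally show ?thesis .
    qed
    have "\<kappa> * sqrt (\<epsilon> / 2) * (hi - lo) \<le> measure law I"
    proof (rule integral_window_ge[OF I_def hl(2)])
      fix y assume "y \<in> I"
      then obtain s where s: "y = c - \<sigma> * s" "\<epsilon> / 2 \<le> s" "s \<le> \<epsilon>" using I by blast
      have "\<kappa> * sqrt (\<epsilon> / 2) \<le> \<kappa> * sqrt s" using s \<kappa> by simp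
      also have "\<dots> \<le> \<rho> y" unfolding s(1) using s \<epsilon> by (intro \<kappa>(3)) (auto simp: \<epsilon>0_def)
      finally show "\<kappa> * sqrt (\<epsilon> / 2) \<le> \<rho> y" .
    qed
    then have "ln 3 / pi * sqrt (\<epsilon> / r0) * (\<kappa> * sqrt (\<epsilon> / 2) * (\<epsilon> / 2)) \<le> ln 3 / pi * sqrt (\<epsilon> / r0) * measure law I"
      using \<epsilon> r0 hl by (intro mult_left_mono) auto
    moreover have "ln 3 / pi * sqrt (\<epsilon> / r0) * (\<kappa> * sqrt (\<epsilon> / 2) * (\<epsilon> / 2)) = k * \<epsilon>\<^sup>2"
    proof -
      have "sqrt (\<epsilon> / r0) * sqrt (\<epsilon> / 2) = \<epsilon> / sqrt (2 * r0)"
        using \<epsilon> r0 by (simp add: real_sqrt_divide real_sqrt_mult)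
      then have "ln 3 / pi * sqrt (\<epsilon> / r0) * (\<kappa> * sqrt (\<epsilon> / 2) * (\<epsilon> / 2)) = ln 3 / pi * \<kappa> * (\<epsilon> / sqrt (2 * r0)) * (\<epsilon> / 2)"
        by (metis (no_types, opaque_lifting) mult.assoc mult.left_commute)
      then show ?thesis by (simp add: k_def power2_eq_square)
    qed
    moreover have "ln 3 / pi * sqrt (\<epsilon> / r0) * measure law I = (\<integral>y. ln 3 / pi * sqrt (\<epsilon> / r0) * indicator I y \<partial>law)"
      by (simp add: I_def)
    moreover have "(\<integral>y. ln 3 / pi * sqrt (\<epsilon> / r0) * indicator I y \<partial>law) \<le> (\<integral>y. green m r y \<partial>law)"
    proof (rule integral_mono)
      show "ln 3 / pi * sqrt (\<epsilon> / r0) * indicator I y \<le> green m r y" for y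
        using g[of y] green_nonneg[OF r(1), of m y] by (auto split: split_indicator)
    qed (auto simp: green_integrable I_def intro!: integrable_real_indicator simp: law.emeasure_eq_measure)
    ultimately show ?thesis
      unfolding m_def[symmetric] r_def[symmetric] excess_eq[OF r(1)] using slack_integral_nonneg[of m r] by linarith
  qed
  moreover have "0 < \<epsilon>0" using r0 \<kappa> by (simp add: \<epsilon>0_def)
  ultimately show ?thesis using k unfolding m0_def r0_def by blast
qed

end

section \<open>Separately holomorphic functions of two variables\<close>

text \<open>Joint continuity is part of the notion so that a Cauchy integral in one variable depends
  continuously on the other; Osgood's argument then gives joint differentiability.\<close>

definition separately_holomorphic :: "(complex \<times> complex) set \<Rightarrow> (complex \<times> complex \<Rightarrow> complex) \<Rightarrow> bool" where
  "separately_holomorphic W f \<longleftrightarrow> open W \<and> continuous_on W f \<and>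
     (\<forall>(z, s)\<in>W. (\<lambda>w. f (w, s)) field_differentiable at z \<and> (\<lambda>w. f (z, w)) field_differentiable at s)"

definition deriv1 :: "(complex \<times> complex \<Rightarrow> complex) \<Rightarrow> complex \<times> complex \<Rightarrow> complex" where
  "deriv1 f p = deriv (\<lambda>w. f (w, snd p)) (fst p)"

definition deriv2 :: "(complex \<times> complex \<Rightarrow> complex) \<Rightarrow> complex \<times> complex \<Rightarrow> complex" where
  "deriv2 f p = deriv (\<lambda>w. f (fst p, w)) (snd p)"

lemma polydisc_in_open:
  fixes W :: "(complex \<times> complex) set"
  assumes "open W" "(z, s) \<in> W"
  obtains R where "0 < R" "cball z R \<times> cball s R \<subseteq> W"
proof -
  obtain A B where AB: "open A" "open B" "z \<in> A" "s \<in> B" "A \<times> B \<subseteq> W"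
    using open_prod_elim[OF assms] by (metis mem_Times_iff fst_conv snd_conv)
  obtain r1 where "0 < r1" "cball z r1 \<subseteq> A" using AB open_contains_cball by blast
  moreover obtain r2 where "0 < r2" "cball s r2 \<subseteq> B" using AB open_contains_cball by blast
  ultimately show ?thesis using AB
    by (intro that[of "min r1 r2"]) (auto simp: subset_iff)
qed

lemma separately_holomorphicD:
  assumes "separately_holomorphic W f" "(z, s) \<in> W"
  shows "(\<lambda>w. f (w, s)) field_differentiable at z" "(\<lambda>w. f (z, w)) field_differentiable at s"
  using assms unfolding separately_holomorphic_def by blast+

lemma separately_holomorphic_holomorphic1:
  assumes f: "separately_holomorphic W f" and "A \<times> {s} \<subseteq> W"
  shows "(\<lambda>w. f (w, s)) holomorphic_on A"
  unfolding holomorphic_on_def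
proof
  fix x assume "x \<in> A"
  then have "(x, s) \<in> W" using assms(2) by auto
  then show "(\<lambda>w. f (w, s)) field_differentiable (at x within A)"
    by (rule field_differentiable_at_within[OF separately_holomorphicD(1)[OF f]])
qed

text \<open>Cauchy's formula for the derivative, written over the parameter interval [0, 1] so that
  theorems on integrals depending on a parameter apply in both variables.\<close>

lemma deriv1_integral:
  assumes f: "separately_holomorphic W f" and sub: "cball z R \<times> cball s R \<subseteq> W"
    and w: "w \<in> ball z R" and u: "u \<in> cball s R"
  shows "deriv1 f (w, u) = integral {0..1} (\<lambda>x. f (circlepath z R x, u) / (circlepath z R x - w)\<^sup>2 * vector_derivative (circlepath z R) (at x)) / (2 * of_real pi * \<i>)"
proof -
  have R: "0 < R" using w by (metis ball_eq_empty empty_iff not_le)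
  have h: "(\<lambda>w. f (w, u)) holomorphic_on cball z R"
    by (rule separately_holomorphic_holomorphic1[OF f]) (use sub u in auto)
  have "((\<lambda>x. f (x, u) / (x - w)\<^sup>2) has_contour_integral 2 * of_real pi * \<i> * deriv (\<lambda>w. f (w, u)) w) (circlepath z R)"
    using Cauchy_has_contour_integral_higher_derivative_circlepath[of z R "\<lambda>w. f (w, u)" w 1]
      holomorphic_on_imp_continuous_on[OF h] holomorphic_on_subset[OF h ball_subset_cball] w
    by (simp add: power2_eq_square numeral_2_eq_2)
  then have "2 * of_real pi * \<i> * deriv (\<lambda>w. f (w, u)) w = contour_integral (circlepath z R) (\<lambda>x. f (x, u) / (x - w)\<^sup>2)"
    by (simp add: contour_integral_unique)
  then have "deriv (\<lambda>w. f (w, u)) w = contour_integral (circlepath z R) (\<lambda>x. f (x, u) / (x - w)\<^sup>2) / (2 * of_real pi * \<i>)"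
    by (subst eq_divide_eq) (simp add: mult_ac)
  then show ?thesis unfolding contour_integral_integral deriv1_def by simp
qed

text \<open>In Cauchy's formula the first argument of f stays on a fixed circle, so that continuity
  and holomorphy in the second argument pass under the integral. Continuity of
  \<open>deriv2 f\<close> is a premise of the second claim because it is obtained from the first
  claim by exchanging the arguments.\<close>

lemma deriv1_local:
  assumes f: "separately_holomorphic W f" and sub: "cball z R \<times> cball s R \<subseteq> W" and R: "0 < R"
  shows "continuous_on (ball z R \<times> ball s R) (deriv1 f)"
    and "continuous_on (W) (deriv2 f) \<Longrightarrow> (\<lambda>u. deriv1 f (z, u)) holomorphic_on ball s R"
proof -
  define g where "g = (\<lambda>p x. f (circlepath z R x, snd p) / (circlepath z R x - fst p)\<^sup>2 * vector_derivative (circlepath z R) (at x))"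
  have fc: "continuous_on W f" using f by (simp add: separately_holomorphic_def)
  have sph: "circlepath z R x \<in> sphere z R" if "x \<in> {0..1}" for x
  proof -
    have "circlepath z R x \<in> path_image (circlepath z R)" unfolding path_image_def using that by (rule imageI)
    then show ?thesis unfolding path_image_circlepath using R by simp
  qed
  have ne: "circlepath z R x \<noteq> w" if "w \<in> ball z R" "x \<in> {0..1}" for x w
    using sph[OF that(2)] that(1) by auto
  have in_W: "(circlepath z R x, u) \<in> W" if "u \<in> ball s R" "x \<in> {0..1}" for x u
    using sph[OF that(2)] that(1) sub by force
  have cpc: "continuous_on S (\<lambda>y. circlepath z R (c y))" if "continuous_on S c" for S :: "'b::topological_space set" and c
    unfolding circlepath by (intro continuous_intros that)
  have vd: "vector_derivative (circlepath z R) (at x) = 2 * pi * \<i> * R * exp (2 * of_real pi * \<i> * x)" for x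
    by (rule vector_derivative_circlepath)
  have gc: "continuous_on ((ball z R \<times> ball s R) \<times> cbox 0 1) (\<lambda>(p, x). g p x)"
    unfolding g_def split_def vd
    by (intro continuous_intros continuous_on_compose2[OF fc] cpc) (use in_W ne in auto)
  have eq: "deriv1 f p = integral (cbox 0 1) (g p) / (2 * of_real pi * \<i>)" if "p \<in> ball z R \<times> ball s R" for p
    using deriv1_integral[OF f sub, of "fst p" "snd p"] that by (auto simp: g_def)
  have "continuous_on (ball z R \<times> ball s R) (\<lambda>p. integral (cbox 0 1) (g p) / (2 * of_real pi * \<i>))"
    by (intro continuous_intros integral_continuous_on_param gc) auto
  then show "continuous_on (ball z R \<times> ball s R) (deriv1 f)"
    by (subst continuous_on_cong[OF refl eq])
  assume d2: "continuous_on W (deriv2 f)"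
  have zR: "z \<in> ball z R" using R by simp
  define g' where "g' = (\<lambda>u x. deriv2 f (circlepath z R x, u) / (circlepath z R x - z)\<^sup>2 * vector_derivative (circlepath z R) (at x))"
  have "(\<lambda>u. integral (cbox 0 1) (g (z, u))) holomorphic_on ball s R"
  proof (rule leibniz_rule_holomorphic[where fx = g'])
    show "continuous_on (ball s R \<times> cbox 0 1) (\<lambda>(u, x). g' u x)"
      unfolding g'_def split_def vd
      by (intro continuous_intros continuous_on_compose2[OF d2] cpc) (use in_W ne[OF zR] in auto)
    show "g (z, u) integrable_on cbox 0 1" if "u \<in> ball s R" for u
    proof (rule integrable_continuous)
      have "continuous_on ((\<lambda>x. ((z, u), x)) ` cbox 0 1) (\<lambda>(p, x). g p x)"
        by (rule continuous_on_subset[OF gc]) (use that R in auto)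
      then have "continuous_on (cbox 0 1) ((\<lambda>(p, x). g p x) \<circ> (\<lambda>x. ((z, u), x)))"
        by (intro continuous_on_compose continuous_intros)
      then show "continuous_on (cbox 0 1) (g (z, u))" by (simp add: comp_def)
    qed
    fix u :: complex and x :: real assume u: "u \<in> ball s R" "x \<in> cbox 0 1"
    define k where "k = vector_derivative (circlepath z R) (at x) / (circlepath z R x - z)\<^sup>2"
    have "x \<in> {0..1}" using u(2) by simp
    then have "((\<lambda>u. f (circlepath z R x, u)) has_field_derivative deriv2 f (circlepath z R x, u)) (at u)"
      unfolding deriv2_def fst_conv snd_conv
      by (intro field_differentiable_derivI separately_holomorphicD(2)[OF f in_W[OF u(1)]])
    then have "((\<lambda>u. f (circlepath z R x, u) * k) has_field_derivative deriv2 f (circlepath z R x, u) * k) (at u)"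
      by (rule DERIV_cmult_right)
    moreover have "(\<lambda>u. g (z, u) x) = (\<lambda>u. f (circlepath z R x, u) * k)"
      by (simp add: g_def k_def)
    moreover have "g' u x = deriv2 f (circlepath z R x, u) * k"
      by (simp add: g'_def k_def)
    ultimately show "((\<lambda>u. g (z, u) x) has_field_derivative g' u x) (at u within ball s R)"
      by (simp add: has_field_derivative_at_within)
  qed auto
  then have "(\<lambda>u. integral (cbox 0 1) (g (z, u)) / (2 * of_real pi * \<i>)) holomorphic_on ball s R"
    by (intro holomorphic_intros) auto
  then show "(\<lambda>u. deriv1 f (z, u)) holomorphic_on ball s R"
    by (rule holomorphic_transform) (use eq R in auto)
qed

lemma continuous_deriv1:
  assumes f: "separately_holomorphic W f"
  shows "continuous_on W (deriv1 f)"
proof (rule continuous_at_imp_continuous_on, rule ballI)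
  have o: "open W" using f by (simp add: separately_holomorphic_def)
  fix p assume "p \<in> W"
  moreover obtain z s where p: "p = (z, s)" by (cases p)
  ultimately have "(z, s) \<in> W" by simp
  then obtain R where R: "0 < R" "cball z R \<times> cball s R \<subseteq> W"
    by (rule polydisc_in_open[OF o])
  have "continuous_on (ball z R \<times> ball s R) (deriv1 f)" by (rule deriv1_local(1)[OF f R(2,1)])
  moreover have "open (ball z R \<times> ball s R)" by (intro open_Times open_ball)
  moreover have "p \<in> ball z R \<times> ball s R" using R p by simp
  ultimately show "isCont (deriv1 f) p" by (simp only: continuous_on_eq_continuous_at)
qed

definition swap_args :: "(complex \<times> complex \<Rightarrow> complex) \<Rightarrow> complex \<times> complex \<Rightarrow> complex" where
  "swap_args f p = f (snd p, fst p)"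

lemma separately_holomorphic_swap:
  assumes f: "separately_holomorphic W f"
  shows "separately_holomorphic {p. (snd p, fst p) \<in> W} (swap_args f)"
proof -
  have o: "open W" and c: "continuous_on W f" using f by (auto simp: separately_holomorphic_def)
  have "open ((\<lambda>p. (snd p, fst p)) -` W)"
    by (rule open_vimage[OF o]) (intro continuous_intros)
  moreover have "continuous_on {p. (snd p, fst p) \<in> W} (\<lambda>p. f (snd p, fst p))"
    by (rule continuous_on_compose2[OF c]) (auto intro!: continuous_intros)
  moreover have "(\<lambda>w. f (s, w)) field_differentiable at z" "(\<lambda>w. f (w, z)) field_differentiable at s"
    if "(s, z) \<in> W" for z s
    using separately_holomorphicD[OF f that] by auto
  ultimately show ?thesis
    unfolding separately_holomorphic_def swap_args_def by (simp add: vimage_def split_beta)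
qed

lemma continuous_deriv2:
  assumes f: "separately_holomorphic W f"
  shows "continuous_on W (deriv2 f)"
proof -
  have c: "continuous_on {p. (snd p, fst p) \<in> W} (deriv1 (swap_args f))"
    by (rule continuous_deriv1[OF separately_holomorphic_swap[OF f]])
  have "continuous_on W (\<lambda>p. deriv1 (swap_args f) (snd p, fst p))"
    by (rule continuous_on_compose2[OF c]) (auto intro!: continuous_intros)
  then show ?thesis by (simp add: deriv1_def deriv2_def swap_args_def)
qed

text \<open>Closes the class under differentiation in the first variable, so that a potential and
  its first and second derivatives fall under the same lemmas.\<close>

lemma separately_holomorphic_deriv1:
  assumes f: "separately_holomorphic W f"
  shows "separately_holomorphic W (deriv1 f)"
proof -
  have o: "open W" using f by (simp add: separately_holomorphic_def)
  have "(\<lambda>w. deriv1 f (w, s)) field_differentiable at z \<and> (\<lambda>w. deriv1 f (z, w)) field_differentiable at s"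
    if zs: "(z, s) \<in> W" for z s
  proof -
    obtain R where R: "0 < R" "cball z R \<times> cball s R \<subseteq> W"
      by (rule polydisc_in_open[OF o zs])
    have "(\<lambda>u. deriv1 f (z, u)) holomorphic_on ball s R"
      by (rule deriv1_local(2)[OF f R(2,1) continuous_deriv2[OF f]])
    then have "(\<lambda>u. deriv1 f (z, u)) field_differentiable at s"
      by (rule holomorphic_on_imp_differentiable_at) (use R(1) in auto)
    moreover have "(\<lambda>w. f (w, s)) holomorphic_on ball z R"
      by (rule separately_holomorphic_holomorphic1[OF f]) (use R in auto)
    then have "deriv (\<lambda>w. f (w, s)) holomorphic_on ball z R"
      by (rule holomorphic_deriv) (rule open_ball)
    then have "deriv (\<lambda>w. f (w, s)) field_differentiable at z"
      by (rule holomorphic_on_imp_differentiable_at) (use R(1) in auto)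
    moreover have "(\<lambda>w. deriv1 f (w, s)) = deriv (\<lambda>w. f (w, s))"
      by (simp add: deriv1_def fun_eq_iff)
    ultimately show ?thesis by simp
  qed
  then show ?thesis using o continuous_deriv1[OF f] unfolding separately_holomorphic_def by blast
qed

lemma separately_holomorphic_has_derivative:
  assumes f: "separately_holomorphic W f" and p: "p \<in> W"
  shows "(f has_derivative (\<lambda>(h, k). deriv1 f p * h + deriv2 f p * k)) (at p)"
proof -
  have o: "open W" using f by (simp add: separately_holomorphic_def)
  obtain z s where zs: "p = (z, s)" by (cases p)
  have "(z, s) \<in> W" using p zs by simp
  then obtain R where R: "0 < R" "cball z R \<times> cball s R \<subseteq> W"
    by (rule polydisc_in_open[OF o])
  have in_W: "(w, u) \<in> W" if "w \<in> ball z R" "u \<in> ball s R" for w u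
    using R that by auto
  have dd: "((\<lambda>w. f (w, u)) has_field_derivative deriv1 f (w, u)) (at w)"
    "((\<lambda>u. f (w, u)) has_field_derivative deriv2 f (w, u)) (at u)" if "(w, u) \<in> W" for w u
    using f that by (auto simp: deriv1_def deriv2_def separately_holomorphic_def field_differentiable_derivI)
  have "((\<lambda>(w, u). f (w, u)) has_derivative
     (\<lambda>(h, k). deriv1 f (z, s) * h + blinfun_apply (blinfun_mult_right (deriv2 f (z, s))) k)) (at (z, s) within ball z R \<times> ball s R)"
  proof (rule has_derivative_partialsI)
    show "((\<lambda>w. f (w, s)) has_derivative (*) (deriv1 f (z, s))) (at z within ball z R)"
      using dd(1)[OF in_W[of z s]] R by (auto simp: has_field_derivative_def intro: has_derivative_at_withinI)
    show "((\<lambda>u. f (w, u)) has_derivative blinfun_apply (blinfun_mult_right (deriv2 f (w, u)))) (at u within ball s R)"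
      if "w \<in> ball z R" "u \<in> ball s R" for w u
      using dd(2)[OF in_W[OF that]] by (auto simp: has_field_derivative_def intro: has_derivative_at_withinI)
    have "continuous_on (ball z R \<times> ball s R) (deriv2 f)"
      by (rule continuous_on_subset[OF continuous_deriv2[OF f]]) (use in_W in auto)
    then have "continuous_on (ball z R \<times> ball s R) (\<lambda>p. blinfun_mult_right (deriv2 f p))"
      by (rule bounded_linear.continuous_on[OF bounded_linear_blinfun_mult_right])
    then have "continuous (at (z, s) within ball z R \<times> ball s R) (\<lambda>p. blinfun_mult_right (deriv2 f p))"
      unfolding continuous_on_eq_continuous_within using R(1) by (auto dest: bspec[of _ _ "(z, s)"])
    moreover have "(\<lambda>p. blinfun_mult_right (deriv2 f p)) = (\<lambda>(w, u). blinfun_mult_right (deriv2 f (w, u)))"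
      by (simp add: fun_eq_iff)
    ultimately show "continuous (at (z, s) within ball z R \<times> ball s R) (\<lambda>(w, u). blinfun_mult_right (deriv2 f (w, u)))"
      by simp
  qed (use R in auto)
  moreover have "at (z, s) within ball z R \<times> ball s R = at (z, s)"
    using R by (intro at_within_open) (auto intro: open_Times)
  ultimately show ?thesis by (simp add: zs)
qed

section \<open>The implicit function theorem for the endpoint equations\<close>

type_synonym complex3 = "complex \<times> complex \<times> complex"

lemma bounded_linear_coordinates [simp]:
  "bounded_linear (\<lambda>h::complex3. fst h)" "bounded_linear (\<lambda>h::complex3. fst (snd h))"
  "bounded_linear (\<lambda>h::complex3. snd (snd h))"
  by (intro bounded_linear_fst bounded_linear_compose[OF bounded_linear_fst bounded_linear_snd]
      bounded_linear_compose[OF bounded_linear_snd bounded_linear_snd])+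

text \<open>A row of a Jacobian as a bounded linear map. Assembling \<open>lin3\<close> and
  \<open>pack3\<close> from coordinate maps carries continuity of the entries over to the operator
  norm, as the inverse function theorem asks.\<close>

definition lin3 :: "complex3 \<Rightarrow> complex3 \<Rightarrow>\<^sub>L complex" where
  "lin3 v = (blinfun_mult_right (fst v) o\<^sub>L Blinfun (\<lambda>h. fst h)) +
    (blinfun_mult_right (fst (snd v)) o\<^sub>L Blinfun (\<lambda>h. fst (snd h))) +
    (blinfun_mult_right (snd (snd v)) o\<^sub>L Blinfun (\<lambda>h. snd (snd h)))"

lemma lin3_apply [simp]:
  "blinfun_apply (lin3 v) h = fst v * fst h + fst (snd v) * fst (snd h) + snd (snd v) * snd (snd h)"
  by (simp add: lin3_def blinfun.add_left bounded_linear_Blinfun_apply)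

lemma bounded_linear_lin3: "bounded_linear lin3"
proof -
  have *: "bounded_linear (\<lambda>v::complex3. blinfun_mult_right (g v) o\<^sub>L B)" if g: "bounded_linear g"
    for g :: "complex3 \<Rightarrow> complex" and B :: "complex3 \<Rightarrow>\<^sub>L complex"
    by (rule bounded_linear_compose[OF bounded_bilinear.bounded_linear_left[OF bounded_bilinear_blinfun_compose]
          bounded_linear_compose[OF bounded_linear_blinfun_mult_right g]])
  show ?thesis unfolding lin3_def
    by (rule bounded_linear_add[OF bounded_linear_add]) (rule *, rule bounded_linear_coordinates)+
qed

definition pack3 :: "(complex3 \<Rightarrow>\<^sub>L complex) \<Rightarrow> (complex3 \<Rightarrow>\<^sub>L complex) \<Rightarrow> (complex3 \<Rightarrow>\<^sub>L complex) \<Rightarrow> complex3 \<Rightarrow>\<^sub>L complex3" where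
  "pack3 A B C = (Blinfun (\<lambda>w. (w, 0, 0)) o\<^sub>L A) + (Blinfun (\<lambda>w. (0, w, 0)) o\<^sub>L B) + (Blinfun (\<lambda>w. (0, 0, w)) o\<^sub>L C)"

lemma pack3_apply [simp]: "blinfun_apply (pack3 A B C) h = (blinfun_apply A h, blinfun_apply B h, blinfun_apply C h)"
proof -
  have "bounded_linear (\<lambda>w::complex. (w, 0::complex, 0::complex))" "bounded_linear (\<lambda>w::complex. (0::complex, w, 0::complex))"
    "bounded_linear (\<lambda>w::complex. (0::complex, 0::complex, w))"
    by (intro bounded_linear_Pair bounded_linear_zero bounded_linear_ident)+
  then show ?thesis by (simp add: pack3_def blinfun.add_left bounded_linear_Blinfun_apply)
qed

lemma continuous_on_pack3:
  assumes "continuous_on S A" "continuous_on S B" "continuous_on S C"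
  shows "continuous_on S (\<lambda>x. pack3 (A x) (B x) (C x))"
proof -
  have *: "continuous_on S (\<lambda>x. E o\<^sub>L A x)" if "continuous_on S A"
    for A :: "'a \<Rightarrow> complex3 \<Rightarrow>\<^sub>L complex" and E :: "complex \<Rightarrow>\<^sub>L complex3"
    by (rule bounded_bilinear.continuous_on[OF bounded_bilinear_blinfun_compose continuous_on_const that])
  show ?thesis unfolding pack3_def
    by (rule continuous_on_add[OF continuous_on_add]) (rule *, rule assms)+
qed

section \<open>Circle averages with complex midpoint, radius and parameter\<close>

definition circle_point :: "complex3 \<Rightarrow> real \<Rightarrow> complex \<times> complex" where
  "circle_point x \<phi> = (fst x + fst (snd x) * of_real (cos \<phi>), snd (snd x))"

text \<open>The weights 1, cos and cos^2 give the entries of the gradient and the Hessian of the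
  interval energy, up to a factor pi and the contribution of ln r.\<close>

definition circle_integral :: "(complex \<times> complex \<Rightarrow> complex) \<Rightarrow> (real \<Rightarrow> complex) \<Rightarrow> complex3 \<Rightarrow> complex" where
  "circle_integral f c x = integral {0..pi} (\<lambda>\<phi>. c \<phi> * f (circle_point x \<phi>))"

lemma continuous_circle_integrand:
  fixes f :: "complex \<times> complex \<Rightarrow> complex" and c :: "real \<Rightarrow> complex"
  assumes f: "continuous_on W f" and c: "continuous_on UNIV c"
    and sub: "\<And>x \<phi>. x \<in> N \<Longrightarrow> \<phi> \<in> {0..pi} \<Longrightarrow> circle_point x \<phi> \<in> W"
  shows "continuous_on (N \<times> cbox 0 pi) (\<lambda>(x, \<phi>). c \<phi> * f (circle_point x \<phi>))"
proof -
  have A: "continuous_on (N \<times> cbox 0 pi) (\<lambda>p. f (circle_point (fst p) (snd p)))"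
    by (rule continuous_on_compose2[OF f]) (use sub in \<open>auto simp: circle_point_def intro!: continuous_intros\<close>)
  have B: "continuous_on (N \<times> cbox 0 pi) (\<lambda>p. c (snd p))"
    by (rule continuous_on_compose2[OF c]) (auto intro!: continuous_intros)
  show ?thesis unfolding split_beta by (rule continuous_on_mult[OF B A])
qed

lemma continuous_circle_integral:
  assumes "continuous_on W f" "continuous_on UNIV c"
    and "\<And>x \<phi>. x \<in> N \<Longrightarrow> \<phi> \<in> {0..pi} \<Longrightarrow> circle_point x \<phi> \<in> W"
  shows "continuous_on N (circle_integral f c)"
  using integral_continuous_on_param[OF continuous_circle_integrand[OF assms]]
  unfolding circle_integral_def by simp

lemma circle_integral_has_derivative:
  assumes f: "separately_holomorphic W f" and c: "continuous_on UNIV c"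
    and N: "open N" "convex N" "x \<in> N"
    and sub: "\<And>x \<phi>. x \<in> N \<Longrightarrow> \<phi> \<in> {0..pi} \<Longrightarrow> circle_point x \<phi> \<in> W"
  shows "(circle_integral f c has_derivative blinfun_apply (lin3 (circle_integral (deriv1 f) c x,
    circle_integral (deriv1 f) (\<lambda>\<phi>. c \<phi> * of_real (cos \<phi>)) x, circle_integral (deriv2 f) c x))) (at x)"
proof -
  have cc: "continuous_on UNIV (\<lambda>\<phi>. c \<phi> * of_real (cos \<phi>))" using c by (intro continuous_intros)
  have f0: "continuous_on W f" using f by (simp add: separately_holomorphic_def)
  note f1 = continuous_deriv1[OF f] and f2 = continuous_deriv2[OF f]
  \<comment> \<open>One vector-valued integrand for the whole row, so that differentiating once
    under the integral yields all three entries.\<close>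
  define k where "k x \<phi> = (c \<phi> * deriv1 f (circle_point x \<phi>), (c \<phi> * of_real (cos \<phi>)) * deriv1 f (circle_point x \<phi>),
     c \<phi> * deriv2 f (circle_point x \<phi>))" for x \<phi>
  have kc: "continuous_on (N \<times> cbox 0 pi) (\<lambda>(x, \<phi>). k x \<phi>)"
    using continuous_circle_integrand[OF f1 c sub] continuous_circle_integrand[OF f1 cc sub] continuous_circle_integrand[OF f2 c sub]
    unfolding k_def split_beta by (intro continuous_on_Pair)
  have slice: "h x integrable_on cbox 0 pi" if h: "continuous_on (N \<times> cbox 0 pi) (\<lambda>(x, \<phi>). h x \<phi>)" and x: "x \<in> N"
    for h :: "complex3 \<Rightarrow> real \<Rightarrow> 'b::banach" and x
  proof (rule integrable_continuous)
    have "continuous_on ((\<lambda>\<phi>. (x, \<phi>)) ` cbox 0 pi) (\<lambda>(x, \<phi>). h x \<phi>)"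
      by (rule continuous_on_subset[OF h]) (use x in auto)
    then have "continuous_on (cbox 0 pi) ((\<lambda>(x, \<phi>). h x \<phi>) \<circ> (\<lambda>\<phi>. (x, \<phi>)))"
      by (intro continuous_on_compose continuous_intros)
    then show "continuous_on (cbox 0 pi) (h x)" by (simp add: comp_def)
  qed
  have D: "((\<lambda>x. integral (cbox 0 pi) (\<lambda>\<phi>. c \<phi> * f (circle_point x \<phi>))) has_derivative
      blinfun_apply (integral (cbox 0 pi) (\<lambda>\<phi>. lin3 (k x \<phi>)))) (at x within N)"
  proof (rule leibniz_rule[where fx = "\<lambda>x \<phi>. lin3 (k x \<phi>)"])
    show "continuous_on (N \<times> cbox 0 pi) (\<lambda>(x, \<phi>). lin3 (k x \<phi>))"
      using bounded_linear.continuous_on[OF bounded_linear_lin3 kc] by (simp add: split_beta)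
    show "(\<lambda>\<phi>. c \<phi> * f (circle_point y \<phi>)) integrable_on cbox 0 pi" if "y \<in> N" for y
      by (rule slice[OF continuous_circle_integrand[OF f0 c sub] that])
    fix y \<phi> assume y: "y \<in> N" "\<phi> \<in> cbox 0 pi"
    have "circle_point y \<phi> \<in> W" using sub[OF y(1)] y(2) by simp
    from separately_holomorphic_has_derivative[OF f this]
    have d: "(f has_derivative (\<lambda>(h, k). deriv1 f (circle_point y \<phi>) * h + deriv2 f (circle_point y \<phi>) * k)) (at (circle_point y \<phi>))" .
    have "((\<lambda>y. circle_point y \<phi>) has_derivative (\<lambda>h. circle_point h \<phi>)) (at y within N)"
    proof (rule bounded_linear_imp_has_derivative)
      show "bounded_linear (\<lambda>h. circle_point h \<phi>)" unfolding circle_point_def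
        by (rule bounded_linear_Pair[OF bounded_linear_add[OF bounded_linear_coordinates(1)
            bounded_linear_compose[OF bounded_linear_mult_left bounded_linear_coordinates(2)]] bounded_linear_coordinates(3)])
    qed
    from has_derivative_compose[OF this d]
    have "((\<lambda>y. c \<phi> * f (circle_point y \<phi>)) has_derivative (\<lambda>h. c \<phi> * (\<lambda>(h, k). deriv1 f (circle_point y \<phi>) * h + deriv2 f (circle_point y \<phi>) * k) (circle_point h \<phi>))) (at y within N)"
      by (rule has_derivative_mult_right)
    moreover have "(\<lambda>h. c \<phi> * (\<lambda>(h, k). deriv1 f (circle_point y \<phi>) * h + deriv2 f (circle_point y \<phi>) * k) (circle_point h \<phi>)) =
      blinfun_apply (lin3 (k y \<phi>))"
      by (rule ext) (simp add: k_def circle_point_def algebra_simps)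
    ultimately show "((\<lambda>y. c \<phi> * f (circle_point y \<phi>)) has_derivative blinfun_apply (lin3 (k y \<phi>))) (at y within N)"
      by simp
  qed (use N in auto)
  have ki: "k x integrable_on cbox 0 pi" by (rule slice[OF kc N(3)])
  have I1: "integral (cbox 0 pi) (\<lambda>\<phi>. lin3 (k x \<phi>)) = lin3 (integral (cbox 0 pi) (k x))"
    using integral_linear[OF ki bounded_linear_lin3] by (simp only: comp_def)
  have I2: "integral (cbox 0 pi) (k x) = (circle_integral (deriv1 f) c x,
    circle_integral (deriv1 f) (\<lambda>\<phi>. c \<phi> * of_real (cos \<phi>)) x, circle_integral (deriv2 f) c x)"
  proof -
    define I where "I = integral (cbox 0 pi) (k x)"
    have "fst I = integral (cbox 0 pi) (\<lambda>\<phi>. fst (k x \<phi>))" "fst (snd I) = integral (cbox 0 pi) (\<lambda>\<phi>. fst (snd (k x \<phi>)))"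
      "snd (snd I) = integral (cbox 0 pi) (\<lambda>\<phi>. snd (snd (k x \<phi>)))"
      unfolding I_def using integral_linear[OF ki bounded_linear_coordinates(1)] integral_linear[OF ki bounded_linear_coordinates(2)]
        integral_linear[OF ki bounded_linear_coordinates(3)] by (simp_all only: comp_def)
    then have "I = (circle_integral (deriv1 f) c x,
      circle_integral (deriv1 f) (\<lambda>\<phi>. c \<phi> * of_real (cos \<phi>)) x, circle_integral (deriv2 f) c x)"
      by (intro prod_eqI) (simp_all add: k_def circle_integral_def)
    then show ?thesis unfolding I_def .
  qed
  have cb: "cbox 0 pi = {0..pi}" by simp
  show ?thesis
    using D unfolding I1 I2 at_within_open[OF N(3,1)] unfolding cb circle_integral_def[abs_def] .
qed

lemma norm_components_le: "norm (fst p) \<le> norm p" "norm (snd p) \<le> norm p"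
  by (metis norm_fst_le prod.collapse, metis norm_snd_le prod.collapse)

text \<open>Compactness of the arc leaves a margin e around it inside W. Each of the three
  coordinates may use a third of it, since the cosine has modulus at most 1.\<close>

lemma circle_tube:
  fixes x0 :: complex3
  assumes "open W" "\<And>\<phi>. \<phi> \<in> {0..pi} \<Longrightarrow> circle_point x0 \<phi> \<in> W"
  obtains d where "0 < d" "\<And>x \<phi>. x \<in> ball x0 d \<Longrightarrow> \<phi> \<in> {0..pi} \<Longrightarrow> circle_point x \<phi> \<in> W"
proof -
  define K where "K = circle_point x0 ` {0..pi}"
  have cK: "compact K" unfolding K_def circle_point_def by (intro compact_continuous_image continuous_intros) auto
  moreover have "K \<subseteq> W" using assms(2) by (auto simp: K_def)
  ultimately obtain e where e: "0 < e" "(\<Union>p\<in>K. ball p e) \<subseteq> W"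
    by (rule compact_subset_open_imp_ball_epsilon_subset[OF _ assms(1)])
  have "circle_point x \<phi> \<in> W" if x: "x \<in> ball x0 (e / 3)" and \<phi>: "\<phi> \<in> {0..pi}" for x \<phi>
  proof -
    define m r s where "m = fst x - fst x0" and "r = fst (snd x) - fst (snd x0)" and "s = snd (snd x) - snd (snd x0)"
    have nx: "norm (x - x0) < e / 3" using x by (simp add: dist_norm norm_minus_commute)
    have "norm m \<le> norm (x - x0)" using norm_components_le(1)[of "x - x0"] by (simp add: m_def)
    moreover have "norm (snd (x - x0)) \<le> norm (x - x0)" by (rule norm_components_le)
    moreover have "norm r \<le> norm (snd (x - x0))" "norm s \<le> norm (snd (x - x0))"
      using norm_components_le[of "snd (x - x0)"] by (simp_all add: r_def s_def)
    ultimately have mrs: "norm m < e / 3" "norm r < e / 3" "norm s < e / 3" using nx by linarith+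
    have "circle_point x \<phi> - circle_point x0 \<phi> = (m + r * of_real (cos \<phi>), s)"
      by (simp add: circle_point_def m_def r_def s_def algebra_simps)
    then have "norm (circle_point x \<phi> - circle_point x0 \<phi>) \<le> norm (m + r * of_real (cos \<phi>)) + norm s"
      by (simp add: norm_Pair sqrt_sum_squares_le_sum)
    also have "norm (m + r * of_real (cos \<phi>)) \<le> norm m + norm (r * of_real (cos \<phi>))" by (rule norm_triangle_ineq)
    also have "norm (r * of_real (cos \<phi>)) \<le> norm r" by (simp add: norm_mult mult_left_le)
    finally have "norm (circle_point x \<phi> - circle_point x0 \<phi>) < e" using mrs by linarith
    then have "circle_point x \<phi> \<in> ball (circle_point x0 \<phi>) e" by (simp add: dist_norm norm_minus_commute)
    then have "circle_point x \<phi> \<in> (\<Union>p\<in>K. ball p e)" using \<phi> unfolding K_def by blast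
    then show ?thesis using e(2) by blast
  qed
  then show ?thesis using e by (intro that[of "e / 3"]) auto
qed

text \<open>In the application f is the derivative of the potential in its first variable: the two
  equations say that the gradient of the interval energy vanishes, and \<open>nondeg\<close> that
  its Hessian is invertible. The conclusion covers every solution near x0, not just one; this is how
  the real minimisers are recognised on the holomorphic branch.\<close>

lemma endpoint_equations_solution:
  fixes m0 r0 t0 :: complex and f :: "complex \<times> complex \<Rightarrow> complex"
  defines "x0 \<equiv> (m0, r0, t0)"
  defines "A \<equiv> circle_integral (deriv1 f) (\<lambda>_. 1) x0"
    and "B \<equiv> circle_integral (deriv1 f) (\<lambda>\<phi>. of_real (cos \<phi>)) x0"
    and "D \<equiv> circle_integral (deriv1 f) (\<lambda>\<phi>. of_real (cos \<phi>) * of_real (cos \<phi>)) x0"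
  assumes f: "separately_holomorphic W f" and r0: "r0 \<noteq> 0"
    and in_W: "\<And>\<phi>. \<phi> \<in> {0..pi} \<Longrightarrow> circle_point x0 \<phi> \<in> W"
    and eq1: "circle_integral f (\<lambda>_. 1) x0 = 0"
    and eq2: "circle_integral f (\<lambda>\<phi>. of_real (cos \<phi>)) x0 = 2 * of_real pi / r0"
    and nondeg: "A * (D + 2 * of_real pi / r0\<^sup>2) \<noteq> B\<^sup>2"
  shows "\<exists>T mf rf U. open T \<and> t0 \<in> T \<and> mf holomorphic_on T \<and> rf holomorphic_on T \<and> open U \<and> x0 \<in> U \<and>
     (\<forall>m r s. (m, r, s) \<in> U \<longrightarrow> circle_integral f (\<lambda>_. 1) (m, r, s) = 0 \<longrightarrow>
        circle_integral f (\<lambda>\<phi>. of_real (cos \<phi>)) (m, r, s) = 2 * of_real pi / r \<longrightarrow> s \<in> T \<and> mf s = m \<and> rf s = r)"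
proof -
  define c0 :: "real \<Rightarrow> complex" where "c0 = (\<lambda>_. 1)"
  define c1 :: "real \<Rightarrow> complex" where "c1 = (\<lambda>\<phi>. of_real (cos \<phi>))"
  have c: "continuous_on UNIV c0" "continuous_on UNIV c1" unfolding c0_def c1_def by (intro continuous_intros)+
  define c2 :: "real \<Rightarrow> complex" where "c2 = (\<lambda>\<phi>. c1 \<phi> * of_real (cos \<phi>))"
  have c': "continuous_on UNIV c2" unfolding c2_def by (intro continuous_intros c)
  have c01: "(\<lambda>\<phi>. c0 \<phi> * of_real (cos \<phi>)) = c1" by (simp add: c0_def c1_def)
  obtain d1 where d1: "0 < d1" "\<And>x \<phi>. x \<in> ball x0 d1 \<Longrightarrow> \<phi> \<in> {0..pi} \<Longrightarrow> circle_point x \<phi> \<in> W"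
  proof (rule circle_tube[of W x0])
    show "open W" using f by (simp add: separately_holomorphic_def)
  qed (use in_W in auto)
  \<comment> \<open>The bound \<open>norm r0\<close> keeps the radius coordinate away from 0, where
    2 pi / r is singular.\<close>
  define N where "N = ball x0 (min d1 (norm r0))"
  have N: "open N" "convex N" "x0 \<in> N" using d1 r0 by (auto simp: N_def)
  have sub: "circle_point x \<phi> \<in> W" if "x \<in> N" "\<phi> \<in> {0..pi}" for x \<phi>
    using d1(2)[of x \<phi>] that by (simp add: N_def)
  have rnz: "fst (snd x) \<noteq> 0" if "x \<in> N" for x
  proof
    assume z: "fst (snd x) = 0"
    have "norm (fst (snd (x0 - x))) \<le> norm (snd (x0 - x))" by (rule norm_components_le)
    also have "\<dots> \<le> norm (x0 - x)" by (rule norm_components_le)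
    also have "\<dots> < norm r0" using that by (simp add: N_def dist_norm)
    finally show False using z by (simp add: x0_def)
  qed
  define F1 where "F1 x = (circle_integral (deriv1 f) c0 x, circle_integral (deriv1 f) c1 x, circle_integral (deriv2 f) c0 x)" for x
  define F2 where "F2 x = (circle_integral (deriv1 f) c1 x, circle_integral (deriv1 f) c2 x + 2 * of_real pi / (fst (snd x))\<^sup>2, circle_integral (deriv2 f) c1 x)" for x
  define F3 :: "complex3 \<Rightarrow> complex3" where "F3 x = (0, 0, 1)" for x
  \<comment> \<open>Carrying the parameter along as third component turns the implicit function
    theorem into the inverse function theorem: the solution is the inverse of \<open>\<Psi>\<close>
    along the line of points (0, 0, s).\<close>
  define \<Psi> where "\<Psi> x = (circle_integral f c0 x, circle_integral f c1 x - 2 * of_real pi / fst (snd x), snd (snd x))" for x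
  define \<Psi>' where "\<Psi>' x = pack3 (lin3 (F1 x)) (lin3 (F2 x)) (lin3 (F3 x))" for x
  let ?G = "\<lambda>x. (circle_integral (deriv1 f) c1 x, circle_integral (deriv1 f) c2 x, circle_integral (deriv2 f) c1 x)"
  have der: "(\<Psi> has_derivative blinfun_apply (\<Psi>' x)) (at x)" if x: "x \<in> N" for x
  proof -
    have 1: "(circle_integral f c0 has_derivative blinfun_apply (lin3 (F1 x))) (at x)"
      using circle_integral_has_derivative[OF f c(1) N(1,2) x sub] unfolding c01 F1_def .
    have 2: "(circle_integral f c1 has_derivative blinfun_apply (lin3 (?G x))) (at x)"
      using circle_integral_has_derivative[OF f c(2) N(1,2) x sub] unfolding c2_def .
    have "((\<lambda>x::complex3. fst (snd x)) has_derivative (\<lambda>h. fst (snd h))) (at x)"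
      by (rule bounded_linear_imp_has_derivative) simp
    moreover have "((\<lambda>w. 2 * of_real pi / w) has_field_derivative (- 2 * of_real pi / (fst (snd x))\<^sup>2)) (at (fst (snd x)))"
      using rnz[OF x] by (auto intro!: derivative_eq_intros simp: power2_eq_square)
    ultimately have 3: "((\<lambda>x. 2 * of_real pi / fst (snd x)) has_derivative (\<lambda>h. (- 2 * of_real pi / (fst (snd x))\<^sup>2) * fst (snd h))) (at x)"
      unfolding has_field_derivative_def by (rule has_derivative_compose)
    have 4: "((\<lambda>x::complex3. snd (snd x)) has_derivative (\<lambda>h. snd (snd h))) (at x)"
      by (rule bounded_linear_imp_has_derivative) simp
    have "(\<Psi> has_derivative (\<lambda>h. (blinfun_apply (lin3 (F1 x)) h, blinfun_apply (lin3 (?G x)) h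
        - (- 2 * of_real pi / (fst (snd x))\<^sup>2) * fst (snd h), snd (snd h)))) (at x)"
      unfolding \<Psi>_def[abs_def] by (intro has_derivative_Pair 1 4 has_derivative_diff 2 3)
    moreover have "(\<lambda>h. (blinfun_apply (lin3 (F1 x)) h, blinfun_apply (lin3 (?G x)) h
        - (- 2 * of_real pi / (fst (snd x))\<^sup>2) * fst (snd h), snd (snd h))) = blinfun_apply (\<Psi>' x)"
      by (rule ext) (simp add: \<Psi>'_def F2_def F3_def distrib_right)
    ultimately show ?thesis by simp
  qed
  note f1 = continuous_deriv1[OF f] and f2 = continuous_deriv2[OF f]
  note cci = continuous_circle_integral[OF f1 c(1) sub] continuous_circle_integral[OF f1 c(2) sub] continuous_circle_integral[OF f1 c' sub]
    continuous_circle_integral[OF f2 c(1) sub] continuous_circle_integral[OF f2 c(2) sub]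
  have cF1: "continuous_on N F1" unfolding F1_def[abs_def] by (intro continuous_on_Pair cci)
  have cF2: "continuous_on N F2" unfolding F2_def[abs_def]
    by (intro continuous_on_Pair cci continuous_on_add continuous_on_divide continuous_on_const continuous_on_power
      continuous_on_fst continuous_on_snd continuous_on_id) (use rnz in auto)
  have cont: "continuous_on N \<Psi>'" unfolding \<Psi>'_def[abs_def]
    by (intro continuous_on_pack3 bounded_linear.continuous_on[OF bounded_linear_lin3] cF1 cF2) (simp add: F3_def[abs_def])
  have inj: "inj (blinfun_apply (\<Psi>' x0))"
  proof (rule injI)
    fix u v assume uv: "blinfun_apply (\<Psi>' x0) u = blinfun_apply (\<Psi>' x0) v"
    define h where "h = u - v"
    have "blinfun_apply (\<Psi>' x0) h = 0" unfolding h_def using uv by (simp add: blinfun.diff_right)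
    moreover obtain a b e where h: "h = (a, b, e)" by (cases h)
    ultimately have e: "e = 0" and p: "A * a + B * b = 0" and q: "B * a + (D + 2 * of_real pi / r0\<^sup>2) * b = 0"
      by (auto simp: \<Psi>'_def F1_def F2_def F3_def A_def B_def D_def c0_def c1_def c2_def x0_def zero_prod_def)
    define E where "E = D + 2 * of_real pi / r0\<^sup>2"
    have q: "B * a + E * b = 0" using q by (simp add: E_def)
    \<comment> \<open>Cramer's rule: eliminating either unknown leaves the determinant, nonzero by
      \<open>nondeg\<close>.\<close>
    have "(A * E - B\<^sup>2) * a = E * (A * a + B * b) - B * (B * a + E * b)"
      by (simp add: algebra_simps power2_eq_square)
    then have a: "a = 0" using nondeg p q by (simp add: E_def)
    have "(A * E - B\<^sup>2) * b = A * (B * a + E * b) - B * (A * a + B * b)"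
      by (simp add: algebra_simps power2_eq_square)
    then have b: "b = 0" using nondeg p q by (simp add: E_def)
    show "u = v" using h a b e by (simp add: h_def zero_prod_def[symmetric])
  qed
  have "linear (blinfun_apply (\<Psi>' x0))" by (rule bounded_linear.linear[OF blinfun.bounded_linear_right])
  from linear_injective_left_inverse[OF this inj]
  obtain g0 where g0: "linear g0" "g0 \<circ> blinfun_apply (\<Psi>' x0) = id" by blast
  have g0b: "bounded_linear g0" using g0(1) by (simp add: linear_conv_bounded_linear)
  have inv: "Blinfun g0 o\<^sub>L \<Psi>' x0 = id_blinfun"
  proof (rule blinfun_eqI)
    fix h show "blinfun_apply (Blinfun g0 o\<^sub>L \<Psi>' x0) h = blinfun_apply id_blinfun h"
      using fun_cong[OF g0(2), of h] by (simp add: bounded_linear_Blinfun_apply[OF g0b])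
  qed
  have "\<exists>U V g g'. open U \<and> U \<subseteq> N \<and> x0 \<in> U \<and> open V \<and> \<Psi> x0 \<in> V \<and> homeomorphism U V \<Psi> g \<and>
    (\<forall>y\<in>V. (g has_derivative (g' y)) (at y) \<and> g' y = inv (blinfun_apply (\<Psi>' (g y))) \<and> bij (blinfun_apply (\<Psi>' (g y))))"
    (is "\<exists>U V g g'. ?P U V g g'")
  proof (rule inverse_function_theorem[OF N(1) der cont N(3) inv], goal_cases)
    case (1 x)
    then show ?case .
  next
    case (2 U V g g')
    then have "?P U V g g'" by (intro conjI ballI 2)
    then show ?case by (intro exI)
  qed
  then obtain U V g g' where H: "?P U V g g'" by (elim exE)
  note H1 = H[THEN conjunct2, THEN conjunct2]
  note H2 = H1[THEN conjunct2, THEN conjunct2]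
  have U: "open U" "x0 \<in> U" by (rule H[THEN conjunct1], rule H1[THEN conjunct1])
  have V: "open V" "\<Psi> x0 \<in> V" by (rule H1[THEN conjunct2, THEN conjunct1], rule H2[THEN conjunct1])
  have hom: "homeomorphism U V \<Psi> g" by (rule H2[THEN conjunct2, THEN conjunct1])
  note H3 = bspec[OF H2[THEN conjunct2, THEN conjunct2]]
  note g = H3[THEN conjunct1] and g' = H3[THEN conjunct2, THEN conjunct1] H3[THEN conjunct2, THEN conjunct2]
  define emb :: "complex \<Rightarrow> complex3" where "emb s = (0, 0, s)" for s
  have embb: "bounded_linear emb" unfolding emb_def[abs_def]
    by (intro bounded_linear_Pair bounded_linear_zero bounded_linear_ident)
  define T where "T = emb -` V"
  have T: "open T" unfolding T_def
    by (rule open_vimage[OF V(1) linear_continuous_on[OF embb]])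
  have \<Psi>0: "\<Psi> x0 = emb t0"
    using eq1 eq2 by (simp add: \<Psi>_def emb_def c0_def c1_def) (simp add: x0_def)
  \<comment> \<open>The inverse function theorem gives only real differentiability. The derivatives
    of \<open>\<Psi>\<close> commute with complex multiples, hence so do their inverses, and the
    coordinates of the inverse are complex differentiable in s.\<close>
  have hol: "(\<lambda>s. p (g (emb s))) holomorphic_on T"
    if p: "bounded_linear p" "\<And>k h. p (k * fst h, k * fst (snd h), k * snd (snd h)) = k * p h" for p :: "complex3 \<Rightarrow> complex"
    unfolding holomorphic_on_open[OF T]
  proof
    fix s assume "s \<in> T"
    then have y: "emb s \<in> V" by (simp add: T_def)
    define L where "L = blinfun_apply (\<Psi>' (g (emb s)))"
    have L: "L (k * fst h, k * fst (snd h), k * snd (snd h)) = (k * fst (L h), k * fst (snd (L h)), k * snd (snd (L h)))" for k h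
      by (simp add: L_def \<Psi>'_def algebra_simps)
    have bij: "bij L" unfolding L_def by (rule g'(2)[OF y])
    define w where "w = inv L (emb 1)"
    have Lw: "L w = emb 1" unfolding w_def using bij by (simp add: bij_is_surj surj_f_inv_f)
    have "inv L (emb k) = (k * fst w, k * fst (snd w), k * snd (snd w))" for k
    proof -
      have "L (k * fst w, k * fst (snd w), k * snd (snd w)) = emb k" unfolding L Lw by (simp add: emb_def)
      then show ?thesis using bij by (metis bij_is_inj inv_f_f)
    qed
    then have inv: "p (inv L (emb k)) = p w * k" for k using p(2)[of k w] by (simp add: mult.commute)
    have "(emb has_derivative emb) (at s)" by (rule bounded_linear_imp_has_derivative[OF embb])
    from has_derivative_compose[OF has_derivative_compose[OF this g[OF y]] bounded_linear_imp_has_derivative[OF p(1)]]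
    have "((\<lambda>s. p (g (emb s))) has_derivative (\<lambda>k. p (g' (emb s) (emb k)))) (at s)" .
    moreover have "(\<lambda>k. p (g' (emb s) (emb k))) = (*) (p w)"
      unfolding g'(1)[OF y] L_def[symmetric] by (simp add: inv fun_eq_iff)
    ultimately show "\<exists>d. ((\<lambda>s. p (g (emb s))) has_field_derivative d) (at s)"
      unfolding has_field_derivative_def by auto
  qed
  have h1: "(\<lambda>s. fst (g (emb s))) holomorphic_on T" by (rule hol[OF bounded_linear_coordinates(1)]) simp
  have h2: "(\<lambda>s. fst (snd (g (emb s)))) holomorphic_on T" by (rule hol[OF bounded_linear_coordinates(2)]) simp
  have t0: "t0 \<in> T" using V(2) \<Psi>0 by (simp add: T_def)
  have sol: "s \<in> T \<and> fst (g (emb s)) = m \<and> fst (snd (g (emb s))) = r"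
    if "(m, r, s) \<in> U" "circle_integral f (\<lambda>_. 1) (m, r, s) = 0"
      "circle_integral f (\<lambda>\<phi>. of_real (cos \<phi>)) (m, r, s) = 2 * of_real pi / r" for m r s
  proof -
    have *: "\<Psi> (m, r, s) = emb s" using that(2,3) unfolding \<Psi>_def emb_def c0_def c1_def by simp
    have "\<Psi> (m, r, s) \<in> V" "g (\<Psi> (m, r, s)) = (m, r, s)"
      using hom that(1) unfolding homeomorphism_def by auto
    then show ?thesis unfolding * T_def by simp
  qed
  show ?thesis
    by (rule exI[of _ T], rule exI[of _ "\<lambda>s. fst (g (emb s))"], rule exI[of _ "\<lambda>s. fst (snd (g (emb s)))"], rule exI[of _ U])
      (intro conjI allI impI T t0 h1 h2 U sol[THEN conjunct1] sol[THEN conjunct2, THEN conjunct1] sol[THEN conjunct2, THEN conjunct2]; assumption)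
qed

section \<open>First and second order conditions at the minimiser\<close>

text \<open>The imaginary part of F vanishes along the real axis, so the derivative taken along the
  axis is real.\<close>

lemma real_restriction_derivative:
  fixes F :: "complex \<Rightarrow> complex" and v :: "real \<Rightarrow> real"
  assumes F: "F field_differentiable at (of_real x)" and v: "\<And>y. F (of_real y) = of_real (v y)"
  shows "(v has_real_derivative Re (deriv F (of_real x))) (at x)"
    and "deriv F (of_real x) = of_real (Re (deriv F (of_real x)))"
proof -
  have "(F has_field_derivative deriv F (of_real x)) (at (of_real x))"
    using F by (rule field_differentiable_derivI)
  then have d: "((\<lambda>y. of_real (v y)) has_vector_derivative deriv F (of_real x)) (at x)"
    using has_vector_derivative_real_field[of F _ x UNIV] by (simp add: v)
  from bounded_linear.has_vector_derivative[OF bounded_linear_Re d]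
  show "(v has_real_derivative Re (deriv F (of_real x))) (at x)"
    by (simp add: has_real_derivative_iff_has_vector_derivative)
  from bounded_linear.has_vector_derivative[OF bounded_linear_Im d]
  have "((\<lambda>y. 0::real) has_vector_derivative Im (deriv F (of_real x))) (at x)" by simp
  then have "Im (deriv F (of_real x)) = 0"
    using vector_derivative_unique_at[OF _ has_vector_derivative_const] by blast
  then show "deriv F (of_real x) = of_real (Re (deriv F (of_real x)))"
    by (simp add: complex_eq_iff)
qed

lemma interval_energy_eq:
  assumes "continuous_on UNIV v"
  shows "interval_energy v m r = integral {0..pi} (\<lambda>\<phi>. v (m + r * cos \<phi>)) / pi - 2 * ln r"
proof -
  have c: "continuous_on UNIV (\<lambda>\<phi>. v (m + r * cos \<phi>))"
    by (rule continuous_on_compose2[OF assms]) (auto intro!: continuous_intros)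
  have "set_integrable lborel {0..pi} (\<lambda>\<phi>. v (m + r * cos \<phi>))"
    by (rule borel_integrable_atLeastAtMost', rule continuous_on_subset[OF c]) simp
  then have "(LINT \<phi>:{0..pi}|lborel. v (m + r * cos \<phi>)) = integral {0..pi} (\<lambda>\<phi>. v (m + r * cos \<phi>))"
    by (rule set_borel_integral_eq_integral(2))
  then show ?thesis unfolding interval_energy_def
    using integral_angle[OF borel_measurable_continuous_onI[OF c]] by simp
qed

text \<open>Differentiation along the line through (m, r) in direction (d, e). The weight
  \<open>c\<close> permits a second application, as the first derivative is again such an average,
  with weight d + e cos \<phi>.\<close>

lemma circle_average_derivative:
  fixes w w1 c :: "real \<Rightarrow> real"
  assumes w: "\<And>x. (w has_real_derivative w1 x) (at x)" and w1: "continuous_on UNIV w1" and c: "continuous_on UNIV c"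
  shows "((\<lambda>\<epsilon>. integral {0..pi} (\<lambda>\<phi>. w ((m + \<epsilon> * d) + (r + \<epsilon> * e) * cos \<phi>) * c \<phi>)) has_real_derivative
     integral {0..pi} (\<lambda>\<phi>. w1 ((m + \<epsilon> * d) + (r + \<epsilon> * e) * cos \<phi>) * (d + e * cos \<phi>) * c \<phi>)) (at \<epsilon>)"
proof -
  have wc: "continuous_on UNIV w"
    by (intro DERIV_continuous_on[where D = w1]) (rule w)
  have "((\<lambda>\<epsilon>. integral (cbox 0 pi) (\<lambda>\<phi>. w ((m + \<epsilon> * d) + (r + \<epsilon> * e) * cos \<phi>) * c \<phi>)) has_field_derivative
     integral (cbox 0 pi) (\<lambda>\<phi>. w1 ((m + \<epsilon> * d) + (r + \<epsilon> * e) * cos \<phi>) * (d + e * cos \<phi>) * c \<phi>)) (at \<epsilon> within UNIV)"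
  proof (rule leibniz_rule_field_derivative)
    show "((\<lambda>\<epsilon>. w ((m + \<epsilon> * d) + (r + \<epsilon> * e) * cos \<phi>) * c \<phi>) has_field_derivative
        w1 ((m + \<epsilon> * d) + (r + \<epsilon> * e) * cos \<phi>) * (d + e * cos \<phi>) * c \<phi>) (at \<epsilon> within UNIV)" for \<epsilon> \<phi>
      by (rule DERIV_cmult_right, rule DERIV_chain2[OF w]) (auto intro!: derivative_eq_intros)
    show "(\<lambda>\<phi>. w ((m + \<epsilon> * d) + (r + \<epsilon> * e) * cos \<phi>) * c \<phi>) integrable_on cbox 0 pi" for \<epsilon>
    proof (rule integrable_continuous)
      have "continuous_on (cbox 0 pi) (\<lambda>\<phi>. w ((m + \<epsilon> * d) + (r + \<epsilon> * e) * cos \<phi>))"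
        by (rule continuous_on_compose2[OF wc]) (auto intro!: continuous_intros)
      then show "continuous_on (cbox 0 pi) (\<lambda>\<phi>. w ((m + \<epsilon> * d) + (r + \<epsilon> * e) * cos \<phi>) * c \<phi>)"
        by (rule continuous_on_mult) (rule continuous_on_subset[OF c], simp)
    qed
    have "continuous_on (UNIV \<times> cbox 0 pi) (\<lambda>p. w1 ((m + fst p * d) + (r + fst p * e) * cos (snd p)))"
      by (rule continuous_on_compose2[OF w1]) (auto intro!: continuous_intros)
    moreover have "continuous_on (UNIV \<times> cbox 0 pi) (\<lambda>p::real \<times> real. d + e * cos (snd p))" by (intro continuous_intros)
    moreover have "continuous_on (UNIV \<times> cbox 0 pi) (\<lambda>p::real \<times> real. c (snd p))"
      by (rule continuous_on_compose2[OF c]) (auto intro!: continuous_intros)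
    ultimately have "continuous_on (UNIV \<times> cbox 0 pi) (\<lambda>p. w1 ((m + fst p * d) + (r + fst p * e) * cos (snd p)) * (d + e * cos (snd p)) * c (snd p))"
      by (simp only: continuous_on_mult)
    then show "continuous_on (UNIV \<times> cbox 0 pi) (\<lambda>(\<epsilon>, \<phi>). w1 ((m + \<epsilon> * d) + (r + \<epsilon> * e) * cos \<phi>) * (d + e * cos \<phi>) * c \<phi>)"
      unfolding split_beta .
  qed auto
  then show ?thesis by simp
qed

text \<open>By the mean value theorem some z < x has x * j1 z = j x - j 0 \<ge> k x^2, so j1 z > k
  z. If j2 were not positive, the difference quotient of j1 at 0 would stay below k near 0.\<close>

lemma second_derivative_pos:
  fixes j j1 :: "real \<Rightarrow> real"
  assumes \<delta>: "0 < \<delta>" and j: "\<And>x. 0 \<le> x \<Longrightarrow> x < \<delta> \<Longrightarrow> (j has_real_derivative j1 x) (at x)"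
    and j0: "j1 0 = 0" and j2: "(j1 has_real_derivative j2) (at 0)"
    and k: "0 < k" "\<And>x. 0 < x \<Longrightarrow> x < \<delta> \<Longrightarrow> k * x\<^sup>2 \<le> j x - j 0"
  shows "0 < j2"
proof (rule ccontr)
  assume "\<not> 0 < j2"
  have "((\<lambda>h. (j1 h - j1 0) / h) \<longlongrightarrow> j2) (at 0)"
    using j2 unfolding DERIV_def by simp
  from LIM_D[OF this k(1)] obtain s where s: "0 < s" "\<And>x. x \<noteq> 0 \<Longrightarrow> \<bar>x\<bar> < s \<Longrightarrow> \<bar>(j1 x - j1 0) / x - j2\<bar> < k"
    by auto
  define x where "x = min s \<delta> / 2"
  have x: "0 < x" "x < s" "x < \<delta>" using s \<delta> by (auto simp: x_def)
  obtain z where z: "0 < z" "z < x" "j x - j 0 = (x - 0) * j1 z"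
    using MVT2[of 0 x j j1] x j by auto
  have "j1 z / z < k" using s(2)[of z] z x j0 \<open>\<not> 0 < j2\<close> by (auto simp: abs_less_iff)
  then have "j1 z < k * z" using z by (simp add: field_simps)
  then have "x * j1 z < x * (k * x)" using z x k
    by (intro mult_strict_left_mono) (auto intro: less_trans mult_strict_left_mono)
  then show False using k(2)[of x] x z by (simp add: power2_eq_square algebra_simps)
qed

context soft_edge_equilibrium
begin

definition "mid = (a + b) / 2"
definition "rad = (b - a) / 2"

lemma rad_pos: "0 < rad" using ab by (simp add: rad_def)

lemma interval_energy_min: "0 < r \<Longrightarrow> interval_energy V mid rad \<le> interval_energy V m r"
  using excess_nonneg[of r m] excess_zero unfolding excess_def mid_def rad_def by linarith

lemma interval_energy_min_unique:
  assumes "0 < r" "interval_energy V m r = interval_energy V mid rad"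
  shows "m = mid" "r = rad"
proof -
  have "excess m r = 0" using assms(2) excess_zero unfolding excess_def mid_def rad_def by simp
  from excess_zero_unique[OF assms(1) this] show "m = mid" "r = rad"
    by (auto simp: mid_def rad_def)
qed

text \<open>The energy is restricted to lines through the minimiser. Directions (1, 0) and (0, 1)
  give the two first-order equations; the third claim comes from moving one endpoint at a time
  inwards, where \<open>excess_quadratic\<close> forces a positive second derivative.\<close>

lemma critical_point:
  assumes V1: "\<And>x. (V has_real_derivative V1 x) (at x)" and V2: "\<And>x. (V1 has_real_derivative V2 x) (at x)"
    and V2c: "continuous_on UNIV V2"
  defines "\<alpha> \<equiv> integral {0..pi} (\<lambda>\<phi>. V2 (mid + rad * cos \<phi>))"
    and "\<beta> \<equiv> integral {0..pi} (\<lambda>\<phi>. cos \<phi> * V2 (mid + rad * cos \<phi>))"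
    and "\<gamma> \<equiv> integral {0..pi} (\<lambda>\<phi>. cos \<phi> * cos \<phi> * V2 (mid + rad * cos \<phi>))"
  shows "integral {0..pi} (\<lambda>\<phi>. V1 (mid + rad * cos \<phi>)) = 0"
    and "integral {0..pi} (\<lambda>\<phi>. cos \<phi> * V1 (mid + rad * cos \<phi>)) = 2 * pi / rad"
    and "\<alpha> * (\<gamma> + 2 * pi / rad\<^sup>2) \<noteq> \<beta>\<^sup>2"
proof -
  let ?v1 = "\<lambda>\<phi>. V1 (mid + rad * cos \<phi>)" and ?v2 = "\<lambda>\<phi>. V2 (mid + rad * cos \<phi>)"
  note r = rad_pos
  have V1c: "continuous_on UNIV V1" by (intro DERIV_continuous_on[where D = V2]) (rule V2)
  define j where "j d e \<epsilon> = interval_energy V (mid + \<epsilon> * d) (rad + \<epsilon> * e)" for d e \<epsilon>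
  define j1 where "j1 d e \<epsilon> = integral {0..pi} (\<lambda>\<phi>. V1 ((mid + \<epsilon> * d) + (rad + \<epsilon> * e) * cos \<phi>) * (d + e * cos \<phi>)) / pi - 2 * e / (rad + \<epsilon> * e)" for d e \<epsilon>
  define j2 where "j2 d e = integral {0..pi} (\<lambda>\<phi>. ?v2 \<phi> * (d + e * cos \<phi>) * (d + e * cos \<phi>)) / pi + 2 * e\<^sup>2 / rad\<^sup>2" for d e
  have dj: "(j d e has_real_derivative j1 d e \<epsilon>) (at \<epsilon>)" if "0 < rad + \<epsilon> * e" for d e \<epsilon>
  proof -
    have "((\<lambda>\<epsilon>. integral {0..pi} (\<lambda>\<phi>. V ((mid + \<epsilon> * d) + (rad + \<epsilon> * e) * cos \<phi>))) has_real_derivative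
       integral {0..pi} (\<lambda>\<phi>. V1 ((mid + \<epsilon> * d) + (rad + \<epsilon> * e) * cos \<phi>) * (d + e * cos \<phi>))) (at \<epsilon>)"
      using circle_average_derivative[OF V1 V1c, of "\<lambda>_. 1" mid d rad e \<epsilon>] by simp
    moreover have "((\<lambda>\<epsilon>. 2 * ln (rad + \<epsilon> * e)) has_real_derivative 2 * e / (rad + \<epsilon> * e)) (at \<epsilon>)"
      using that by (auto intro!: derivative_eq_intros)
    ultimately show ?thesis unfolding j_def[abs_def] j1_def interval_energy_eq[OF V_cont]
      by (intro DERIV_diff DERIV_cdivide)
  qed
  have dj1: "(j1 d e has_real_derivative j2 d e) (at 0)" for d e
  proof -
    have "((\<lambda>\<epsilon>. integral {0..pi} (\<lambda>\<phi>. V1 ((mid + \<epsilon> * d) + (rad + \<epsilon> * e) * cos \<phi>) * (d + e * cos \<phi>))) has_real_derivative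
       integral {0..pi} (\<lambda>\<phi>. V2 ((mid + 0 * d) + (rad + 0 * e) * cos \<phi>) * (d + e * cos \<phi>) * (d + e * cos \<phi>))) (at 0)"
      by (rule circle_average_derivative[OF V2 V2c]) (intro continuous_intros)
    moreover have "((\<lambda>\<epsilon>. 2 * e / (rad + \<epsilon> * e)) has_real_derivative - (2 * e\<^sup>2 / rad\<^sup>2)) (at 0)"
      using r by (auto intro!: derivative_eq_intros simp: power2_eq_square)
    ultimately have "(j1 d e has_real_derivative integral {0..pi} (\<lambda>\<phi>. V2 ((mid + 0 * d) + (rad + 0 * e) * cos \<phi>) * (d + e * cos \<phi>) * (d + e * cos \<phi>)) / pi
       - - (2 * e\<^sup>2 / rad\<^sup>2)) (at 0)"
      unfolding j1_def[abs_def] by (intro DERIV_diff DERIV_cdivide)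
    then show ?thesis by (simp add: j2_def)
  qed
  have pos: "0 < rad + \<epsilon> * e" if "\<bar>e\<bar> \<le> 1" "\<bar>\<epsilon>\<bar> < rad" for e \<epsilon>
  proof -
    have "\<bar>\<epsilon> * e\<bar> \<le> \<bar>\<epsilon>\<bar>" using that by (simp add: abs_mult mult_left_le)
    then show ?thesis using that by linarith
  qed
  have crit: "j1 d e 0 = 0" if "\<bar>e\<bar> \<le> 1" for d e
  proof (rule DERIV_local_min[of "j d e" _ 0 rad])
    show "(j d e has_real_derivative j1 d e 0) (at 0)" by (rule dj) (use r in auto)
    show "\<forall>y. \<bar>0 - y\<bar> < rad \<longrightarrow> j d e 0 \<le> j d e y"
      using pos[OF that] interval_energy_min by (auto simp: j_def)
  qed (use r in auto)
  show 1: "integral {0..pi} (\<lambda>\<phi>. ?v1 \<phi>) = 0"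
    using crit[of 0 1] by (simp add: j1_def)
  show 2: "integral {0..pi} (\<lambda>\<phi>. cos \<phi> * ?v1 \<phi>) = 2 * pi / rad"
    using crit[of 1 0] by (simp add: j1_def mult.commute field_simps)
  \<comment> \<open>Direction (-\<sigma>, -1) moves only the endpoint c. Since \<open>excess\<close>
    contains half of the energy, its quadratic constant appears doubled.\<close>
  have conv: "0 < j2 (- \<sigma>) (- 1)" if \<sigma>: "(\<sigma> = 1 \<and> c = b) \<or> (\<sigma> = -1 \<and> c = a)" for \<sigma> c
  proof -
    obtain k \<epsilon>0 where k: "0 < k" "0 < \<epsilon>0" "\<And>\<epsilon>. 0 < \<epsilon> \<Longrightarrow> \<epsilon> < \<epsilon>0 \<Longrightarrow> k * \<epsilon>\<^sup>2 \<le> excess (mid - \<sigma> * \<epsilon>) (rad - \<epsilon>)"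
      using excess_quadratic[OF \<sigma>] unfolding mid_def rad_def by blast
    show ?thesis
    proof (rule second_derivative_pos[of "min \<epsilon>0 rad" "j (- \<sigma>) (- 1)" "j1 (- \<sigma>) (- 1)" _ "2 * k"])
      show "(j (- \<sigma>) (- 1) has_real_derivative j1 (- \<sigma>) (- 1) x) (at x)" if "0 \<le> x" "x < min \<epsilon>0 rad" for x
        by (rule dj) (use that in auto)
      show "2 * k * x\<^sup>2 \<le> j (- \<sigma>) (- 1) x - j (- \<sigma>) (- 1) 0" if "0 < x" "x < min \<epsilon>0 rad" for x
        using k(3)[of x] that excess_zero unfolding j_def excess_def mid_def[symmetric] rad_def[symmetric]
        by (simp add: mult.commute)
    qed (use k r crit[of "-1"] dj1 in auto)
  qed
  have V2r: "continuous_on S (\<lambda>\<phi>. ?v2 \<phi>)" and V1r: "continuous_on S (\<lambda>\<phi>. ?v1 \<phi>)" for S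
    by (rule continuous_on_compose2[OF V2c], auto intro!: continuous_intros, rule continuous_on_compose2[OF V1c], auto intro!: continuous_intros)
  have i: "(\<lambda>\<phi>. ?v2 \<phi>) integrable_on {0..pi}" "(\<lambda>\<phi>. cos \<phi> * ?v2 \<phi>) integrable_on {0..pi}"
    "(\<lambda>\<phi>. cos \<phi> * cos \<phi> * ?v2 \<phi>) integrable_on {0..pi}" "(\<lambda>\<phi>. cos \<phi> * ?v1 \<phi>) integrable_on {0..pi}"
    by (intro integrable_continuous_real continuous_intros V2r V1r)+
  have expand: "integral {0..pi} (\<lambda>\<phi>. ?v2 \<phi> * (d + e * cos \<phi>) * (d + e * cos \<phi>)) = d\<^sup>2 * \<alpha> + 2 * d * e * \<beta> + e\<^sup>2 * \<gamma>" for d e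
  proof -
    have "((\<lambda>\<phi>. d\<^sup>2 * ?v2 \<phi> + 2 * d * e * (cos \<phi> * ?v2 \<phi>) + e\<^sup>2 * (cos \<phi> * cos \<phi> * ?v2 \<phi>))
      has_integral (d\<^sup>2 * \<alpha> + 2 * d * e * \<beta> + e\<^sup>2 * \<gamma>)) {0..pi}"
      unfolding \<alpha>_def \<beta>_def \<gamma>_def by (intro has_integral_add has_integral_mult_right integrable_integral i)
    then have "((\<lambda>\<phi>. ?v2 \<phi> * (d + e * cos \<phi>) * (d + e * cos \<phi>)) has_integral (d\<^sup>2 * \<alpha> + 2 * d * e * \<beta> + e\<^sup>2 * \<gamma>)) {0..pi}"
      by (rule has_integral_eq[rotated]) (simp add: power2_eq_square algebra_simps)
    then show ?thesis by (rule integral_unique)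
  qed
  \<comment> \<open>Integration by parts identifies the two diagonal entries of the Hessian of the energy, which is
    therefore \<open>((\<alpha>, \<beta>), (\<beta>, \<alpha>)) / \<pi>\<close>; moving one endpoint inwards tests \<open>\<alpha> + \<beta>\<close>
    and \<open>\<alpha> - \<beta>\<close>.\<close>
  have parts: "rad * (\<alpha> - \<gamma>) = 2 * pi / rad"
  proof -
    have A: "((\<lambda>\<phi>. cos \<phi> * ?v1 \<phi> - rad * (?v2 \<phi> - cos \<phi> * cos \<phi> * ?v2 \<phi>))
       has_integral (V1 (mid + rad * cos pi) * sin pi - V1 (mid + rad * cos 0) * sin 0)) {0..pi}"
    proof (rule fundamental_theorem_of_calculus)
      fix \<phi> :: real
      have "((\<lambda>\<phi>. ?v1 \<phi>) has_real_derivative ?v2 \<phi> * (- rad * sin \<phi>)) (at \<phi> within {0..pi})"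
        by (rule DERIV_chain2[OF V2]) (auto intro!: derivative_eq_intros)
      then have "((\<lambda>\<phi>. ?v1 \<phi> * sin \<phi>) has_real_derivative
         ?v2 \<phi> * (- rad * sin \<phi>) * sin \<phi> + cos \<phi> * ?v1 \<phi>) (at \<phi> within {0..pi})"
        by (rule DERIV_mult) (auto intro!: derivative_eq_intros)
      moreover have "?v2 \<phi> * (- rad * sin \<phi>) * sin \<phi> + cos \<phi> * ?v1 \<phi> =
         cos \<phi> * ?v1 \<phi> - rad * (?v2 \<phi> - cos \<phi> * cos \<phi> * ?v2 \<phi>)"
      proof -
        have ss: "sin \<phi> * sin \<phi> = 1 - cos \<phi> * cos \<phi>" using sin_cos_squared_add[of \<phi>] by (simp add: power2_eq_square)
        define X where "X = ?v2 \<phi>"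
        have "X * (- rad * sin \<phi>) * sin \<phi> = - (rad * (X * (sin \<phi> * sin \<phi>)))" by simp
        also have "\<dots> = - (rad * (X - cos \<phi> * cos \<phi> * X))" unfolding ss by (simp add: right_diff_distrib)
        finally show ?thesis unfolding X_def by simp
      qed
      ultimately show "((\<lambda>\<phi>. ?v1 \<phi> * sin \<phi>) has_vector_derivative
         cos \<phi> * ?v1 \<phi> - rad * (?v2 \<phi> - cos \<phi> * cos \<phi> * ?v2 \<phi>)) (at \<phi> within {0..pi})"
        by (simp only: has_real_derivative_iff_has_vector_derivative)
    qed simp
    have B: "((\<lambda>\<phi>. cos \<phi> * ?v1 \<phi> - rad * (?v2 \<phi> - cos \<phi> * cos \<phi> * ?v2 \<phi>))
       has_integral (2 * pi / rad - rad * (\<alpha> - \<gamma>))) {0..pi}"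
      unfolding \<alpha>_def \<gamma>_def 2[symmetric] by (intro has_integral_diff has_integral_mult_right integrable_integral i)
    show ?thesis using has_integral_unique[OF A B] by simp
  qed
  have \<gamma>: "\<gamma> + 2 * pi / rad\<^sup>2 = \<alpha>"
    using parts r by (simp add: field_simps power2_eq_square)
  have g: "\<gamma> = \<alpha> - 2 * pi / rad\<^sup>2" using \<gamma> by linarith
  have e1: "j2 (- 1) (- 1) = 2 * (\<alpha> + \<beta>) / pi"
    unfolding j2_def expand g using r by (simp add: field_simps power2_eq_square)
  have e2: "j2 1 (- 1) = 2 * (\<alpha> - \<beta>) / pi"
    unfolding j2_def expand g using r by (simp add: field_simps power2_eq_square)
  have "0 < 2 * (\<alpha> + \<beta>) / pi" "0 < 2 * (\<alpha> - \<beta>) / pi"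
    using conv[of 1 b] conv[of "-1" a] unfolding e1[symmetric] e2[symmetric] by simp_all
  then have "0 < \<alpha> + \<beta>" "0 < \<alpha> - \<beta>" by (auto simp: zero_less_divide_iff)
  then have "0 < (\<alpha> + \<beta>) * (\<alpha> - \<beta>)" by (rule mult_pos_pos)
  then show "\<alpha> * (\<gamma> + 2 * pi / rad\<^sup>2) \<noteq> \<beta>\<^sup>2"
    unfolding \<gamma> by (simp add: algebra_simps power2_eq_square)
qed

end

section \<open>From one-cut data to an equilibrium law with soft edges\<close>

lemma second_difference_bound:
  fixes v v1 v2 :: "real \<Rightarrow> real"
  assumes v: "\<And>x. (v has_real_derivative v1 x) (at x)" and v1: "\<And>x. (v1 has_real_derivative v2 x) (at x)"
    and v2: "continuous_on UNIV v2"
  shows "\<exists>K \<delta>. 0 < \<delta> \<and> (\<forall>h. 0 < h \<and> h < \<delta> \<longrightarrow> \<bar>v (c + 2 * (\<sigma> * h)) - 2 * v (c + \<sigma> * h) + v c\<bar> \<le> K * h\<^sup>2)"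
proof -
  define S where "S = cball c (2 * \<bar>\<sigma>\<bar>)"
  have "bounded (v2 ` S)"
    by (intro compact_imp_bounded compact_continuous_image continuous_on_subset[OF v2]) (auto simp: S_def)
  then obtain M where M: "0 < M" "\<And>x. x \<in> S \<Longrightarrow> \<bar>v2 x\<bar> \<le> M" by (auto simp: bounded_pos)
  have "\<bar>v (c + 2 * (\<sigma> * h)) - 2 * v (c + \<sigma> * h) + v c\<bar> \<le> (M * \<sigma>\<^sup>2) * h\<^sup>2" if h: "0 < h" "h < 1" for h
  proof -
    define e where "e = \<sigma> * h"
    have e: "\<bar>e\<bar> \<le> \<bar>\<sigma>\<bar>" using h by (simp add: e_def abs_mult mult_left_le)
    have lip: "norm (v1 x - v1 y) \<le> M * norm (x - y)" if "x \<in> S" "y \<in> S" for x y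
    proof (rule field_differentiable_bound[of S v1 v2])
      show "convex S" by (simp add: S_def)
      show "norm (v2 z) \<le> M" if "z \<in> S" for z using M(2)[OF that] by simp
    qed (rule has_field_derivative_at_within[OF v1], (rule that)+)
    \<comment> \<open>The second difference is an increment of \<open>G\<close>, and the derivative
      of \<open>G\<close> is itself an increment of v1; the mean value inequality is applied at both
      levels.\<close>
    define G where "G x = v (x + e) - v x" for x
    have "norm (G (c + e) - G c) \<le> (M * \<bar>e\<bar>) * norm ((c + e) - c)"
    proof (rule field_differentiable_bound[of "cball c \<bar>e\<bar>" G "\<lambda>x. v1 (x + e) - v1 x"])
      fix x assume x: "x \<in> cball c \<bar>e\<bar>"
      have "((\<lambda>x. v (x + e)) has_real_derivative v1 (x + e) * 1) (at x)"
        by (rule DERIV_chain2[OF v]) (auto intro!: derivative_eq_intros)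
      then have "((\<lambda>x. v (x + e)) has_real_derivative v1 (x + e)) (at x)" by simp
      then show "(G has_field_derivative v1 (x + e) - v1 x) (at x within cball c \<bar>e\<bar>)"
          unfolding G_def[abs_def] by (rule has_field_derivative_at_within[OF DERIV_diff[OF _ v]])
      have "x \<in> S" "x + e \<in> S" using x e by (auto simp: S_def dist_real_def)
      from lip[OF this(2,1)] show "norm (v1 (x + e) - v1 x) \<le> M * \<bar>e\<bar>" by simp
    qed (auto simp: dist_real_def)
    also have "G (c + e) - G c = v (c + 2 * (\<sigma> * h)) - 2 * v (c + \<sigma> * h) + v c"
      by (simp add: G_def e_def algebra_simps)
    also have "(M * \<bar>e\<bar>) * norm ((c + e) - c) = (M * \<sigma>\<^sup>2) * h\<^sup>2"
    proof -
      have "(M * \<bar>e\<bar>) * norm ((c + e) - c) = M * (\<bar>e\<bar> * \<bar>e\<bar>)" by simp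
      also have "\<bar>e\<bar> * \<bar>e\<bar> = \<sigma>\<^sup>2 * h\<^sup>2" by (simp add: e_def power2_eq_square)
      finally show ?thesis by simp
    qed
    finally show ?thesis by simp
  qed
  then show ?thesis by (intro exI[of _ "M * \<sigma>\<^sup>2"] exI[of _ 1]) auto
qed

lemma real_analytic_at_isCont:
  assumes "real_analytic_at f x" shows "isCont f x"
proof -
  obtain r c where r: "0 < r" and s: "\<And>y. \<bar>y - x\<bar> < r \<Longrightarrow> (\<lambda>n. c n * (y - x) ^ n) sums f y"
    using assms unfolding real_analytic_at_def by blast
  have "summable (\<lambda>n. c n * (r / 2) ^ n)"
    using s[of "x + r / 2"] r by (auto simp: sums_iff)
  then have A: "isCont (\<lambda>z. \<Sum>n. c n * z ^ n) (x - x)"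
    by (rule isCont_powser) (use r in simp)
  have "isCont (\<lambda>y. y - x) x" by (intro continuous_intros)
  from isCont_o2[OF this A] have B: "isCont (\<lambda>y. \<Sum>n. c n * (y - x) ^ n) x" .
  have "eventually (\<lambda>y. y \<in> ball x r) (nhds x)" using r by (intro eventually_nhds_in_open) auto
  then have "eventually (\<lambda>y. f y = (\<Sum>n. c n * (y - x) ^ n)) (nhds x)"
  proof eventually_elim
    case (elim y)
    then have "\<bar>y - x\<bar> < r" by (simp add: dist_real_def abs_minus_commute)
    from sums_unique[OF s[OF this]] show ?case .
  qed
  from isCont_cong[OF this] B show ?thesis by (rule iffD2)
qed

lemma analytic_on_closed_interval_continuous:
  assumes "analytic_on_closed_interval h a b" shows "continuous_on {a..b} h"
proof -
  obtain c d g where g: "c < a" "b < d" "real_analytic_on {c<..<d} g" "\<And>x. x \<in> {a..b} \<Longrightarrow> g x = h x"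
    using assms unfolding analytic_on_closed_interval_def by blast
  have "continuous_on {a..b} g"
    using g by (intro continuous_at_imp_continuous_on ballI real_analytic_at_isCont) (auto simp: real_analytic_on_def)
  then show ?thesis using g(4) by (rule continuous_on_eq)
qed

text \<open>One-cut data give \<open>h\<close> on [a, b] without a sign, and the density is
  truncated by \<open>ennreal\<close>. The task is to find a continuous nonnegative density on the
  line for the same measure, to show that \<open>h\<close> is positive at the endpoints, and to
  extract the square-root lower bound.\<close>

lemma one_cut_soft_edge:
  fixes V V1 V2 :: "real \<Rightarrow> real"
  assumes conf: "confining_potential V C"
    and V1: "\<And>x. (V has_real_derivative V1 x) (at x)" and V2: "\<And>x. (V1 has_real_derivative V2 x) (at x)"
    and V2c: "continuous_on UNIV V2"
    and cut: "one_cut_data V a b h \<nu>" and ends: "h a \<noteq> 0" "h b \<noteq> 0"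
  shows "\<exists>\<rho> l. soft_edge_equilibrium V C \<rho> a b l \<and> continuous_density.law \<rho> = \<nu>"
proof -
  have eq: "equilibrium_measure V \<nu>" and ab: "a < b" and supp: "msupp \<nu> = {a..b}"
    and an: "analytic_on_closed_interval h a b"
    and \<nu>: "\<nu> = density lborel (\<lambda>x. ennreal (indicator {a..b} x * (1 / (2 * pi)) * h x * sqrt ((b - x) * (x - a))))"
    using cut by (auto simp: one_cut_data_def)
  have hc: "continuous_on {a..b} h" by (rule analytic_on_closed_interval_continuous[OF an])
  \<comment> \<open>Clamping the argument to [a, b] makes \<rho> continuous on the line;
    \<open>max 0\<close> on \<open>h\<close> repeats the truncation that \<open>ennreal\<close>
    performs in the given density, so the measure is unchanged.\<close>
  define \<rho> where "\<rho> x = max 0 (h (max a (min b x))) * sqrt (max 0 ((b - x) * (x - a))) / (2 * pi)" for x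
  have \<rho>_in: "\<rho> x = max 0 (h x) * sqrt ((b - x) * (x - a)) / (2 * pi)" if "x \<in> {a..b}" for x
    using that by (simp add: \<rho>_def max_def)
  have \<rho>_out: "\<rho> x = 0" if "x \<notin> {a..b}" for x
  proof -
    have "(b - x) * (x - a) \<le> 0" using that ab by (auto simp: mult_le_0_iff)
    then show ?thesis by (simp add: \<rho>_def)
  qed
  have dens: "\<nu> = density lborel (\<lambda>x. ennreal (\<rho> x))"
    unfolding \<nu>
  proof (rule arg_cong[where f = "density lborel"], rule ext)
    fix x
    show "ennreal (indicator {a..b} x * (1 / (2 * pi)) * h x * sqrt ((b - x) * (x - a))) = ennreal (\<rho> x)"
    proof (cases "x \<in> {a..b}")
      case True
      then have s: "0 \<le> sqrt ((b - x) * (x - a))" by simp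
      show ?thesis
      proof (cases "0 \<le> h x")
        case False
        then have "indicator {a..b} x * (1 / (2 * pi)) * h x * sqrt ((b - x) * (x - a)) \<le> 0"
          using True s by (simp add: mult_le_0_iff divide_le_0_iff)
        then show ?thesis using False True by (simp add: \<rho>_in ennreal_neg)
      qed (use True in \<open>simp add: \<rho>_in\<close>)
    qed (simp add: \<rho>_out)
  qed
  have "prob_space \<nu>" using eq by (simp add: equilibrium_measure_def borel_prob_def)
  then have one: "emeasure \<nu> (space \<nu>) = 1" by (rule prob_space.emeasure_space_1)
  have \<rho>c: "continuous_on UNIV \<rho>"
  proof -
    have "continuous_on UNIV (\<lambda>x. h (max a (min b x)))"
      by (rule continuous_on_compose2[OF hc]) (use ab in \<open>auto intro!: continuous_intros\<close>)
    then show ?thesis unfolding \<rho>_def[abs_def] by (intro continuous_intros) auto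
  qed
  have [measurable]: "\<rho> \<in> borel_measurable borel" using \<rho>c by (rule borel_measurable_continuous_onI)
  have cd: "continuous_density \<rho> a b"
  proof
    show "(\<integral>\<^sup>+y. ennreal (\<rho> y) \<partial>lborel) = 1"
      using one unfolding dens by (simp add: emeasure_density)
  qed (use \<rho>c \<rho>_out in \<open>auto simp: \<rho>_def\<close>)
  interpret potential_and_density V C \<rho> a b
    using conf cd by (simp add: potential_and_density_def)
  have law: "law = \<nu>" unfolding law_def dens ..
  \<comment> \<open>If \<open>h\<close> were negative at c, the truncated density would vanish near
    c and c would not belong to the support.\<close>
  have hpos: "0 < h c" if c: "c \<in> {a..b}" "h c \<noteq> 0" for c
  proof (rule ccontr)
    assume "\<not> 0 < h c"
    then have neg: "h c < 0" using c by simp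
    have "continuous (at c within {a..b}) h" using hc c by (simp add: continuous_on_eq_continuous_within)
    then obtain e where e: "0 < e" "\<And>x. x \<in> {a..b} \<Longrightarrow> \<bar>x - c\<bar> < e \<Longrightarrow> \<bar>h x - h c\<bar> < - h c"
      using neg unfolding continuous_within_eps_delta dist_real_def by (metis neg_0_less_iff_less)
    have "\<rho> x = 0" if "\<bar>x - c\<bar> < e" for x
    proof (cases "x \<in> {a..b}")
      case True
      then show ?thesis using e(2)[OF True that] by (simp add: \<rho>_in)
    qed (simp add: \<rho>_out)
    then have "AE x in law. x \<notin> {c - e<..<c + e}"
      unfolding AE_law by (intro AE_I2) (auto simp: abs_less_iff)
    then have "emeasure law {c - e<..<c + e} = 0"
      by (subst (asm) AE_iff_measurable[of "{c - e<..<c + e}"]) auto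
    moreover have "c \<in> msupp law" using c supp law by simp
    ultimately show False using e unfolding msupp_def by force
  qed
  have edge: "soft_edge \<rho> c \<sigma>" if \<sigma>: "(\<sigma> = 1 \<and> c = b) \<or> (\<sigma> = -1 \<and> c = a)" for \<sigma> c
  proof -
    have c: "c \<in> {a..b}" "0 < h c" using \<sigma> ab ends hpos by auto
    have "continuous (at c within {a..b}) h" using hc c by (simp add: continuous_on_eq_continuous_within)
    then obtain e where e: "0 < e" "\<And>x. x \<in> {a..b} \<Longrightarrow> \<bar>x - c\<bar> < e \<Longrightarrow> \<bar>h x - h c\<bar> < h c / 2"
      using c unfolding continuous_within_eps_delta dist_real_def by (metis half_gt_zero)
    \<comment> \<open>Within e / 2 of c, \<open>h\<close> stays above half of \<open>h c\<close>;
      within (b - a) / 2, the factor of (b - x) (x - a) belonging to the other endpoint stays above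
      (b - a) / 2.\<close>
    define \<delta> where "\<delta> = min (e / 2) ((b - a) / 2)"
    define \<kappa> where "\<kappa> = h c / 2 * sqrt ((b - a) / 2) / (2 * pi)"
    have "\<kappa> * sqrt s \<le> \<rho> (c - \<sigma> * s)" if s: "s \<in> {0..\<delta>}" for s
    proof -
      define x where "x = c - \<sigma> * s"
      have x: "x \<in> {a..b}" "\<bar>x - c\<bar> < e" using \<sigma> s e ab by (auto simp: x_def \<delta>_def min_def split: if_splits)
      have p: "(b - x) * (x - a) = s * (b - a - s)" using \<sigma> by (auto simp: x_def algebra_simps)
      have "h c / 2 \<le> max 0 (h x)" using e(2)[OF x] by linarith
      moreover have "sqrt ((b - a) / 2) * sqrt s \<le> sqrt ((b - x) * (x - a))"
        unfolding p real_sqrt_mult[symmetric]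
      proof (intro real_sqrt_le_mono)
        have "s * ((b - a) / 2) \<le> s * (b - a - s)" using s by (intro mult_left_mono) (auto simp: \<delta>_def)
        then show "(b - a) / 2 * s \<le> s * (b - a - s)" by (simp add: mult.commute)
      qed
      ultimately have "h c / 2 * (sqrt ((b - a) / 2) * sqrt s) \<le> max 0 (h x) * sqrt ((b - x) * (x - a))"
        using c s ab by (intro mult_mono) auto
      then have "h c / 2 * (sqrt ((b - a) / 2) * sqrt s) / (2 * pi) \<le> max 0 (h x) * sqrt ((b - x) * (x - a)) / (2 * pi)"
        by (intro divide_right_mono) auto
      then show ?thesis unfolding x_def[symmetric] \<rho>_in[OF x(1)] by (simp add: \<kappa>_def)
    qed
    moreover have "0 < \<delta>" "0 < \<kappa>" using e ab c by (auto simp: \<delta>_def \<kappa>_def)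
    ultimately show ?thesis unfolding soft_edge_def by blast
  qed
  obtain l where l: "\<And>x. log_pot x \<le> V x / 2 + l" "\<And>x. x \<in> msupp law \<Longrightarrow> log_pot x = V x / 2 + l"
    using Euler_Lagrange[unfolded law, OF eq] law by metis
  have "soft_edge_equilibrium V C \<rho> a b l"
  proof
    show "soft_edge \<rho> b 1" "soft_edge \<rho> a (- 1)" using edge by auto
  qed (use l law supp ab second_difference_bound[OF V1 V2 V2c] in auto)
  then show ?thesis using law by blast
qed

section \<open>Analytic dependence on the parameter\<close>

lemma real_analytic_at_Re:
  assumes F: "F holomorphic_on T" and T: "open T" "complex_of_real x \<in> T"
  shows "real_analytic_at (\<lambda>t. Re (F (of_real t))) x"
proof -
  obtain r where r: "0 < r" "ball (complex_of_real x) r \<subseteq> T" using T open_contains_ball by blast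
  define k where "k n = (deriv ^^ n) F (of_real x) / fact n" for n
  have "(\<lambda>n. Re (k n) * (y - x) ^ n) sums Re (F (of_real y))" if "\<bar>y - x\<bar> < r" for y
  proof -
    have "(\<lambda>n. k n * (of_real y - of_real x) ^ n) sums F (of_real y)"
      unfolding k_def by (rule holomorphic_power_series[OF holomorphic_on_subset[OF F r(2)]])
        (use that in \<open>auto simp: dist_norm norm_minus_commute simp flip: of_real_diff\<close>)
    then have "(\<lambda>n. Re (k n * (of_real y - of_real x) ^ n)) sums Re (F (of_real y))" by (rule sums_Re)
    moreover have "Re (k n * (of_real y - of_real x) ^ n) = Re (k n) * (y - x) ^ n" for n
      by (simp flip: of_real_diff of_real_power)
    ultimately show ?thesis by simp
  qed
  then show ?thesis unfolding real_analytic_at_def using r by (intro exI[of _ r] conjI exI[of _ "\<lambda>n. Re (k n)"]) auto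
qed

lemma real_analytic_at_cong:
  assumes f: "real_analytic_at f x" and d: "0 < d" "\<And>y. \<bar>y - x\<bar> < d \<Longrightarrow> f y = g y"
  shows "real_analytic_at g x"
proof -
  obtain r c where r: "0 < r" "\<And>y. \<bar>y - x\<bar> < r \<Longrightarrow> (\<lambda>n. c n * (y - x) ^ n) sums f y"
    using f unfolding real_analytic_at_def by blast
  have "(\<lambda>n. c n * (y - x) ^ n) sums g y" if "\<bar>y - x\<bar> < min r d" for y
    using r(2)[of y] d(2)[of y] that by simp
  then show ?thesis unfolding real_analytic_at_def using d r
    by (intro exI[of _ "min r d"] conjI exI[of _ c]) auto
qed

text \<open>At a and b the local data are one-sided. There the holomorphic function itself continues
  g past the endpoint, and the pieces fit because on the inner side g is its restriction.\<close>

lemma analytic_on_closed_interval_glue: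
  fixes g :: "real \<Rightarrow> real"
  assumes ab: "a < b"
    and loc: "\<And>x. x \<in> {a..b} \<Longrightarrow> \<exists>F T d. open T \<and> complex_of_real x \<in> T \<and> F holomorphic_on T \<and> 0 < d \<and>
      (\<forall>y\<in>{a..b}. \<bar>y - x\<bar> < d \<longrightarrow> g y = Re (F (of_real y)))"
  shows "analytic_on_closed_interval g a b"
proof -
  have real_ball: "\<exists>r>0. \<forall>y. \<bar>y - x\<bar> < r \<longrightarrow> complex_of_real y \<in> T" if T: "open T" "complex_of_real x \<in> T" for x T
  proof -
    obtain r where "0 < r" "ball (complex_of_real x) r \<subseteq> T" using T open_contains_ball by blast
    then show ?thesis by (intro exI[of _ r]) (auto simp: subset_iff dist_norm norm_minus_commute simp flip: of_real_diff)
  qed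
  obtain F0 T0 d0 where 0: "open T0" "complex_of_real a \<in> T0" "F0 holomorphic_on T0" "0 < d0"
    "\<And>y. y \<in> {a..b} \<Longrightarrow> \<bar>y - a\<bar> < d0 \<Longrightarrow> g y = Re (F0 (of_real y))" using loc[of a] ab by auto
  obtain F1 T1 d1 where 1: "open T1" "complex_of_real b \<in> T1" "F1 holomorphic_on T1" "0 < d1"
    "\<And>y. y \<in> {a..b} \<Longrightarrow> \<bar>y - b\<bar> < d1 \<Longrightarrow> g y = Re (F1 (of_real y))" using loc[of b] ab by auto
  obtain r0 where r0: "0 < r0" "\<And>y. \<bar>y - a\<bar> < r0 \<Longrightarrow> complex_of_real y \<in> T0" using real_ball[OF 0(1,2)] by blast
  obtain r1 where r1: "0 < r1" "\<And>y. \<bar>y - b\<bar> < r1 \<Longrightarrow> complex_of_real y \<in> T1" using real_ball[OF 1(1,2)] by blast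
  define G where "G y = (if y < a then Re (F0 (of_real y)) else if b < y then Re (F1 (of_real y)) else g y)" for y
  have "real_analytic_at G x" if x: "a - r0 < x" "x < b + r1" for x
  proof -
    consider "x \<le> a" | "a < x" "x < b" | "b \<le> x" by linarith
    then show ?thesis
    proof cases
      case 1
      have "real_analytic_at (\<lambda>t. Re (F0 (of_real t))) x"
        by (rule real_analytic_at_Re[OF 0(3,1) r0(2)]) (use x 1 in auto)
      \<comment> \<open>The bound b - a keeps y off the branch of \<open>G\<close> beyond the other
        endpoint.\<close>
      then show ?thesis
        by (rule real_analytic_at_cong[where d = "min d0 (b - a)"]) (use 0 ab 1 in \<open>auto simp: G_def\<close>)
    next
      case 2
      obtain F T d where F: "open T" "complex_of_real x \<in> T" "F holomorphic_on T" "0 < d"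
        "\<And>y. y \<in> {a..b} \<Longrightarrow> \<bar>y - x\<bar> < d \<Longrightarrow> g y = Re (F (of_real y))" using loc[of x] 2 by auto
      have "real_analytic_at (\<lambda>t. Re (F (of_real t))) x" by (rule real_analytic_at_Re[OF F(3,1,2)])
      then show ?thesis
        by (rule real_analytic_at_cong[where d = "min d (min (x - a) (b - x))"]) (use F 2 in \<open>auto simp: G_def\<close>)
    next
      case 3
      have "real_analytic_at (\<lambda>t. Re (F1 (of_real t))) x"
        by (rule real_analytic_at_Re[OF 1(3,1) r1(2)]) (use x 3 in auto)
      then show ?thesis
        by (rule real_analytic_at_cong[where d = "min d1 (b - a)"]) (use 1 ab 3 in \<open>auto simp: G_def\<close>)
    qed
  qed
  then show ?thesis unfolding analytic_on_closed_interval_def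
    using r0(1) r1(1) by (intro exI[of _ "a - r0"] exI[of _ "b + r1"] exI[of _ G]) (auto simp: real_analytic_on_def G_def)
qed

text \<open>If x (u n) stayed away from x t, compactness would give a subsequence converging to some
  y. Passing to the limit in the comparison with the fixed competitor x t makes y a minimiser at t,
  so y = x t.\<close>

lemma unique_minimiser_continuous:
  fixes J :: "'a::metric_space \<Rightarrow> 'b::metric_space \<Rightarrow> real"
  assumes K: "compact K" and J: "continuous_on (T \<times> K) (\<lambda>(t, y). J t y)"
    and x: "\<And>t. t \<in> T \<Longrightarrow> x t \<in> K"
    and min: "\<And>t y. t \<in> T \<Longrightarrow> y \<in> K \<Longrightarrow> J t (x t) \<le> J t y"
    and uniq: "\<And>t y. t \<in> T \<Longrightarrow> y \<in> K \<Longrightarrow> J t y = J t (x t) \<Longrightarrow> y = x t"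
  shows "continuous_on T x"
  unfolding continuous_on_sequentially
proof (intro allI ballI impI, elim conjE)
  fix u t assume t: "t \<in> T" and u: "\<forall>n. u n \<in> T" "u \<longlonglongrightarrow> t"
  show "(x \<circ> u) \<longlonglongrightarrow> x t"
  proof (rule ccontr)
    assume "\<not> (x \<circ> u) \<longlonglongrightarrow> x t"
    then obtain e where e: "0 < e" "\<not> eventually (\<lambda>n. dist ((x \<circ> u) n) (x t) < e) sequentially"
      unfolding tendsto_iff by blast
    then have "infinite {n. \<not> dist ((x \<circ> u) n) (x t) < e}"
      by (simp add: frequently_def[symmetric] not_eventually INFM_iff_infinite cofinite_eq_sequentially[symmetric])
    from infinite_enumerate[OF this] have "\<exists>r::nat \<Rightarrow> nat. strict_mono r \<and> (\<forall>n. \<not> dist (x (u (r n))) (x t) < e)"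
      by simp
    then obtain r :: "nat \<Rightarrow> nat" where r: "strict_mono r" "\<And>n. \<not> dist (x (u (r n))) (x t) < e" by blast
    obtain y q where y: "y \<in> K" "strict_mono q" "((\<lambda>n. x (u (r n))) \<circ> q) \<longlonglongrightarrow> y"
      using K x u(1) unfolding compact_def by (metis (no_types, lifting))
    define w where "w n = u (r (q n))" for n
    have w: "w \<longlonglongrightarrow> t" "\<And>n. w n \<in> T"
      using LIMSEQ_subseq_LIMSEQ[OF u(2) strict_mono_o[OF r(1) y(2)]] u(1) by (auto simp: w_def[abs_def] comp_def)
    have xw: "(\<lambda>n. x (w n)) \<longlonglongrightarrow> y" using y(3) by (simp add: w_def comp_def)
    have "(\<lambda>n. J (w n) (x (w n))) \<longlonglongrightarrow> J t y"
      using continuous_on_tendsto_compose[OF J tendsto_Pair[OF w(1) xw]] t y(1) w(2) x by simp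
    moreover have "(\<lambda>n. J (w n) (x t)) \<longlonglongrightarrow> J t (x t)"
      using continuous_on_tendsto_compose[OF J tendsto_Pair[OF w(1) tendsto_const[of "x t"]]] t w(2) x by simp
    ultimately have "J t y \<le> J t (x t)"
      by (rule LIMSEQ_le) (use min w(2) x[OF t] in auto)
    then have "y = x t" using min[OF t y(1)] by (intro uniq t y) simp
    then have "eventually (\<lambda>n. dist (x (w n)) (x t) < e) sequentially"
      using xw e(1) unfolding tendsto_iff by blast
    then obtain n where "dist (x (w n)) (x t) < e" by (auto dest: eventually_happens)
    then show False using r(2)[of "q n"] by (simp add: w_def)
  qed
qed

section \<open>Families of potentials depending analytically on a parameter\<close>

locale analytic_family =
  fixes V :: "real \<Rightarrow> real \<Rightarrow> real" and t0 :: real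
    and W :: "(complex \<times> complex) set" and F :: "complex \<times> complex \<Rightarrow> complex"
  assumes t0_pos: "0 < t0"
    and F: "separately_holomorphic W F"
    and in_W: "\<And>x t. t \<in> {0..t0} \<Longrightarrow> (complex_of_real x, complex_of_real t) \<in> W"
    and F_real: "\<And>x t. t \<in> {0..t0} \<Longrightarrow> F (of_real x, of_real t) = of_real (V t x)"
begin

definition "V1 t x = Re (deriv1 F (of_real x, of_real t))"
definition "V2 t x = Re (deriv1 (deriv1 F) (of_real x, of_real t))"

lemma V1_derivative:
  assumes t: "t \<in> {0..t0}"
  shows "(V t has_real_derivative V1 t x) (at x)" "deriv1 F (of_real x, of_real t) = of_real (V1 t x)"
proof -
  have e: "deriv1 F (of_real x, of_real t) = deriv (\<lambda>w. F (w, of_real t)) (of_real x)"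
    by (simp only: deriv1_def fst_conv snd_conv)
  note d = real_restriction_derivative[OF separately_holomorphicD(1)[OF F in_W[OF t]] F_real[OF t], of x]
  show "(V t has_real_derivative V1 t x) (at x)" using d(1) unfolding V1_def e .
  show "deriv1 F (of_real x, of_real t) = of_real (V1 t x)" using d(2) unfolding V1_def e .
qed

lemma V2_derivative:
  assumes t: "t \<in> {0..t0}"
  shows "(V1 t has_real_derivative V2 t x) (at x)" "deriv1 (deriv1 F) (of_real x, of_real t) = of_real (V2 t x)"
proof -
  have e: "deriv1 (deriv1 F) (of_real x, of_real t) = deriv (\<lambda>w. deriv1 F (w, of_real t)) (of_real x)"
    by (simp only: deriv1_def[of "deriv1 F"] fst_conv snd_conv)
  note d = real_restriction_derivative[OF separately_holomorphicD(1)[OF separately_holomorphic_deriv1[OF F] in_W[OF t]] V1_derivative(2)[OF t], of x]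
  show "(V1 t has_real_derivative V2 t x) (at x)" using d(1) unfolding V2_def e .
  show "deriv1 (deriv1 F) (of_real x, of_real t) = of_real (V2 t x)" using d(2) unfolding V2_def e .
qed

lemma V2_continuous:
  assumes t: "t \<in> {0..t0}" shows "continuous_on UNIV (V2 t)"
proof -
  have c: "continuous_on W (deriv1 (deriv1 F))"
    by (rule continuous_deriv1[OF separately_holomorphic_deriv1[OF F]])
  have "continuous_on UNIV (\<lambda>x. deriv1 (deriv1 F) (complex_of_real x, complex_of_real t))"
  proof (rule continuous_on_compose2[OF c])
    show "continuous_on UNIV (\<lambda>x. (complex_of_real x, complex_of_real t))" by (intro continuous_intros)
    show "range (\<lambda>x. (complex_of_real x, complex_of_real t)) \<subseteq> W" using in_W[OF t] by blast
  qed
  then show ?thesis unfolding V2_def[abs_def] by (rule continuous_on_Re)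
qed

lemma V1_continuous:
  assumes t: "t \<in> {0..t0}" shows "continuous_on UNIV (V1 t)"
  by (rule DERIV_continuous_on, rule has_field_derivative_at_within, rule V2_derivative(1)[OF t])

lemma V_continuous:
  assumes t: "t \<in> {0..t0}" shows "continuous_on UNIV (V t)"
  by (rule DERIV_continuous_on, rule has_field_derivative_at_within, rule V1_derivative(1)[OF t])

lemma V_joint_continuous: "continuous_on ({0..t0} \<times> UNIV) (\<lambda>p. V (fst p) (snd p))"
proof -
  have c: "continuous_on W F" using F by (simp add: separately_holomorphic_def)
  have "continuous_on ({0..t0} \<times> UNIV) (\<lambda>p. F (complex_of_real (snd p), complex_of_real (fst p)))"
  proof (rule continuous_on_compose2[OF c])
    show "continuous_on ({0..t0} \<times> UNIV) (\<lambda>p. (complex_of_real (snd p), complex_of_real (fst p)))" by (intro continuous_intros)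
    show "(\<lambda>p. (complex_of_real (snd p), complex_of_real (fst p))) ` ({0..t0} \<times> UNIV) \<subseteq> W" using in_W by auto
  qed
  then have "continuous_on ({0..t0} \<times> UNIV) (\<lambda>p. Re (F (complex_of_real (snd p), complex_of_real (fst p))))"
    by (rule continuous_on_Re)
  moreover have "Re (F (complex_of_real (snd p), complex_of_real (fst p))) = V (fst p) (snd p)"
    if "p \<in> {0..t0} \<times> UNIV" for p
    using F_real[of "fst p" "snd p"] that by auto
  ultimately show ?thesis by (rule continuous_on_eq)
qed

end

section \<open>The minimiser as a function of the parameter\<close>

locale potential_family = analytic_family V t0 W F for V t0 W F +
  fixes C :: real
  assumes C_nonneg: "0 \<le> C"
    and growth: "\<And>x t. t \<in> {0..t0} \<Longrightarrow> 4 * ln (1 + \<bar>x\<bar>) - C \<le> V t x"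
    and soft: "\<And>t. t \<in> {0..t0} \<Longrightarrow> \<exists>a b h \<nu>. one_cut_data (V t) a b h \<nu> \<and> h a \<noteq> 0 \<and> h b \<noteq> 0"
begin

lemma confining:
  assumes t: "t \<in> {0..t0}" shows "confining_potential (V t) C"
  by (rule confining_potential.intro[OF V_continuous[OF t] growth[OF t] C_nonneg])

text \<open>Collects what is known at one parameter value, so that the pair can be picked by
  \<open>SOME\<close>. The support clause speaks of every equilibrium measure, as the final
  statement does; the last clause is the Hessian condition of
  \<open>endpoint_equations_solution\<close>.\<close>

definition nondegenerate_minimiser :: "real \<Rightarrow> real \<times> real \<Rightarrow> bool" where
  "nondegenerate_minimiser t p \<longleftrightarrow> (case p of (m, r) \<Rightarrow> 0 < r \<and>
     (\<forall>\<mu>. equilibrium_measure (V t) \<mu> \<longrightarrow> msupp \<mu> = {m - r..m + r}) \<and>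
     (\<forall>m' r'. 0 < r' \<longrightarrow> interval_energy (V t) m r \<le> interval_energy (V t) m' r') \<and>
     (\<forall>m' r'. 0 < r' \<longrightarrow> interval_energy (V t) m' r' = interval_energy (V t) m r \<longrightarrow> m' = m \<and> r' = r) \<and>
     integral {0..pi} (\<lambda>\<phi>. V1 t (m + r * cos \<phi>)) = 0 \<and>
     integral {0..pi} (\<lambda>\<phi>. cos \<phi> * V1 t (m + r * cos \<phi>)) = 2 * pi / r \<and>
     integral {0..pi} (\<lambda>\<phi>. V2 t (m + r * cos \<phi>)) * (integral {0..pi} (\<lambda>\<phi>. cos \<phi> * cos \<phi> * V2 t (m + r * cos \<phi>)) + 2 * pi / r\<^sup>2)
       \<noteq> (integral {0..pi} (\<lambda>\<phi>. cos \<phi> * V2 t (m + r * cos \<phi>)))\<^sup>2)"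

lemma nondegenerate_minimiser_exists:
  assumes t: "t \<in> {0..t0}" shows "\<exists>p. nondegenerate_minimiser t p"
proof -
  obtain a b h \<nu> where cut: "one_cut_data (V t) a b h \<nu>" "h a \<noteq> 0" "h b \<noteq> 0" using soft[OF t] by blast
  obtain \<rho> l where "soft_edge_equilibrium (V t) C \<rho> a b l" and law: "continuous_density.law \<rho> = \<nu>"
    using one_cut_soft_edge[OF confining[OF t] V1_derivative(1)[OF t] V2_derivative(1)[OF t] V2_continuous[OF t] cut] by blast
  then interpret E: soft_edge_equilibrium "V t" C \<rho> a b l by simp
  have "equilibrium_measure (V t) E.law" using cut(1) unfolding law one_cut_data_def by blast
  \<comment> \<open>Finite energy, which uniqueness of the support asks for, comes from the
    continuous density.\<close>
  then have "msupp \<mu> = msupp E.law" if "equilibrium_measure (V t) \<mu>" for \<mu>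
    by (rule E.equilibrium_msupp_unique[OF that]) (simp add: E.form_law_law)
  moreover have "msupp E.law = {E.mid - E.rad..E.mid + E.rad}"
    unfolding E.msupp_law by (simp add: E.mid_def E.rad_def field_simps)
  ultimately have s: "\<forall>\<mu>. equilibrium_measure (V t) \<mu> \<longrightarrow> msupp \<mu> = {E.mid - E.rad..E.mid + E.rad}" by metis
  note c = E.critical_point[OF V1_derivative(1)[OF t] V2_derivative(1)[OF t] V2_continuous[OF t]]
  have "nondegenerate_minimiser t (E.mid, E.rad)"
    unfolding nondegenerate_minimiser_def prod.case
    by (intro conjI allI impI E.rad_pos s[rule_format] E.interval_energy_min E.interval_energy_min_unique c; assumption)
  then show ?thesis ..
qed

definition minimiser :: "real \<Rightarrow> real \<times> real" where
  "minimiser t = (SOME p. nondegenerate_minimiser t p)"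

lemma minimiser: "t \<in> {0..t0} \<Longrightarrow> nondegenerate_minimiser t (minimiser t)"
  unfolding minimiser_def by (rule someI_ex) (rule nondegenerate_minimiser_exists)

lemma average_ge:
  fixes f :: "real \<Rightarrow> real"
  assumes "continuous_on UNIV f" "\<And>\<phi>. k \<le> f \<phi>"
  shows "k \<le> (\<integral>\<phi>. f \<phi> \<partial>angle)"
proof -
  have "(\<integral>\<phi>. k \<partial>angle) \<le> (\<integral>\<phi>. f \<phi> \<partial>angle)"
    by (rule Bochner_Integration.integral_mono) (use assms integrable_angle_continuous in auto)
  then show ?thesis by (simp add: angle.prob_space[simplified])
qed

text \<open>The minimiser is compared with the interval [-1, 1]. A small radius is excluded by -2 ln
  r and the lower bound on V, a large one because growth like 4 ln r beats 2 ln r, and a distant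
  midpoint because V is then large on the whole interval.\<close>

lemma minimiser_bounded:
  obtains r1 R where "0 < r1" "\<And>t. t \<in> {0..t0} \<Longrightarrow> minimiser t \<in> {-R..R} \<times> {r1..R}"
proof -
  have "continuous_on ({0..t0} \<times> {-1..1}) (\<lambda>p. V (fst p) (snd p))"
    by (rule continuous_on_subset[OF V_joint_continuous]) auto
  then have "bounded ((\<lambda>p. V (fst p) (snd p)) ` ({0..t0} \<times> {-1..1}))"
    by (intro compact_imp_bounded compact_continuous_image compact_Times) auto
  then obtain M where M: "\<And>t x. t \<in> {0..t0} \<Longrightarrow> \<bar>x\<bar> \<le> 1 \<Longrightarrow> \<bar>V t x\<bar> \<le> M"
    by (force simp: bounded_iff)
  \<comment> \<open>The bounds \<open>exp (- L / 2)\<close>, \<open>R1\<close> and the second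
    summand of \<open>R\<close> come from solving -C - 2 ln r \<le> M, 4 ln (r / 2) - C - 2 ln r
    \<le> M and 4 ln (1 + \<bar>m\<bar> - r) - C - 2 ln r \<le> M.\<close>
  define L where "L = M + C"
  define R1 where "R1 = exp ((L + 4 * ln 2) / 2)"
  define R where "R = R1 + exp ((L + 2 * ln R1) / 4)"
  have R1: "0 < R1" "R1 \<le> R" by (auto simp: R1_def R_def)
  have "minimiser t \<in> {-R..R} \<times> {exp (- L / 2)..R}" if t: "t \<in> {0..t0}" for t
  proof -
    obtain m r where p: "minimiser t = (m, r)" by (cases "minimiser t")
    have r: "0 < r" and min: "\<And>m' r'. 0 < r' \<Longrightarrow> interval_energy (V t) m r \<le> interval_energy (V t) m' r'"
      using minimiser[OF t] unfolding p nondegenerate_minimiser_def by auto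
    have vc: "continuous_on UNIV (\<lambda>\<phi>. V t (m' + r' * cos \<phi>))" for m' r'
      by (rule continuous_on_compose2[OF V_continuous[OF t]]) (auto intro!: continuous_intros)
    have "interval_energy (V t) m r \<le> interval_energy (V t) 0 1" by (rule min) simp
    also have "\<dots> \<le> M"
    proof -
      have "- M \<le> (\<integral>\<phi>. - V t (0 + 1 * cos \<phi>) \<partial>angle)"
        by (rule average_ge, rule continuous_on_minus[OF vc]) (use M[OF t] in \<open>auto simp: abs_le_iff\<close>)
      then show ?thesis by (simp add: interval_energy_def)
    qed
    finally have up: "interval_energy (V t) m r \<le> M" .
    have 1: "- C \<le> (\<integral>\<phi>. V t (m + r * cos \<phi>) \<partial>angle)"
    proof (rule average_ge[OF vc])
      fix \<phi>
      have "0 \<le> ln (1 + \<bar>m + r * cos \<phi>\<bar>)" by simp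
      then show "- C \<le> V t (m + r * cos \<phi>)" using growth[OF t, of "m + r * cos \<phi>"] by linarith
    qed
    have "- (L / 2) \<le> ln r" using up 1 unfolding interval_energy_def L_def by (simp add: field_simps)
    then have r1: "exp (- L / 2) \<le> r" using r by (simp add: ln_ge_iff)
    \<comment> \<open>The average of ln \<bar>m + r cos \<phi>\<bar> is the arcsine potential at 0.
      It is at least ln (r / 2) wherever the midpoint lies, because the Green function is
      nonnegative.\<close>
    have 2: "4 * ln (r / 2) - C \<le> (\<integral>\<phi>. V t (m + r * cos \<phi>) \<partial>angle)"
    proof -
      have "4 * ln (r / 2) - C \<le> 4 * (ln (r / 2) + green m r 0) - C" using green_nonneg[OF r, of m 0] by simp
      also have "\<dots> = (\<integral>\<phi>. 4 * ln \<bar>m + r * cos \<phi> - 0\<bar> - C \<partial>angle)"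
        using arcsine_potential_integrable(1)[OF r, of m 0] by (simp add: green_def angle.prob_space[simplified])
      also have "\<dots> \<le> (\<integral>\<phi>. V t (m + r * cos \<phi>) \<partial>angle)"
      proof (rule Bochner_Integration.integral_mono)
        fix \<phi>
        have "ln \<bar>x\<bar> \<le> ln (1 + \<bar>x\<bar>)" for x :: real by (cases "x = 0") auto
        then show "4 * ln \<bar>m + r * cos \<phi> - 0\<bar> - C \<le> V t (m + r * cos \<phi>)"
          using growth[OF t, of "m + r * cos \<phi>"] by (smt (verit) diff_zero)
      qed (use arcsine_potential_integrable(1)[OF r, of m 0] integrable_angle_continuous[OF vc] in auto)
      finally show ?thesis .
    qed
    have "2 * ln r \<le> L + 4 * ln 2" using up 2 r unfolding interval_energy_def L_def by (simp add: ln_div)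
    then have "ln r \<le> (L + 4 * ln 2) / 2" by simp
    then have rR: "r \<le> R1" using r unfolding R1_def by (metis exp_le_cancel_iff exp_ln)
    have mR: "\<bar>m\<bar> \<le> R"
    proof (cases "\<bar>m\<bar> \<le> r")
      case False
      have "4 * ln (1 + (\<bar>m\<bar> - r)) - C \<le> (\<integral>\<phi>. V t (m + r * cos \<phi>) \<partial>angle)"
      proof (rule average_ge[OF vc])
        fix \<phi>
        have "\<bar>r * cos \<phi>\<bar> \<le> r" using r by (simp add: abs_mult mult_left_le)
        then have "1 + (\<bar>m\<bar> - r) \<le> 1 + \<bar>m + r * cos \<phi>\<bar>" by linarith
        then have "ln (1 + (\<bar>m\<bar> - r)) \<le> ln (1 + \<bar>m + r * cos \<phi>\<bar>)" using False by (intro ln_mono) auto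
        then show "4 * ln (1 + (\<bar>m\<bar> - r)) - C \<le> V t (m + r * cos \<phi>)" using growth[OF t, of "m + r * cos \<phi>"] by linarith
      qed
      moreover have "ln r \<le> ln R1" using r rR by (intro ln_mono) auto
      ultimately have "ln (1 + (\<bar>m\<bar> - r)) \<le> (L + 2 * ln R1) / 4"
        using up unfolding interval_energy_def L_def by argo
      then have "exp (ln (1 + (\<bar>m\<bar> - r))) \<le> exp ((L + 2 * ln R1) / 4)" by (subst exp_le_cancel_iff)
      moreover have "exp (ln (1 + (\<bar>m\<bar> - r))) = 1 + (\<bar>m\<bar> - r)" using False by (intro exp_ln) simp
      ultimately have "1 + (\<bar>m\<bar> - r) \<le> exp ((L + 2 * ln R1) / 4)" by simp
      then show ?thesis using rR unfolding R_def by linarith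
    qed (use rR R1 in linarith)
    show ?thesis using r1 rR mR R1 by (auto simp: p abs_le_iff)
  qed
  then show ?thesis by (intro that[of "exp (- L / 2)" R]) auto
qed

lemma minimiser_continuous: "continuous_on {0..t0} minimiser"
proof -
  obtain r1 R where R: "0 < r1" "\<And>t. t \<in> {0..t0} \<Longrightarrow> minimiser t \<in> {-R..R} \<times> {r1..R}"
    by (rule minimiser_bounded) blast
  define K where "K = {-R..R} \<times> {r1..R}"
  define J where "J t p = interval_energy (V t) (fst p) (snd p)" for t p
  show ?thesis
  proof (rule unique_minimiser_continuous[of K _ J])
    show "compact K" unfolding K_def by (intro compact_Times) auto
    have "continuous_on (({0..t0} \<times> K) \<times> cbox 0 pi) (\<lambda>q. V (fst (fst q)) (fst (snd (fst q)) + snd (snd (fst q)) * cos (snd q)))"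
      by (rule continuous_on_compose2[OF V_joint_continuous, where f = "\<lambda>q. (fst (fst q), fst (snd (fst q)) + snd (snd (fst q)) * cos (snd q))", unfolded fst_conv snd_conv])
        (auto intro!: continuous_intros)
    then have "continuous_on ({0..t0} \<times> K) (\<lambda>q. integral (cbox 0 pi) (\<lambda>\<phi>. V (fst q) (fst (snd q) + snd (snd q) * cos \<phi>)))"
      by (intro integral_continuous_on_param) (simp add: split_beta)
    moreover have "continuous_on ({0..t0} \<times> K) (\<lambda>q. ln (snd (snd q)))"
      using R(1) by (intro continuous_intros) (auto simp: K_def)
    ultimately have c: "continuous_on ({0..t0} \<times> K) (\<lambda>q. integral (cbox 0 pi) (\<lambda>\<phi>. V (fst q) (fst (snd q) + snd (snd q) * cos \<phi>)) / pi - 2 * ln (snd (snd q)))"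
      by (intro continuous_on_diff continuous_on_divide continuous_on_mult continuous_on_const) auto
    show "continuous_on ({0..t0} \<times> K) (\<lambda>(t, y). J t y)"
      by (rule continuous_on_eq[OF c]) (auto simp: J_def interval_energy_eq V_continuous)
    show "minimiser t \<in> K" if "t \<in> {0..t0}" for t using R(2)[OF that] by (simp add: K_def)
    fix t y assume t: "t \<in> {0..t0}" and y: "y \<in> K"
    have y0: "0 < snd y" using y R(1) by (auto simp: K_def)
    show "J t (minimiser t) \<le> J t y"
      using minimiser[OF t] y0 unfolding nondegenerate_minimiser_def J_def by (auto split: prod.splits)
    show "y = minimiser t" if "J t y = J t (minimiser t)"
      using minimiser[OF t] y0 that unfolding nondegenerate_minimiser_def J_def
      by (cases y; cases "minimiser t") auto
  qed
qed

text \<open>At real points the complexified averages are the real ones, which carries the clauses of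
  \<open>nondegenerate_minimiser\<close> into the hypotheses of
  \<open>endpoint_equations_solution\<close>.\<close>

lemma circle_integral_real:
  fixes c g :: "real \<Rightarrow> real"
  assumes G: "\<And>x. G (of_real x, of_real t) = of_real (g x)" and c: "continuous_on UNIV c" and g: "continuous_on UNIV g"
  shows "circle_integral G (\<lambda>\<phi>. of_real (c \<phi>)) (of_real m, of_real r, of_real t) =
    of_real (integral {0..pi} (\<lambda>\<phi>. c \<phi> * g (m + r * cos \<phi>)))"
proof -
  have "continuous_on {0..pi} (\<lambda>\<phi>. g (m + r * cos \<phi>))"
    by (rule continuous_on_compose2[OF g]) (auto intro!: continuous_intros)
  then have i: "(\<lambda>\<phi>. c \<phi> * g (m + r * cos \<phi>)) integrable_on {0..pi}"
    by (intro integrable_continuous_real continuous_on_mult continuous_on_subset[OF c]) auto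
  have "circle_point (of_real m, of_real r, of_real t) \<phi> = (of_real (m + r * cos \<phi>), of_real t)" for \<phi>
    by (simp add: circle_point_def)
  then have "circle_integral G (\<lambda>\<phi>. of_real (c \<phi>)) (of_real m, of_real r, of_real t) =
    integral {0..pi} (\<lambda>\<phi>. of_real (c \<phi> * g (m + r * cos \<phi>)))"
    unfolding circle_integral_def by (simp only: G of_real_mult)
  also have "\<dots> = of_real (integral {0..pi} (\<lambda>\<phi>. c \<phi> * g (m + r * cos \<phi>)))"
    using integral_linear[OF i bounded_linear_of_real[where 'a = complex]] by (simp only: comp_def)
  finally show ?thesis .
qed

lemma endpoint_equations_at_minimiser:
  assumes t: "t \<in> {0..t0}" and p: "minimiser t = (m, r)"
  shows "circle_integral (deriv1 F) (\<lambda>_. 1) (of_real m, of_real r, of_real t) = 0"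
    and "circle_integral (deriv1 F) (\<lambda>\<phi>. of_real (cos \<phi>)) (of_real m, of_real r, of_real t) = 2 * of_real pi / of_real r"
    and "circle_integral (deriv1 (deriv1 F)) (\<lambda>_. 1) (of_real m, of_real r, of_real t) *
      (circle_integral (deriv1 (deriv1 F)) (\<lambda>\<phi>. of_real (cos \<phi>) * of_real (cos \<phi>)) (of_real m, of_real r, of_real t) + 2 * of_real pi / (of_real r)\<^sup>2)
      \<noteq> (circle_integral (deriv1 (deriv1 F)) (\<lambda>\<phi>. of_real (cos \<phi>)) (of_real m, of_real r, of_real t))\<^sup>2"
proof -
  let ?F2 = "deriv1 (deriv1 F)" and ?x = "(complex_of_real m, complex_of_real r, complex_of_real t)"
  let ?v1 = "\<lambda>\<phi>. V1 t (m + r * cos \<phi>)" and ?v2 = "\<lambda>\<phi>. V2 t (m + r * cos \<phi>)"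
  have "nondegenerate_minimiser t (m, r)" using minimiser[OF t] unfolding p .
  then have nd1: "integral {0..pi} (\<lambda>\<phi>. ?v1 \<phi>) = 0"
    and nd2: "integral {0..pi} (\<lambda>\<phi>. cos \<phi> * ?v1 \<phi>) = 2 * pi / r"
    and nd3: "integral {0..pi} (\<lambda>\<phi>. ?v2 \<phi>) * (integral {0..pi} (\<lambda>\<phi>. cos \<phi> * cos \<phi> * ?v2 \<phi>) + 2 * pi / r\<^sup>2)
       \<noteq> (integral {0..pi} (\<lambda>\<phi>. cos \<phi> * ?v2 \<phi>))\<^sup>2"
    unfolding nondegenerate_minimiser_def prod.case by blast+
  have c: "continuous_on UNIV (\<lambda>\<phi>::real. 1::real)" "continuous_on UNIV (\<lambda>\<phi>::real. cos \<phi>)" "continuous_on UNIV (\<lambda>\<phi>::real. cos \<phi> * cos \<phi>)"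
    by (intro continuous_intros)+
  note 1 = circle_integral_real[OF V1_derivative(2)[OF t] _ V1_continuous[OF t]]
  note 2 = circle_integral_real[OF V2_derivative(2)[OF t] _ V2_continuous[OF t]]
  show "circle_integral (deriv1 F) (\<lambda>_. 1) ?x = 0"
    using 1[OF c(1), of m r] unfolding mult_1 nd1 of_real_1 of_real_0 .
  show "circle_integral (deriv1 F) (\<lambda>\<phi>. of_real (cos \<phi>)) ?x = 2 * of_real pi / of_real r"
    using 1[OF c(2), of m r] unfolding nd2 of_real_divide of_real_mult of_real_numeral .
  have A: "circle_integral ?F2 (\<lambda>_. 1) ?x = of_real (integral {0..pi} (\<lambda>\<phi>. ?v2 \<phi>))"
    using 2[OF c(1), of m r] unfolding mult_1 of_real_1 .
  have B: "circle_integral ?F2 (\<lambda>\<phi>. of_real (cos \<phi>)) ?x = of_real (integral {0..pi} (\<lambda>\<phi>. cos \<phi> * ?v2 \<phi>))"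
    by (rule 2[OF c(2)])
  have D: "circle_integral ?F2 (\<lambda>\<phi>. of_real (cos \<phi>) * of_real (cos \<phi>)) ?x = of_real (integral {0..pi} (\<lambda>\<phi>. cos \<phi> * cos \<phi> * ?v2 \<phi>))"
    using 2[OF c(3), of m r] unfolding of_real_mult .
  have e: "complex_of_real x * (of_real y + 2 * of_real pi / (of_real r)\<^sup>2) = of_real (x * (y + 2 * pi / r\<^sup>2))" for x y by simp
  have e2: "(complex_of_real z)\<^sup>2 = of_real (z\<^sup>2)" for z by simp
  show "circle_integral ?F2 (\<lambda>_. 1) ?x *
      (circle_integral ?F2 (\<lambda>\<phi>. of_real (cos \<phi>) * of_real (cos \<phi>)) ?x + 2 * of_real pi / (of_real r)\<^sup>2)
      \<noteq> (circle_integral ?F2 (\<lambda>\<phi>. of_real (cos \<phi>)) ?x)\<^sup>2"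
    unfolding A B D e unfolding e2 of_real_eq_iff by (rule nd3)
qed

text \<open>By \<open>minimiser_continuous\<close> the minimisers near t lie in the neighbourhood
  where the endpoint equations have only the holomorphic solution, and they satisfy these equations.
  Continuity is relative to [0, t_0], so at its ends the identification is one-sided, while the
  holomorphic branch extends to both sides.\<close>

lemma minimiser_locally_holomorphic:
  assumes t: "t \<in> {0..t0}"
  obtains T mf rf d where "open T" "complex_of_real t \<in> T" "mf holomorphic_on T" "rf holomorphic_on T" "0 < d"
    "\<And>s. s \<in> {0..t0} \<Longrightarrow> \<bar>s - t\<bar> < d \<Longrightarrow> mf (of_real s) = of_real (fst (minimiser s)) \<and> rf (of_real s) = of_real (snd (minimiser s))"
proof -
  obtain m r where p: "minimiser t = (m, r)" by (cases "minimiser t")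
  have r: "0 < r" using minimiser[OF t] unfolding p nondegenerate_minimiser_def by auto
  define x where "x s = (complex_of_real (fst (minimiser s)), complex_of_real (snd (minimiser s)), complex_of_real s)" for s
  have xt: "x t = (of_real m, of_real r, of_real t)" by (simp add: x_def p)
  have "\<exists>T mf rf U. open T \<and> complex_of_real t \<in> T \<and> mf holomorphic_on T \<and> rf holomorphic_on T \<and> open U \<and> (complex_of_real m, complex_of_real r, complex_of_real t) \<in> U \<and>
     (\<forall>m r s. (m, r, s) \<in> U \<longrightarrow> circle_integral (deriv1 F) (\<lambda>_. 1) (m, r, s) = 0 \<longrightarrow>
        circle_integral (deriv1 F) (\<lambda>\<phi>. of_real (cos \<phi>)) (m, r, s) = 2 * of_real pi / r \<longrightarrow> s \<in> T \<and> mf s = m \<and> rf s = r)"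
  proof (rule endpoint_equations_solution[OF separately_holomorphic_deriv1[OF F]])
    show "circle_point (of_real m, of_real r, of_real t) \<phi> \<in> W" for \<phi>
      using in_W[OF t, of "m + r * cos \<phi>"] by (simp add: circle_point_def)
    show "complex_of_real r \<noteq> 0" using r by simp
  qed (rule endpoint_equations_at_minimiser[OF t p])+
  then obtain T mf rf U where T: "open T" "complex_of_real t \<in> T" "mf holomorphic_on T" "rf holomorphic_on T"
    and U: "open U" "x t \<in> U" and sol: "\<And>m r s. (m, r, s) \<in> U \<Longrightarrow> circle_integral (deriv1 F) (\<lambda>_. 1) (m, r, s) = 0 \<Longrightarrow>
        circle_integral (deriv1 F) (\<lambda>\<phi>. of_real (cos \<phi>)) (m, r, s) = 2 * of_real pi / r \<Longrightarrow> s \<in> T \<and> mf s = m \<and> rf s = r"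
    unfolding xt by blast
  have "continuous_on {0..t0} x"
    unfolding x_def[abs_def] by (intro continuous_intros minimiser_continuous)
  then have "continuous (at t within {0..t0}) x" using t by (simp add: continuous_on_eq_continuous_within)
  then have "eventually (\<lambda>s. x s \<in> U) (at t within {0..t0})"
    unfolding continuous_within using U by (rule topological_tendstoD)
  then obtain d where d: "0 < d" "\<And>s. s \<in> {0..t0} \<Longrightarrow> s \<noteq> t \<Longrightarrow> dist s t < d \<Longrightarrow> x s \<in> U"
    unfolding eventually_at by blast
  have "mf (of_real s) = of_real (fst (minimiser s)) \<and> rf (of_real s) = of_real (snd (minimiser s))"
    if s: "s \<in> {0..t0}" "\<bar>s - t\<bar> < d" for s
  proof -
    have xU: "x s \<in> U"
    proof (cases "s = t")
      case False
      then show ?thesis using s by (intro d(2)) (simp_all add: dist_real_def)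
    qed (use U in simp)
    obtain m' r' where p': "minimiser s = (m', r')" by (cases "minimiser s")
    have "(complex_of_real m', complex_of_real r', complex_of_real s) \<in> U"
      using xU unfolding x_def p' fst_conv snd_conv .
    from sol[OF this endpoint_equations_at_minimiser(1,2)[OF s(1) p']]
    show ?thesis unfolding p' fst_conv snd_conv by blast
  qed
  then show ?thesis using T d(1) by (intro that[of T mf rf d])
qed

lemma endpoints_analytic:
  "\<exists>A B. analytic_on_closed_interval A 0 t0 \<and> analytic_on_closed_interval B 0 t0 \<and>
    (\<forall>t\<in>{0..t0}. \<forall>\<nu>. equilibrium_measure (V t) \<nu> \<longrightarrow> msupp \<nu> = {A t..B t})"
proof -
  define A where "A t = fst (minimiser t) - snd (minimiser t)" for t
  define B where "B t = fst (minimiser t) + snd (minimiser t)" for t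
  \<comment> \<open>The choices \<sigma> = -1 and \<sigma> = 1 give the left and the right
    endpoint.\<close>
  have loc: "\<exists>F T d. open T \<and> complex_of_real t \<in> T \<and> F holomorphic_on T \<and> 0 < d \<and>
      (\<forall>y\<in>{0..t0}. \<bar>y - t\<bar> < d \<longrightarrow> fst (minimiser y) + \<sigma> * snd (minimiser y) = Re (F (of_real y)))"
    if t: "t \<in> {0..t0}" for t \<sigma>
  proof (rule minimiser_locally_holomorphic[OF t])
    fix T mf rf d
    assume T: "open T" "complex_of_real t \<in> T" "mf holomorphic_on T" "rf holomorphic_on T" "0 < (d::real)"
      and eq: "\<And>s. s \<in> {0..t0} \<Longrightarrow> \<bar>s - t\<bar> < d \<Longrightarrow> mf (of_real s) = of_real (fst (minimiser s)) \<and> rf (of_real s) = of_real (snd (minimiser s))"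
    have "(\<lambda>z. mf z + of_real \<sigma> * rf z) holomorphic_on T" by (intro holomorphic_intros T)
    moreover have "fst (minimiser y) + \<sigma> * snd (minimiser y) = Re (mf (of_real y) + of_real \<sigma> * rf (of_real y))"
      if "y \<in> {0..t0}" "\<bar>y - t\<bar> < d" for y
      using eq[OF that] by simp
    ultimately show "\<exists>F T d. open T \<and> complex_of_real t \<in> T \<and> F holomorphic_on T \<and> 0 < d \<and>
      (\<forall>y\<in>{0..t0}. \<bar>y - t\<bar> < d \<longrightarrow> fst (minimiser y) + \<sigma> * snd (minimiser y) = Re (F (of_real y)))"
      using T by (intro exI[of _ "\<lambda>z. mf z + of_real \<sigma> * rf z"] exI[of _ T] exI[of _ d]) simp
  qed
  have "analytic_on_closed_interval A 0 t0" "analytic_on_closed_interval B 0 t0"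
    using analytic_on_closed_interval_glue[OF t0_pos loc[of _ "-1"]] analytic_on_closed_interval_glue[OF t0_pos loc[of _ 1]]
    unfolding A_def[abs_def] B_def[abs_def] by simp_all
  moreover have "msupp \<nu> = {A t..B t}" if t: "t \<in> {0..t0}" and "equilibrium_measure (V t) \<nu>" for t \<nu>
    using minimiser[OF t] that(2) unfolding nondegenerate_minimiser_def A_def B_def by (auto split: prod.splits)
  ultimately show ?thesis by blast
qed

end

theorem theorem8p1:
  fixes V :: "real \<Rightarrow> real \<Rightarrow> real"  \<comment> \<open>V t x = V(x;t)\<close>
    and t0 :: real
  assumes t0_pos: "0 < t0"
    and analytic: "\<exists>\<Omega> W (F :: complex \<times> complex \<Rightarrow> complex).
            open \<Omega> \<and> connected \<Omega> \<and> range complex_of_real \<subseteq> \<Omega> \<and>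
            open W \<and> \<Omega> \<times> (complex_of_real ` {0..t0}) \<subseteq> W \<and>
            continuous_on W F \<and>
            (\<forall>(z, s)\<in>W. (\<lambda>w. F (w, s)) field_differentiable at z \<and>
                         (\<lambda>w. F (z, w)) field_differentiable at s) \<and>
            (\<forall>x t. t \<in> {0..t0} \<longrightarrow> F (complex_of_real x, complex_of_real t) = complex_of_real (V t x))"
    and growth: "filterlim (\<lambda>x::real. Inf ((\<lambda>t. V t x) ` {0..t0}) / ln \<bar>x\<bar>) at_top at_infinity"
    and regular: "\<forall>t\<in>{0<..t0}. one_cut_regular (V t)"
    and singular: "one_cut_singular (V 0)"
    and h_ends: "\<exists>a b h \<nu>. one_cut_data (V 0) a b h \<nu> \<and> h a \<noteq> 0 \<and> h b \<noteq> 0"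
  shows "\<exists>A B :: real \<Rightarrow> real.
           analytic_on_closed_interval A 0 t0 \<and> analytic_on_closed_interval B 0 t0 \<and>
           (\<forall>t\<in>{0..t0}. \<forall>\<nu>. equilibrium_measure (V t) \<nu> \<longrightarrow> msupp \<nu> = {A t..B t})"
proof -
  from analytic obtain \<Omega> W and F :: "complex \<times> complex \<Rightarrow> complex"
    where H: "open \<Omega> \<and> connected \<Omega> \<and> range complex_of_real \<subseteq> \<Omega> \<and>
            open W \<and> \<Omega> \<times> (complex_of_real ` {0..t0}) \<subseteq> W \<and>
            continuous_on W F \<and>
            (\<forall>(z, s)\<in>W. (\<lambda>w. F (w, s)) field_differentiable at z \<and>
                         (\<lambda>w. F (z, w)) field_differentiable at s) \<and>
            (\<forall>x t. t \<in> {0..t0} \<longrightarrow> F (complex_of_real x, complex_of_real t) = complex_of_real (V t x))"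
    by (elim exE)
  interpret analytic_family V t0 W F
  proof
    show "separately_holomorphic W F" unfolding separately_holomorphic_def by (intro conjI; rule H[THEN conjunct2, THEN conjunct2, THEN conjunct2, THEN conjunct1]
      H[THEN conjunct2, THEN conjunct2, THEN conjunct2, THEN conjunct2, THEN conjunct2, THEN conjunct1]
      H[THEN conjunct2, THEN conjunct2, THEN conjunct2, THEN conjunct2, THEN conjunct2, THEN conjunct2, THEN conjunct1])
    fix x t assume t: "t \<in> {0..t0}"
    have "complex_of_real x \<in> \<Omega>" using H[THEN conjunct2, THEN conjunct2, THEN conjunct1] by (rule subsetD) (rule rangeI)
    then have "(complex_of_real x, complex_of_real t) \<in> \<Omega> \<times> (complex_of_real ` {0..t0})" using t by (intro SigmaI imageI)
    then show "(complex_of_real x, complex_of_real t) \<in> W"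
      by (rule subsetD[OF H[THEN conjunct2, THEN conjunct2, THEN conjunct2, THEN conjunct2, THEN conjunct1]])
    show "F (complex_of_real x, complex_of_real t) = complex_of_real (V t x)"
      by (rule H[THEN conjunct2, THEN conjunct2, THEN conjunct2, THEN conjunct2, THEN conjunct2, THEN conjunct2, THEN conjunct2, rule_format, OF t])
  qed (rule t0_pos)
  \<comment> \<open>For \<bar>x\<bar> \<ge> 2 one has ln (1 + \<bar>x\<bar>) \<le> 2 ln
    \<bar>x\<bar>, so a ratio of 8 yields the factor 4 demanded by \<open>potential_family\<close>;
    this is also why \<open>R\<close> is at least 2.\<close>
  have "eventually (\<lambda>x::real. 8 \<le> Inf ((\<lambda>t. V t x) ` {0..t0}) / ln \<bar>x\<bar>) at_infinity"
    using growth unfolding filterlim_at_top by blast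
  then obtain R0 where R0: "\<And>x::real. R0 \<le> \<bar>x\<bar> \<Longrightarrow> 8 \<le> Inf ((\<lambda>t. V t x) ` {0..t0}) / ln \<bar>x\<bar>"
    unfolding eventually_at_infinity by auto
  define R where "R = max R0 2"
  have "compact ({0..t0} \<times> {-R..R})" by (intro compact_Times) auto
  then have "bounded ((\<lambda>p. V (fst p) (snd p)) ` ({0..t0} \<times> {-R..R}))"
    by (intro compact_imp_bounded compact_continuous_image continuous_on_subset[OF V_joint_continuous]) auto
  then obtain M where M: "0 < M" "\<And>t x. t \<in> {0..t0} \<Longrightarrow> x \<in> {-R..R} \<Longrightarrow> \<bar>V t x\<bar> \<le> M"
    unfolding bounded_pos by force
  \<comment> \<open>On [-R, R] the summand M absorbs the potential and the other one absorbs the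
    logarithm; further out it is enough that \<open>C\<close> is nonnegative.\<close>
  define C where "C = M + 4 * ln (1 + R)"
  have "potential_family V t0 W F C"
  proof
    show "0 \<le> C" using M(1) by (simp add: C_def R_def)
    show "4 * ln (1 + \<bar>x\<bar>) - C \<le> V t x" if t: "t \<in> {0..t0}" for x t
    proof (cases "\<bar>x\<bar> \<le> R")
      case True
      then have "ln (1 + \<bar>x\<bar>) \<le> ln (1 + R)" by (intro ln_mono) auto
      moreover have "\<bar>V t x\<bar> \<le> M" using True by (intro M t) auto
      ultimately show ?thesis unfolding C_def by linarith
    next
      case False
      then have x: "2 \<le> \<bar>x\<bar>" "R0 \<le> \<bar>x\<bar>" by (auto simp: R_def)
      have cx: "continuous_on {0..t0} (\<lambda>t. V t x)"
      proof -
        have "continuous_on {0..t0} (\<lambda>t. (t, x))" by (intro continuous_intros)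
        from continuous_on_compose2[OF V_joint_continuous this] show ?thesis by auto
      qed
      \<comment> \<open>A real infimum is a lower bound only for a set bounded below, which holds
        here by continuity in t on a compact interval.\<close>
      have "bdd_below ((\<lambda>t. V t x) ` {0..t0})"
        by (intro bounded_imp_bdd_below compact_imp_bounded compact_continuous_image cx) simp
      then have "Inf ((\<lambda>t. V t x) ` {0..t0}) \<le> V t x" using t by (intro cInf_lower) auto
      moreover have "0 < ln \<bar>x\<bar>" using x by simp
      then have "8 * ln \<bar>x\<bar> \<le> Inf ((\<lambda>t. V t x) ` {0..t0})" using R0[OF x(2)] by (simp add: pos_le_divide_eq)
      moreover have "ln (1 + \<bar>x\<bar>) \<le> ln (\<bar>x\<bar> * \<bar>x\<bar>)"
      proof (rule ln_mono)
        have "2 * \<bar>x\<bar> \<le> \<bar>x\<bar> * \<bar>x\<bar>" using x by (intro mult_right_mono) auto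
        then show "1 + \<bar>x\<bar> \<le> \<bar>x\<bar> * \<bar>x\<bar>" using x by linarith
      qed auto
      moreover have "ln (\<bar>x\<bar> * \<bar>x\<bar>) = 2 * ln \<bar>x\<bar>" using x by (subst ln_mult) auto
      moreover have "0 \<le> C" using M(1) by (simp add: C_def R_def)
      ultimately show ?thesis by linarith
    qed
    show "\<exists>a b h \<nu>. one_cut_data (V t) a b h \<nu> \<and> h a \<noteq> 0 \<and> h b \<noteq> 0" if t: "t \<in> {0..t0}" for t
    proof (cases "t = 0")
      case False
      then have "one_cut_regular (V t)" using regular t by simp
      then obtain a b h \<nu> where d: "one_cut_data (V t) a b h \<nu>" "\<forall>x\<in>{a..b}. h x > 0"
        unfolding one_cut_regular_def by blast
      then have "a < b" by (simp add: one_cut_data_def)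
      then have "a \<in> {a..b}" "b \<in> {a..b}" by auto
      then have "h a > 0" "h b > 0" using d(2) by blast+
      then show ?thesis using d(1) by (metis less_irrefl)
    qed (use h_ends in simp)
  qed
  then interpret potential_family V t0 W F C .
  show ?thesis by (rule endpoints_analytic)
qed

end
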